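(* Let $C$ be a diamond category and let $\mathcal{L}$ be a level of $C$. For each $G\in\mathcal{L}$, let $M_G$ be a real number so that $(M_G)_G$ is well-behaved at $\mathcal{L}$. For $F\in\mathcal{L}$ set $v_{\mathcal{L},F}:=\sum_{G\in\mathcal{L}}\frac{\hat{\mu}(F,G)}{|\mathrm{Aut}(G)|}M_G$. (Existence) A measure $\nu_{\mathcal{L}}$ on $\mathcal{L}$ with $G$-moment $M_G$ for all $G\in\mathcal{L}$ exists if and only if $v_{\mathcal{L},F}\ge 0$ for all $F\in\mathcal{L}$. (Uniqueness) If such a measure exists, then it is unique and $\nu_{\mathcal{L}}(\{F\})=v_{\mathcal{L},F}$ for all $F\in\mathcal{L}$. (Robustness) If $\nu^t_{\mathcal{L}}$ ($t=1,2,\dots$) are measures on $\mathcal{L}$ such that for each $G\in\mathcal{L}$, $$\lim_{t\to\infty}\int_{F\in\mathcal{L}}|\mathrm{Epi}(F,G)|\,d\nu^t_{\mathcal{L}}=M_G,$$ then for every $F\in\mathcal{L}$ we have $\lim_{t\to\infty}\nu^t_{\mathcal{L}}(\{F\})=v_{\mathcal{L},F}$.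
   Context: Category notions. Let $C$ be a small category. A quotient of an object $G$ is a pair $(F,\pi)$ of an object $F$ and an epimorphism $\pi:G\to F$; quotients $(F,\pi),(F',\pi')$ are isomorphic if there is an isomorphism $\rho:F\to F'$ with $\pi'=\rho\pi$. Isomorphism classes of quotients of $G$ form a poset, where $H\ge F$ if there is $h:H\to F$ compatible with the morphisms from $G$; joins $\vee$ and meets $\wedge$ of quotients of $G$ are taken in this poset. A lattice (poset in which any two elements have a join and a meet) is modular if $a\le b$ implies $a\vee(x\wedge b)=(a\vee x)\wedge b$ for all $x$. For $F$ a quotient of $G$, $[F,G]$ is the poset of isomorphism classes of quotients of $G$ that are $\ge F$. An object is minimal if it has only one quotient (itself). A set $\mathcal{S}$ of objects, stable under isomorphism (equivalently a set of isomorphism classes), is downward-closed if every quotient of an object of $\mathcal{S}$ is in $\mathcal{S}$; it is join-closed if whenever $H,F\in\mathcal{S}$ are quotients of some object $G$ and $H\vee F$ exists, $H\vee F\in\mathcal{S}$. A formation is a downward-closed join-closed set of isomorphism classes containing every minimal object. A level is a set of isomorphism classes generated by a finite set $B$ of isomorphism classes, i.e. the smallest downward-closed join-closed set containing $B$ and every minimal object. An epimorphism $G\to F$ is simple if it is not an isomorphism and $[F,G]$ contains only $F$ and $G$. A diamond category is a small category $C$ such that: (1) for each object $G$, the set of isomorphism classes of quotients of $G$ is a finite modular lattice; (2) each object has finite automorphism group; (3) for each level $\mathcal{L}$ and each $G\in\mathcal{L}$, there are finitely many elements of $\mathcal{L}$ with a simple epimorphism to $G$; (4) $C$ has at most countably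 many isomorphism classes of minimal objects. Moment notions. $\mathrm{Epi}(G,F)$ is the set of epimorphisms $G\to F$. Sums over objects are over isomorphism classes; a sum being finite includes the claim that only countably many terms are non-zero. For an epimorphism $\pi:G\to F$, $\mu(\pi)=\mu(F,G)$ is the M\"obius function of the poset of quotients of $G$, evaluated at the quotients $(F,\pi)$ and $G$; $\hat{\mu}(F,G)=\sum_{\pi\in\mathrm{Epi}(G,F)/\mathrm{Aut}(F)}\mu(\pi)$; and $Z(\pi)$ is the number of $H\in[F,G]$ with $H\vee(K_1\wedge K_2)=(H\vee K_1)\wedge(H\vee K_2)$ for all $K_1,K_2\in[F,G]$. A tuple $(M_G)_G$ of reals is well-behaved at a formation $\mathcal{W}$ if for all $F\in\mathcal{W}$, $\sum_{G\in\mathcal{W}}\sum_{\pi\in\mathrm{Epi}(G,F)}\frac{|\mu(\pi)|}{|\mathrm{Aut}(G)|}Z(\pi)^3|M_G|<\infty$. Measures on $\mathcal{L}$ are for the discrete $\sigma$-algebra. The $G$-moment of a measure $\nu$ on a set of isomorphism classes is $\int_F|\mathrm{Epi}(F,G)|\,d\nu$. *)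

theory Defs
  imports "HOL-Analysis.Analysis" "HOL-Algebra.Lattice"
begin

section \<open>Small categories\<close>

text \<open>Objects and arrows each form a set; \<open>Comp C g f\<close> is the composite \<open>g\<close> after \<open>f\<close>, meaningful
  when \<open>Cod C f = Dom C g\<close>.\<close>

record ('o, 'm) category =
  Obj :: "'o set"
  Arr :: "'m set"
  Dom :: "'m \<Rightarrow> 'o"
  Cod :: "'m \<Rightarrow> 'o"
  Ident :: "'o \<Rightarrow> 'm"
  Comp :: "'m \<Rightarrow> 'm \<Rightarrow> 'm"

definition Hom :: "('o, 'm) category \<Rightarrow> 'o \<Rightarrow> 'o \<Rightarrow> 'm set" where
  "Hom C X Y = {f \<in> Arr C. Dom C f = X \<and> Cod C f = Y}"

locale small_category =
  fixes C :: "('o, 'm) category"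
  assumes Dom_in_Obj: "f \<in> Arr C \<Longrightarrow> Dom C f \<in> Obj C"
    and Cod_in_Obj: "f \<in> Arr C \<Longrightarrow> Cod C f \<in> Obj C"
    and Ident_in_Hom: "X \<in> Obj C \<Longrightarrow> Ident C X \<in> Hom C X X"
    and Comp_in_Hom: "\<lbrakk>f \<in> Hom C X Y; g \<in> Hom C Y Z\<rbrakk> \<Longrightarrow> Comp C g f \<in> Hom C X Z"
    and Comp_Ident: "f \<in> Hom C X Y \<Longrightarrow> Comp C f (Ident C X) = f"
    and Ident_Comp: "f \<in> Hom C X Y \<Longrightarrow> Comp C (Ident C Y) f = f"
    and Comp_assoc: "\<lbrakk>f \<in> Hom C W X; g \<in> Hom C X Y; h \<in> Hom C Y Z\<rbrakk>
      \<Longrightarrow> Comp C h (Comp C g f) = Comp C (Comp C h g) f"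

definition Epi :: "('o, 'm) category \<Rightarrow> 'o \<Rightarrow> 'o \<Rightarrow> 'm set" where
  "Epi C X Y = {f \<in> Hom C X Y. \<forall>Z\<in>Obj C. \<forall>g\<in>Hom C Y Z. \<forall>h\<in>Hom C Y Z.
     Comp C g f = Comp C h f \<longrightarrow> g = h}"

definition Iso :: "('o, 'm) category \<Rightarrow> 'o \<Rightarrow> 'o \<Rightarrow> 'm set" where
  "Iso C X Y = {f \<in> Hom C X Y. \<exists>g\<in>Hom C Y X. Comp C g f = Ident C X \<and> Comp C f g = Ident C Y}"

definition Aut :: "('o, 'm) category \<Rightarrow> 'o \<Rightarrow> 'm set" where
  "Aut C X = Iso C X X"

definition iso_rel :: "('o, 'm) category \<Rightarrow> ('o \<times> 'o) set" where
  "iso_rel C = {(X, Y). X \<in> Obj C \<and> Y \<in> Obj C \<and> Iso C X Y \<noteq> {}}"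

definition iso_class :: "('o, 'm) category \<Rightarrow> 'o \<Rightarrow> 'o set" where
  "iso_class C X = iso_rel C `` {X}"

definition iso_classes :: "('o, 'm) category \<Rightarrow> 'o set set" where
  "iso_classes C = Obj C // iso_rel C"

text \<open>A representative of an isomorphism class of objects. Everything below that is evaluated at
  a representative (cardinalities of \<open>Epi\<close> and \<open>Aut\<close>, sums over \<open>Epi\<close> of isomorphism-invariant
  terms) does not depend on the choice.\<close>

definition rep :: "'o set \<Rightarrow> 'o" where
  "rep c = (SOME X. X \<in> c)"


section \<open>The poset of quotients of an object\<close>

definition quotients :: "('o, 'm) category \<Rightarrow> 'o \<Rightarrow> ('o \<times> 'm) set" where
  "quotients C G = {(F, \<pi>). F \<in> Obj C \<and> \<pi> \<in> Epi C G F}"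

definition quotient_iso :: "('o, 'm) category \<Rightarrow> 'o \<Rightarrow> (('o \<times> 'm) \<times> ('o \<times> 'm)) set" where
  "quotient_iso C G = {((F, \<pi>), (F', \<pi>')). (F, \<pi>) \<in> quotients C G \<and> (F', \<pi>') \<in> quotients C G \<and>
     (\<exists>\<rho>\<in>Iso C F F'. \<pi>' = Comp C \<rho> \<pi>)}"

text \<open>\<open>F \<sqsubseteq> H\<close> when there is a morphism \<open>H \<rightarrow> F\<close> under \<open>G\<close>; so \<open>G\<close> itself is the greatest
  quotient of \<open>G\<close>. The equality of the order structure is equality of isomorphism classes.\<close>

definition quotient_poset :: "('o, 'm) category \<Rightarrow> 'o \<Rightarrow> ('o \<times> 'm) set gorder" where
  "quotient_poset C G =
    \<lparr>carrier = quotients C G // quotient_iso C G,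
     eq = (=),
     le = (\<lambda>a b. \<exists>(F, \<pi>)\<in>a. \<exists>(H, \<eta>)\<in>b. \<exists>h\<in>Hom C H F. \<pi> = Comp C h \<eta>)\<rparr>"

text \<open>The class of the quotient \<open>(Cod \<pi>, \<pi>)\<close> of \<open>Dom \<pi>\<close>.\<close>

definition quotient_class :: "('o, 'm) category \<Rightarrow> 'm \<Rightarrow> ('o \<times> 'm) set" where
  "quotient_class C \<pi> = quotient_iso C (Dom C \<pi>) `` {(Cod C \<pi>, \<pi>)}"

text \<open>The interval \<open>[F, G]\<close> for an epimorphism \<open>\<pi> : G \<rightarrow> F\<close>.\<close>

definition interval :: "('o, 'm) category \<Rightarrow> 'm \<Rightarrow> ('o \<times> 'm) set set" where
  "interval C \<pi> = {q \<in> carrier (quotient_poset C (Dom C \<pi>)).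
     quotient_class C \<pi> \<sqsubseteq>\<^bsub>quotient_poset C (Dom C \<pi>)\<^esub> q}"

definition minimal_object :: "('o, 'm) category \<Rightarrow> 'o \<Rightarrow> bool" where
  "minimal_object C G \<longleftrightarrow> G \<in> Obj C \<and>
     carrier (quotient_poset C G) = {quotient_class C (Ident C G)}"

definition simple_epi :: "('o, 'm) category \<Rightarrow> 'm \<Rightarrow> bool" where
  "simple_epi C \<pi> \<longleftrightarrow> \<pi> \<in> Epi C (Dom C \<pi>) (Cod C \<pi>) \<and> \<pi> \<notin> Iso C (Dom C \<pi>) (Cod C \<pi>) \<and>
     interval C \<pi> = {quotient_class C \<pi>, quotient_class C (Ident C (Dom C \<pi>))}"


section \<open>Formations and levels\<close>

definition downward_closed :: "('o, 'm) category \<Rightarrow> 'o set set \<Rightarrow> bool" where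
  "downward_closed C S \<longleftrightarrow>
     (\<forall>G\<in>Obj C. \<forall>(F, \<pi>)\<in>quotients C G. iso_class C G \<in> S \<longrightarrow> iso_class C F \<in> S)"

text \<open>In the following, \<open>(J, \<sigma>)\<close> is any quotient whose class is the join of those of \<open>(H, \<eta>)\<close> and
  \<open>(F, \<pi>)\<close>; nothing is required if that join does not exist.\<close>

definition join_closed :: "('o, 'm) category \<Rightarrow> 'o set set \<Rightarrow> bool" where
  "join_closed C S \<longleftrightarrow>
     (\<forall>G\<in>Obj C. \<forall>(H, \<eta>)\<in>quotients C G. \<forall>(F, \<pi>)\<in>quotients C G. \<forall>(J, \<sigma>)\<in>quotients C G.
        iso_class C H \<in> S \<and> iso_class C F \<in> S \<and>
        least (quotient_poset C G) (quotient_class C \<sigma>)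
          (Upper (quotient_poset C G) {quotient_class C \<eta>, quotient_class C \<pi>})
        \<longrightarrow> iso_class C J \<in> S)"

definition minimal_classes :: "('o, 'm) category \<Rightarrow> 'o set set" where
  "minimal_classes C = {iso_class C G | G. minimal_object C G}"

definition formation :: "('o, 'm) category \<Rightarrow> 'o set set \<Rightarrow> bool" where
  "formation C S \<longleftrightarrow> S \<subseteq> iso_classes C \<and> downward_closed C S \<and> join_closed C S \<and>
     minimal_classes C \<subseteq> S"

definition level_generated_by :: "('o, 'm) category \<Rightarrow> 'o set set \<Rightarrow> 'o set set" where
  "level_generated_by C B = \<Inter>{S. formation C S \<and> B \<subseteq> S}"

definition level :: "('o, 'm) category \<Rightarrow> 'o set set \<Rightarrow> bool" where
  "level C L \<longleftrightarrow> (\<exists>B. finite B \<and> B \<subseteq> iso_classes C \<and> L = level_generated_by C B)"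


section \<open>Diamond categories\<close>

definition modular_lattice :: "'a gorder \<Rightarrow> bool" where
  "modular_lattice P \<longleftrightarrow> lattice P \<and>
     (\<forall>a\<in>carrier P. \<forall>b\<in>carrier P. \<forall>x\<in>carrier P.
        a \<sqsubseteq>\<^bsub>P\<^esub> b \<longrightarrow> a \<squnion>\<^bsub>P\<^esub> (x \<sqinter>\<^bsub>P\<^esub> b) = (a \<squnion>\<^bsub>P\<^esub> x) \<sqinter>\<^bsub>P\<^esub> b)"

locale diamond_category = small_category +
  assumes finite_quotients: "G \<in> Obj C \<Longrightarrow> finite (carrier (quotient_poset C G))"
    and modular_quotients: "G \<in> Obj C \<Longrightarrow> modular_lattice (quotient_poset C G)"
    and finite_Aut: "G \<in> Obj C \<Longrightarrow> finite (Aut C G)"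
    and finite_simple_epis: "\<lbrakk>level C L; G \<in> Obj C; iso_class C G \<in> L\<rbrakk> \<Longrightarrow>
      finite {c \<in> L. \<exists>H\<in>c. \<exists>\<pi>\<in>Epi C H G. simple_epi C \<pi>}"
    and countable_minimal: "countable (minimal_classes C)"


section \<open>Moments\<close>

text \<open>The Moebius function of a finite poset (junk value 0 otherwise).\<close>

function moebius :: "'a gorder \<Rightarrow> 'a \<Rightarrow> 'a \<Rightarrow> int" where
  "moebius P x y =
    (if finite (carrier P) \<and> partial_order P \<and> x \<in> carrier P \<and> y \<in> carrier P \<and> x \<sqsubseteq>\<^bsub>P\<^esub> y
     then if x = y then 1
          else - (\<Sum>z\<in>{z \<in> carrier P. x \<sqsubseteq>\<^bsub>P\<^esub> z \<and> z \<sqsubseteq>\<^bsub>P\<^esub> y \<and> z \<noteq> y}. moebius P x z)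
     else 0)"
  by pat_completeness auto
termination
proof (relation "Wellfounded.measure (\<lambda>(P, x, y). card {z \<in> carrier P. x \<sqsubseteq>\<^bsub>P\<^esub> z \<and> z \<sqsubseteq>\<^bsub>P\<^esub> y})", goal_cases)
  case 1
  show ?case by simp
next
  case (2 P x y z)
  then interpret partial_order P by blast
  have "{w \<in> carrier P. x \<sqsubseteq>\<^bsub>P\<^esub> w \<and> w \<sqsubseteq>\<^bsub>P\<^esub> z} \<subset> {w \<in> carrier P. x \<sqsubseteq>\<^bsub>P\<^esub> w \<and> w \<sqsubseteq>\<^bsub>P\<^esub> y}"
    using 2 le_trans le_antisym le_refl by blast
  with 2 show ?case by (simp add: psubset_card_mono)
qed

declare moebius.simps [simp del]

definition mu :: "('o, 'm) category \<Rightarrow> 'm \<Rightarrow> int" where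
  "mu C \<pi> = moebius (quotient_poset C (Dom C \<pi>))
     (quotient_class C \<pi>) (quotient_class C (Ident C (Dom C \<pi>)))"

definition Epi_orbits :: "('o, 'm) category \<Rightarrow> 'o \<Rightarrow> 'o \<Rightarrow> 'm set set" where
  "Epi_orbits C G F = (\<lambda>\<pi>. (\<lambda>\<sigma>. Comp C \<sigma> \<pi>) ` Aut C F) ` Epi C G F"

text \<open>\<open>mu\<close> is constant on each orbit, and \<open>the_elem\<close> picks its value there.\<close>

definition mu_hat :: "('o, 'm) category \<Rightarrow> 'o \<Rightarrow> 'o \<Rightarrow> int" where
  "mu_hat C F G = (\<Sum>orb\<in>Epi_orbits C G F. the_elem (mu C ` orb))"

definition Z_count :: "('o, 'm) category \<Rightarrow> 'm \<Rightarrow> nat" where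
  "Z_count C \<pi> = (let P = quotient_poset C (Dom C \<pi>) in
     card {H \<in> interval C \<pi>. \<forall>K\<^sub>1\<in>interval C \<pi>. \<forall>K\<^sub>2\<in>interval C \<pi>.
       H \<squnion>\<^bsub>P\<^esub> (K\<^sub>1 \<sqinter>\<^bsub>P\<^esub> K\<^sub>2) = (H \<squnion>\<^bsub>P\<^esub> K\<^sub>1) \<sqinter>\<^bsub>P\<^esub> (H \<squnion>\<^bsub>P\<^esub> K\<^sub>2)})"

text \<open>A tuple \<open>M\<close> of reals is indexed by isomorphism classes of objects.\<close>

definition well_behaved :: "('o, 'm) category \<Rightarrow> 'o set set \<Rightarrow> ('o set \<Rightarrow> real) \<Rightarrow> bool" where
  "well_behaved C W M \<longleftrightarrow>
     (\<forall>F\<in>W. (\<lambda>G. \<Sum>\<pi>\<in>Epi C (rep G) (rep F).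
        \<bar>real_of_int (mu C \<pi>)\<bar> / real (card (Aut C (rep G))) * real (Z_count C \<pi>) ^ 3 * \<bar>M G\<bar>)
        summable_on W)"

definition v_coeff :: "('o, 'm) category \<Rightarrow> 'o set set \<Rightarrow> ('o set \<Rightarrow> real) \<Rightarrow> 'o set \<Rightarrow> real" where
  "v_coeff C L M F =
     (\<Sum>\<^sub>\<infinity>G\<in>L. real_of_int (mu_hat C (rep F) (rep G)) / real (card (Aut C (rep G))) * M G)"

text \<open>Measures on a set of isomorphism classes, for the discrete \<open>\<sigma>\<close>-algebra.\<close>

definition discrete_measure_on :: "'o set set \<Rightarrow> 'o set measure \<Rightarrow> bool" where
  "discrete_measure_on L \<nu> \<longleftrightarrow> space \<nu> = L \<and> sets \<nu> = Pow L"

text \<open>Moments may be infinite, and are compared with real numbers inside \<open>ereal\<close>, because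
  \<open>ennreal\<close> would turn a negative real into 0.\<close>

definition moment :: "('o, 'm) category \<Rightarrow> 'o set measure \<Rightarrow> 'o set \<Rightarrow> ereal" where
  "moment C \<nu> G = enn2ereal (\<integral>\<^sup>+F. of_nat (card (Epi C (rep F) (rep G))) \<partial>\<nu>)"

definition has_moments ::
  "('o, 'm) category \<Rightarrow> 'o set set \<Rightarrow> ('o set \<Rightarrow> real) \<Rightarrow> 'o set measure \<Rightarrow> bool" where
  "has_moments C L M \<nu> \<longleftrightarrow> discrete_measure_on L \<nu> \<and> (\<forall>G\<in>L. moment C \<nu> G = ereal (M G))"

end

theory Submission
  imports Defs
begin

text \<open>
  Uniqueness and robustness: Moebius inversion in the lattice of quotients of \<open>H\<close> above \<open>F\<close>, cut off at
  rank \<open>r\<close>, computes the indicator of \<open>H \<cong> F\<close> up to an error bounded by the terms of rank \<open>r + 1\<close>.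
  Only finitely many objects of a level occur at each rank over \<open>F\<close>, so integrating this inequality
  against the given measures involves finitely many moments, and by well-behavedness the error
  vanishes as \<open>r\<close> grows.

  Existence: over a fixed \<open>G\<close>, filter each \<open>H \<rightarrow> G\<close> by the iterated socle (Loewy) series of the lattice
  \<open>[G, H]\<close>. On a level its length is bounded, so the formal identity that the \<open>G\<close>-moment of
  \<open>F \<mapsto> v F\<close> is \<open>M G\<close> can be proved one layer at a time. Within a layer only complemented modular lattices
  contribute. There the absolute values of the Moebius function \<open>\<mu>(x, 1)\<close> sum to at most
  \<open>Z\<^sup>3 \<bar>\<mu>(0, 1)\<bar>\<close>, which makes the rearrangement absolutely convergent; between layers all terms are
  nonnegative.
\<close>

section \<open>Moebius functions of finite posets\<close>

text \<open>Inserting \<open>v_coeff\<close> into a moment gives a double sum over H -> F -> G.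
  Well-behavedness controls it only if \<open>Z_count\<close> cubed times |mu(H -> G)| bounds the
  sum of |mu(H -> F)| over all F between. When [G, H] is not complemented, mu(H -> G) is 0 while F =
  H still contributes 1, so the sums cannot simply be interchanged; this is what forces the
  filtration.

  Formally, if M is the tuple of moments of a measure, sort the epimorphisms K -> G by the i-th
  Loewy term F of K over G: for each i the total is M_G. At i = 0 the term is G itself and this is
  the definition of M_G; once i reaches the Loewy bound of the level the term is K and the total is
  the moment of \<open>v_coeff\<close>. Nonnegativity is passed down from the last index, the value
  of the sum up from index 0, so the induction needs a bound valid for the whole level, and finite
  generation provides it.

  The cube: within one perspectivity class, the ratio of the sum of |mu(x, 1)| to |mu(0, 1)| grows
  at most by the product of all 1 + 1/2^i, about 4.77, which lies between 2^2 and 2^3, while the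
  number of distributive elements at least doubles.\<close>

locale finite_poset = partial_order L for L :: "'a gorder" (structure) +
  assumes finite_carrier: "finite (carrier L)"
begin

definition ivl :: "'a \<Rightarrow> 'a \<Rightarrow> 'a set" where
  "ivl x y = {z \<in> carrier L. x \<sqsubseteq> z \<and> z \<sqsubseteq> y}"

lemma finite_ivl [simp, intro]: "finite (ivl x y)"
  using finite_carrier by (simp add: ivl_def)

lemma le_refl [simp]: "x \<in> carrier L \<Longrightarrow> x \<sqsubseteq> x"
  by (simp add: eq_is_equal)

lemma ivl_self: "x \<in> carrier L \<Longrightarrow> ivl x x = {x}"
  by (auto simp: ivl_def dest: le_antisym)

lemma ivl_psubset:
  assumes "x \<sqsubseteq> z" "z \<sqsubseteq> y" "z \<noteq> y" "x \<in> carrier L" "y \<in> carrier L" "z \<in> carrier L"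
  shows "ivl x z \<subset> ivl x y"
  using assms le_trans le_antisym unfolding ivl_def by blast

lemma ivl_psubset':
  assumes "x \<sqsubseteq> z" "z \<sqsubseteq> y" "z \<noteq> x" "x \<in> carrier L" "y \<in> carrier L" "z \<in> carrier L"
  shows "ivl z y \<subset> ivl x y"
  using assms le_trans le_antisym unfolding ivl_def by blast

abbreviation \<mu> :: "'a \<Rightarrow> 'a \<Rightarrow> int" where "\<mu> \<equiv> moebius L"

lemma moebius_self [simp]: "x \<in> carrier L \<Longrightarrow> \<mu> x x = 1"
  using moebius.simps[of L x x] finite_carrier partial_order_axioms by simp

lemma moebius_rec:
  assumes "x \<in> carrier L" "y \<in> carrier L" "x \<sqsubseteq> y" "x \<noteq> y"
  shows "\<mu> x y = - (\<Sum>z\<in>ivl x y - {y}. \<mu> x z)"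
proof -
  have "{z \<in> carrier L. x \<sqsubseteq> z \<and> z \<sqsubseteq> y \<and> z \<noteq> y} = ivl x y - {y}"
    by (auto simp: ivl_def)
  then show ?thesis
    using moebius.simps[of L x y] finite_carrier partial_order_axioms assms by simp
qed

lemma sum_moebius_left:
  assumes "x \<in> carrier L" "y \<in> carrier L" "x \<sqsubseteq> y" "x \<noteq> y"
  shows "(\<Sum>z\<in>ivl x y. \<mu> x z) = 0"
proof -
  have "y \<in> ivl x y" using assms by (simp add: ivl_def)
  then have "(\<Sum>z\<in>ivl x y. \<mu> x z) = \<mu> x y + (\<Sum>z\<in>ivl x y - {y}. \<mu> x z)"
    by (simp add: sum.remove)
  then show ?thesis using moebius_rec[OF assms] by simp
qed

text \<open>The Moebius function is defined by a recursion on its second argument. Convolving from the left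
  with \<open>\<mu>\<close> and cancelling shows that it is also an inverse of the zeta function on the other side.\<close>

lemma sum_moebius_right:
  assumes "x \<in> carrier L" "y \<in> carrier L" "x \<sqsubseteq> y" "x \<noteq> y"
  shows "(\<Sum>z\<in>ivl x y. \<mu> z y) = 0"
  using assms
proof (induction "card (ivl x y)" arbitrary: x rule: less_induct)
  case less
  define f where "f u = (\<Sum>z\<in>ivl u y. \<mu> z y)" for u
  have y: "f y = 1" using less.prems by (simp add: f_def ivl_self)
  have mid: "f u = 0" if "u \<in> ivl x y" "u \<noteq> x" "u \<noteq> y" for u
  proof -
    have "ivl u y \<subset> ivl x y" using that less.prems by (intro ivl_psubset') (auto simp: ivl_def)
    then show ?thesis
      using less.hyps[of u] that less.prems psubset_card_mono[OF finite_ivl, of "ivl u y" x y]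
      by (simp add: ivl_def f_def)
  qed
  have "(\<Sum>u\<in>ivl x y. \<mu> x u * f u) = (\<Sum>u\<in>ivl x y. \<Sum>z\<in>ivl u y. \<mu> x u * \<mu> z y)"
    by (simp add: f_def sum_distrib_left)
  also have "\<dots> = (\<Sum>(u, z)\<in>(SIGMA u:ivl x y. ivl u y). \<mu> x u * \<mu> z y)"
    by (simp add: sum.Sigma)
  also have "\<dots> = (\<Sum>(z, u)\<in>(SIGMA z:ivl x y. ivl x z). \<mu> x u * \<mu> z y)"
  proof (rule sum.reindex_bij_witness[of _ "\<lambda>(a,b). (b,a)" "\<lambda>(a,b). (b,a)"])
    fix p assume "p \<in> (SIGMA u:ivl x y. ivl u y)"
    then show "(case p of (a, b) \<Rightarrow> (b, a)) \<in> (SIGMA z:ivl x y. ivl x z)"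
      using less.prems by (auto simp: ivl_def intro: le_trans)
  next
    fix p assume "p \<in> (SIGMA z:ivl x y. ivl x z)"
    then show "(case p of (a, b) \<Rightarrow> (b, a)) \<in> (SIGMA u:ivl x y. ivl u y)"
      using less.prems by (auto simp: ivl_def intro: le_trans)
  qed auto
  also have "\<dots> = (\<Sum>z\<in>ivl x y. \<Sum>u\<in>ivl x z. \<mu> x u * \<mu> z y)"
    by (simp add: sum.Sigma)
  also have "\<dots> = (\<Sum>z\<in>ivl x y. (\<Sum>u\<in>ivl x z. \<mu> x u) * \<mu> z y)"
    by (simp add: sum_distrib_right)
  also have "\<dots> = (\<Sum>z\<in>ivl x y. if z = x then \<mu> x y else 0)"
    using less.prems by (intro sum.cong) (auto simp: ivl_self sum_moebius_left, auto simp: ivl_def sum_moebius_left[unfolded ivl_def])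
  also have "\<dots> = \<mu> x y" using less.prems by (simp add: ivl_def finite_carrier)
  finally have 1: "(\<Sum>u\<in>ivl x y. \<mu> x u * f u) = \<mu> x y" .
  have "(\<Sum>u\<in>ivl x y. \<mu> x u * f u) = (\<Sum>u\<in>{x, y}. \<mu> x u * f u)"
    using less.prems mid by (intro sum.mono_neutral_right) (auto simp: ivl_def finite_carrier)
  also have "\<dots> = f x + \<mu> x y" using less.prems y by simp
  finally show ?case using 1 by (simp add: f_def)
qed

end

definition interval_iso :: "'a gorder \<Rightarrow> 'a \<Rightarrow> 'a \<Rightarrow> 'b gorder \<Rightarrow> 'b \<Rightarrow> 'b \<Rightarrow> ('a \<Rightarrow> 'b) \<Rightarrow> bool" where
  "interval_iso P x y Q x' y' f \<longleftrightarrow>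
     bij_betw f {z \<in> carrier P. x \<sqsubseteq>\<^bsub>P\<^esub> z \<and> z \<sqsubseteq>\<^bsub>P\<^esub> y} {z \<in> carrier Q. x' \<sqsubseteq>\<^bsub>Q\<^esub> z \<and> z \<sqsubseteq>\<^bsub>Q\<^esub> y'} \<and>
     (\<forall>u\<in>{z \<in> carrier P. x \<sqsubseteq>\<^bsub>P\<^esub> z \<and> z \<sqsubseteq>\<^bsub>P\<^esub> y}. \<forall>v\<in>{z \<in> carrier P. x \<sqsubseteq>\<^bsub>P\<^esub> z \<and> z \<sqsubseteq>\<^bsub>P\<^esub> y}.
        u \<sqsubseteq>\<^bsub>P\<^esub> v \<longleftrightarrow> f u \<sqsubseteq>\<^bsub>Q\<^esub> f v)"

text \<open>The recursion for \<open>moebius\<close> sees only the order of the interval. Induction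
  on its size applies because \<open>f\<close> matches the endpoints and restricts to an isomorphism
  from \<open>ivl x z\<close> onto the interval below \<open>f z\<close>.\<close>

lemma moebius_interval_iso:
  assumes "finite_poset P" "finite_poset Q"
    and "x \<in> carrier P" "y \<in> carrier P" "x \<sqsubseteq>\<^bsub>P\<^esub> y" "x' \<in> carrier Q" "y' \<in> carrier Q" "x' \<sqsubseteq>\<^bsub>Q\<^esub> y'"
    and "interval_iso P x y Q x' y' f"
  shows "moebius P x y = moebius Q x' y'"
  using assms
proof (induction "card (finite_poset.ivl P x y)" arbitrary: y y' rule: less_induct)
  case less
  interpret P: finite_poset P by fact
  interpret Q: finite_poset Q by fact
  note [simp] = less.prems(3-8)
  have bij: "bij_betw f (P.ivl x y) (Q.ivl x' y')"
    and mono: "\<And>u v. u \<in> P.ivl x y \<Longrightarrow> v \<in> P.ivl x y \<Longrightarrow> u \<sqsubseteq>\<^bsub>P\<^esub> v \<longleftrightarrow> f u \<sqsubseteq>\<^bsub>Q\<^esub> f v"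
    using less.prems(9) unfolding interval_iso_def P.ivl_def[symmetric] Q.ivl_def[symmetric] by blast+
  have mem: "x \<in> P.ivl x y" "y \<in> P.ivl x y" "x' \<in> Q.ivl x' y'" "y' \<in> Q.ivl x' y'"
    by (auto simp: P.ivl_def Q.ivl_def)
  have img: "f u \<in> Q.ivl x' y'" if "u \<in> P.ivl x y" for u using bij that by (auto simp: bij_betw_def)
  have surj: "\<exists>u\<in>P.ivl x y. v = f u" if "v \<in> Q.ivl x' y'" for v using bij that by (auto simp: bij_betw_def)
  have fx: "f x = x'"
  proof -
    obtain u where u: "u \<in> P.ivl x y" "x' = f u" using surj mem by blast
    then have "f x \<sqsubseteq>\<^bsub>Q\<^esub> x'" using mono[of x u] mem by (auto simp: P.ivl_def)
    then show ?thesis using img[OF mem(1)] by (auto simp: Q.ivl_def dest: Q.le_antisym)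
  qed
  have fy: "f y = y'"
  proof -
    obtain u where u: "u \<in> P.ivl x y" "y' = f u" using surj mem by blast
    then have "y' \<sqsubseteq>\<^bsub>Q\<^esub> f y" using mono[of u y] mem by (auto simp: P.ivl_def)
    then show ?thesis using img[OF mem(2)] by (auto simp: Q.ivl_def dest: Q.le_antisym)
  qed
  have inj: "inj_on f (P.ivl x y)" using bij by (simp add: bij_betw_def)
  show ?case
  proof (cases "x = y")
    case True
    then show ?thesis using fx fy by simp
  next
    case False
    then have ne: "x' \<noteq> y'" using fx fy inj mem by (metis inj_onD)
    have "moebius P x z = moebius Q x' (f z)" if z: "z \<in> P.ivl x y - {y}" for z
    proof (rule less.hyps)
      have zc: "z \<in> carrier P" "x \<sqsubseteq>\<^bsub>P\<^esub> z" "z \<sqsubseteq>\<^bsub>P\<^esub> y" "z \<noteq> y" using z by (auto simp: P.ivl_def)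
      have fz: "f z \<in> carrier Q" "x' \<sqsubseteq>\<^bsub>Q\<^esub> f z" "f z \<sqsubseteq>\<^bsub>Q\<^esub> y'"
        using img z by (auto simp: Q.ivl_def)
      have sub: "P.ivl x z \<subset> P.ivl x y" using zc by (intro P.ivl_psubset) auto
      then show "card (P.ivl x z) < card (P.ivl x y)" by (intro psubset_card_mono) auto
      have im: "f ` P.ivl x z = Q.ivl x' (f z)"
      proof (intro Set.set_eqI iffI)
        fix v assume "v \<in> f ` P.ivl x z"
        then obtain u where "u \<in> P.ivl x z" "v = f u" by blast
        moreover have "u \<in> P.ivl x y" using calculation sub by auto
        ultimately show "v \<in> Q.ivl x' (f z)" using img[of u] mono[of u z] z
          by (auto simp: P.ivl_def Q.ivl_def)
      next
        fix v assume v: "v \<in> Q.ivl x' (f z)"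
        then have "v \<in> Q.ivl x' y'" using fz by (auto simp: Q.ivl_def intro: Q.le_trans)
        then obtain u where "u \<in> P.ivl x y" "v = f u" using surj by blast
        then show "v \<in> f ` P.ivl x z" using v mono[of u z] z by (auto simp: P.ivl_def Q.ivl_def)
      qed
      have "inj_on f (P.ivl x z)" using inj sub by (auto intro: inj_on_subset)
      then show "interval_iso P x z Q x' (f z) f"
        unfolding interval_iso_def P.ivl_def[symmetric] Q.ivl_def[symmetric]
        using im mono sub unfolding bij_betw_def by blast
    qed (use less.prems(1,2) z img in \<open>auto simp: P.ivl_def Q.ivl_def\<close>)
    then have "(\<Sum>z\<in>P.ivl x y - {y}. moebius P x z) = (\<Sum>z\<in>P.ivl x y - {y}. moebius Q x' (f z))"
      by (rule sum.cong[OF refl])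
    also have "\<dots> = (\<Sum>z\<in>Q.ivl x' y' - {y'}. moebius Q x' z)"
    proof (rule sum.reindex_bij_betw)
      show "bij_betw f (P.ivl x y - {y}) (Q.ivl x' y' - {y'})"
        using bij_betw_DiffI[OF bij, of "{y}" "{y'}"] mem fy by (auto simp: bij_betw_def)
    qed
    finally show ?thesis using P.moebius_rec[of x y] Q.moebius_rec[of x' y'] False ne by simp
  qed
qed

section \<open>Finite modular lattices\<close>

text \<open>The top is a parameter because the Moebius values to be bounded are of the form
  \<open>\<mu> x t\<close>; the lower end \<open>b\<close> of the interval is left free, since the
  inductions move it upwards.\<close>

locale finite_modular_lattice = lattice L + finite_poset L for L :: "'a gorder" (structure) +
  fixes t :: 'a
  assumes top_carrier [simp, intro]: "t \<in> carrier L"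
    and le_top [simp]: "x \<in> carrier L \<Longrightarrow> x \<sqsubseteq> t"
    and modular: "\<lbrakk>a \<in> carrier L; b \<in> carrier L; x \<in> carrier L; a \<sqsubseteq> b\<rbrakk>
      \<Longrightarrow> a \<squnion> (x \<sqinter> b) = (a \<squnion> x) \<sqinter> b"
begin

lemma le_meet_iff [simp]:
  "\<lbrakk>x \<in> carrier L; y \<in> carrier L; z \<in> carrier L\<rbrakk> \<Longrightarrow> z \<sqsubseteq> x \<sqinter> y \<longleftrightarrow> z \<sqsubseteq> x \<and> z \<sqsubseteq> y"
  by (meson meet_closed meet_le meet_left meet_right le_trans)

lemma join_le_iff [simp]:
  "\<lbrakk>x \<in> carrier L; y \<in> carrier L; z \<in> carrier L\<rbrakk> \<Longrightarrow> x \<squnion> y \<sqsubseteq> z \<longleftrightarrow> x \<sqsubseteq> z \<and> y \<sqsubseteq> z"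
  by (meson join_closed join_le join_left join_right le_trans)

lemma le_joinI1 [simp]: "\<lbrakk>z \<sqsubseteq> x; x \<in> carrier L; y \<in> carrier L; z \<in> carrier L\<rbrakk> \<Longrightarrow> z \<sqsubseteq> x \<squnion> y"
  by (meson join_closed join_left le_trans)

lemma le_joinI2 [simp]: "\<lbrakk>z \<sqsubseteq> y; x \<in> carrier L; y \<in> carrier L; z \<in> carrier L\<rbrakk> \<Longrightarrow> z \<sqsubseteq> x \<squnion> y"
  by (meson join_closed join_right le_trans)

lemma meet_leI1 [simp]: "\<lbrakk>x \<sqsubseteq> z; x \<in> carrier L; y \<in> carrier L; z \<in> carrier L\<rbrakk> \<Longrightarrow> x \<sqinter> y \<sqsubseteq> z"
  by (meson meet_closed meet_left le_trans)

lemma meet_leI2 [simp]: "\<lbrakk>y \<sqsubseteq> z; x \<in> carrier L; y \<in> carrier L; z \<in> carrier L\<rbrakk> \<Longrightarrow> x \<sqinter> y \<sqsubseteq> z"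
  by (meson meet_closed meet_right le_trans)

lemma join_absorb: "\<lbrakk>x \<in> carrier L; y \<in> carrier L; y \<sqsubseteq> x\<rbrakk> \<Longrightarrow> x \<squnion> y = x"
  by (rule le_antisym) (auto intro: join_left)

lemma join_absorb': "\<lbrakk>x \<in> carrier L; y \<in> carrier L; y \<sqsubseteq> x\<rbrakk> \<Longrightarrow> y \<squnion> x = x"
  by (rule le_antisym) (auto intro: join_right)

lemma meet_absorb: "\<lbrakk>x \<in> carrier L; y \<in> carrier L; x \<sqsubseteq> y\<rbrakk> \<Longrightarrow> x \<sqinter> y = x"
  by (rule le_antisym) (auto intro: meet_left)

lemma meet_absorb': "\<lbrakk>x \<in> carrier L; y \<in> carrier L; x \<sqsubseteq> y\<rbrakk> \<Longrightarrow> y \<sqinter> x = x"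
  by (rule le_antisym) (auto intro: meet_right)

lemma join_eq_iff [simp]:
  assumes "x \<in> carrier L" "y \<in> carrier L"
  shows "x \<squnion> y = x \<longleftrightarrow> y \<sqsubseteq> x" "y \<squnion> x = x \<longleftrightarrow> y \<sqsubseteq> x"
    "x = x \<squnion> y \<longleftrightarrow> y \<sqsubseteq> x" "x = y \<squnion> x \<longleftrightarrow> y \<sqsubseteq> x"
  using assms join_absorb join_absorb' join_left join_right by metis+

lemma meet_eq_iff [simp]:
  assumes "x \<in> carrier L" "y \<in> carrier L"
  shows "x \<sqinter> y = x \<longleftrightarrow> x \<sqsubseteq> y" "y \<sqinter> x = x \<longleftrightarrow> x \<sqsubseteq> y"
    "x = x \<sqinter> y \<longleftrightarrow> x \<sqsubseteq> y" "x = y \<sqinter> x \<longleftrightarrow> x \<sqsubseteq> y"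
  using assms meet_absorb meet_absorb' meet_left meet_right by metis+

lemma top_unique: "\<lbrakk>x \<in> carrier L; t \<sqsubseteq> x\<rbrakk> \<Longrightarrow> x = t"
  by (rule le_antisym) auto

lemma ivl_iff: "x \<in> ivl a b \<longleftrightarrow> x \<in> carrier L \<and> a \<sqsubseteq> x \<and> x \<sqsubseteq> b"
  by (simp add: ivl_def)

text \<open>Dedekind's transposition principle. The inverse map is
  \<open>\<lambda>w. w \<sqinter> y\<close>, and each of the two round trips is one instance of the
  modular law.\<close>

lemma diamond:
  assumes [simp]: "x \<in> carrier L" "y \<in> carrier L"
  shows "bij_betw (\<lambda>z. x \<squnion> z) (ivl (x \<sqinter> y) y) (ivl x (x \<squnion> y))"
    and "\<And>u v. u \<in> ivl (x \<sqinter> y) y \<Longrightarrow> v \<in> ivl (x \<sqinter> y) y \<Longrightarrow> u \<sqsubseteq> v \<longleftrightarrow> x \<squnion> u \<sqsubseteq> x \<squnion> v"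
proof -
  have 1: "(x \<squnion> z) \<sqinter> y = z" if "z \<in> ivl (x \<sqinter> y) y" for z
  proof -
    have z [simp]: "z \<in> carrier L" "x \<sqinter> y \<sqsubseteq> z" "z \<sqsubseteq> y" using that by (auto simp: ivl_def)
    show ?thesis using modular[of z y x] by (simp add: join_absorb join_comm[of L x z])
  qed
  have 2: "x \<squnion> (w \<sqinter> y) = w" if "w \<in> ivl x (x \<squnion> y)" for w
  proof -
    have w [simp]: "w \<in> carrier L" "x \<sqsubseteq> w" "w \<sqsubseteq> x \<squnion> y" using that by (auto simp: ivl_def)
    show ?thesis using modular[of x w y] by (simp add: meet_absorb' meet_comm[of L w y])
  qed
  show "bij_betw (\<lambda>z. x \<squnion> z) (ivl (x \<sqinter> y) y) (ivl x (x \<squnion> y))"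
  proof (rule bij_betwI[where g = "\<lambda>w. w \<sqinter> y"])
    show "(\<lambda>z. x \<squnion> z) \<in> ivl (x \<sqinter> y) y \<rightarrow> ivl x (x \<squnion> y)"
      by (auto simp: ivl_def)
    show "(\<lambda>w. w \<sqinter> y) \<in> ivl x (x \<squnion> y) \<rightarrow> ivl (x \<sqinter> y) y"
      by (auto simp: ivl_def)
  qed (use 1 2 in auto)
  fix u v assume u: "u \<in> ivl (x \<sqinter> y) y" and v: "v \<in> ivl (x \<sqinter> y) y"
  then have c [simp]: "u \<in> carrier L" "v \<in> carrier L" by (auto simp: ivl_def)
  show "u \<sqsubseteq> v \<longleftrightarrow> x \<squnion> u \<sqsubseteq> x \<squnion> v"
  proof
    assume "u \<sqsubseteq> v" then show "x \<squnion> u \<sqsubseteq> x \<squnion> v"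
      by auto
  next
    assume "x \<squnion> u \<sqsubseteq> x \<squnion> v"
    then have "(x \<squnion> u) \<sqinter> y \<sqsubseteq> (x \<squnion> v) \<sqinter> y"
      by auto
    then show "u \<sqsubseteq> v" using 1 u v by simp
  qed
qed

lemma moebius_diamond:
  assumes [simp]: "x \<in> carrier L" "y \<in> carrier L"
  shows "\<mu> (x \<sqinter> y) y = \<mu> x (x \<squnion> y)"
proof (rule moebius_interval_iso[OF finite_poset_axioms finite_poset_axioms])
  show "interval_iso L (x \<sqinter> y) y L x (x \<squnion> y) (\<lambda>z. x \<squnion> z)"
    using diamond[OF assms] unfolding interval_iso_def ivl_def[symmetric] by blast
qed (auto simp: meet_right join_left)


subsection \<open>Covering relation\<close>

definition cov :: "'a \<Rightarrow> 'a \<Rightarrow> bool" where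
  "cov x y \<longleftrightarrow> x \<in> carrier L \<and> y \<in> carrier L \<and> x \<sqsubseteq> y \<and> x \<noteq> y \<and>
     (\<forall>z\<in>carrier L. x \<sqsubseteq> z \<longrightarrow> z \<sqsubseteq> y \<longrightarrow> z = x \<or> z = y)"

lemma covD:
  assumes "cov x y"
  shows "x \<in> carrier L" "y \<in> carrier L" "x \<sqsubseteq> y" "x \<noteq> y" "\<not> y \<sqsubseteq> x"
  using assms le_antisym unfolding cov_def by blast+

lemma cov_between: "\<lbrakk>cov x y; z \<in> carrier L; x \<sqsubseteq> z; z \<sqsubseteq> y\<rbrakk> \<Longrightarrow> z = x \<or> z = y"
  unfolding cov_def by blast

lemma cov_join_eq: "\<lbrakk>cov x y; z \<in> carrier L; \<not> z \<sqsubseteq> x; z \<sqsubseteq> y\<rbrakk> \<Longrightarrow> x \<squnion> z = y"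
  using cov_between[of x y "x \<squnion> z"] covD[of x y] join_right[of x z] join_left[of x z] by auto

lemma cov_unique: "\<lbrakk>cov x y; cov x z; z \<sqsubseteq> y\<rbrakk> \<Longrightarrow> z = y"
  using cov_between[of x y z] covD by blast

text \<open>The interval from \<open>b\<close> to \<open>a\<close> is the transpose of the one from
  \<open>x\<close> to \<open>x \<squnion> a\<close>. An element \<open>z\<close> of the latter is
  recovered from \<open>a \<sqinter> z\<close>, which can only be \<open>b\<close> or
  \<open>a\<close>.\<close>

lemma cov_join:
  assumes "cov b a" and [simp]: "x \<in> carrier L" and "b \<sqsubseteq> x" "\<not> a \<sqsubseteq> x"
  shows "cov x (x \<squnion> a)" and "x \<sqinter> a = b"
proof -
  note [simp] = covD[OF \<open>cov b a\<close>]
  have between: "w = b \<or> w = a" if "w \<in> carrier L" "b \<sqsubseteq> w" "w \<sqsubseteq> a" for w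
    using assms(1) that unfolding cov_def by blast
  show "x \<sqinter> a = b"
    using between[of "x \<sqinter> a"] assms meet_left[of x a] by (auto simp: meet_right)
  show "cov x (x \<squnion> a)"
    unfolding cov_def
  proof (intro conjI ballI impI)
    have "x \<squnion> a \<noteq> x" using assms by simp
    then show "x \<noteq> x \<squnion> a" by (rule not_sym)
    fix z assume z [simp]: "z \<in> carrier L" and le: "x \<sqsubseteq> z" "z \<sqsubseteq> x \<squnion> a"
    have eq: "x \<squnion> (a \<sqinter> z) = z" using modular[of x z a] le by (simp add: meet_absorb')
    have "a \<sqinter> z = b \<or> a \<sqinter> z = a"
      using le assms(3) by (intro between) (auto simp: meet_left intro: le_trans)
    then show "z = x \<or> z = x \<squnion> a"
    proof
      assume "a \<sqinter> z = b"
      then show ?thesis using eq assms(3) by (metis join_absorb assms(2) covD(1)[OF assms(1)])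
    next
      assume "a \<sqinter> z = a"
      then show ?thesis using eq by metis
    qed
  qed (auto simp: join_left)
qed

text \<open>Order dual of \<open>cov_join\<close>: an intermediate \<open>z\<close> is recovered
  from \<open>z \<squnion> c\<close>, which can only be \<open>c\<close> or
  \<open>s\<close>.\<close>

lemma cov_meet:
  assumes "cov c s" and [simp]: "x \<in> carrier L" and "x \<sqsubseteq> s" "\<not> x \<sqsubseteq> c"
  shows "cov (x \<sqinter> c) x" and "x \<squnion> c = s"
proof -
  note [simp] = covD[OF \<open>cov c s\<close>]
  have between: "w = c \<or> w = s" if "w \<in> carrier L" "c \<sqsubseteq> w" "w \<sqsubseteq> s" for w
    using assms(1) that unfolding cov_def by blast
  show "x \<squnion> c = s"
    using between[of "x \<squnion> c"] assms join_left[of x c] by (auto simp: join_right)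
  show "cov (x \<sqinter> c) x"
    unfolding cov_def
  proof (intro conjI ballI impI)
    show "x \<sqinter> c \<noteq> x" using meet_right[of x c] assms by auto
    fix z assume z [simp]: "z \<in> carrier L" and le: "x \<sqinter> c \<sqsubseteq> z" "z \<sqsubseteq> x"
    have eq: "(z \<squnion> c) \<sqinter> x = z" using modular[of z x c] le by (simp add: join_absorb meet_comm[of L c x])
    have "z \<squnion> c = c \<or> z \<squnion> c = s"
      using le assms(3) by (intro between) (auto simp: join_right intro: le_trans)
    then show "z = x \<sqinter> c \<or> z = x"
    proof
      assume "z \<squnion> c = c"
      then show ?thesis using eq by (metis meet_comm)
    next
      assume "z \<squnion> c = s"
      then show ?thesis using eq assms(3) by (metis meet_absorb' assms(2) covD(2)[OF assms(1)])
    qed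
  qed (auto simp: meet_left)
qed

lemma ex_atom:
  assumes "b \<in> carrier L" "x \<in> carrier L" "b \<sqsubseteq> x" "b \<noteq> x"
  shows "\<exists>a. cov b a \<and> a \<sqsubseteq> x"
  using assms
proof (induction "card (ivl b x)" arbitrary: x rule: less_induct)
  case less
  show ?case
  proof (cases "cov b x")
    case False
    then obtain z where z: "z \<in> carrier L" "b \<sqsubseteq> z" "z \<sqsubseteq> x" "z \<noteq> b" "z \<noteq> x"
      using less.prems unfolding cov_def by blast
    then have "ivl b z \<subset> ivl b x" using less.prems by (intro ivl_psubset) auto
    then have "\<exists>a. cov b a \<and> a \<sqsubseteq> z"
      using less.hyps[of z] z less.prems psubset_card_mono[OF finite_ivl] by metis
    then show ?thesis using z less.prems covD le_trans by blast
  qed (use less.prems in auto)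
qed

lemma ex_coatom:
  assumes "b \<in> carrier L" "x \<in> carrier L" "b \<sqsubseteq> x" "b \<noteq> x"
  shows "\<exists>c. cov c x \<and> b \<sqsubseteq> c"
  using assms
proof (induction "card (ivl b x)" arbitrary: b rule: less_induct)
  case less
  show ?case
  proof (cases "cov b x")
    case False
    then obtain z where z: "z \<in> carrier L" "b \<sqsubseteq> z" "z \<sqsubseteq> x" "z \<noteq> b" "z \<noteq> x"
      using less.prems unfolding cov_def by blast
    then have "ivl z x \<subset> ivl b x" using less.prems by (intro ivl_psubset') auto
    then have "\<exists>c. cov c x \<and> z \<sqsubseteq> c"
      using less.hyps[of z] z less.prems psubset_card_mono[OF finite_ivl] by metis
    then show ?thesis using z less.prems covD le_trans by blast
  qed (use less.prems in auto)
qed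


subsection \<open>Weisner's theorem\<close>

text \<open>The sum of \<open>\<mu> b x\<close> over all of \<open>ivl b y\<close> is 0. Grouping it
  by the value of \<open>x \<squnion> a\<close>, every group below \<open>y\<close> vanishes by
  induction, hence so does the group of \<open>y\<close>.\<close>

lemma weisner_join:
  assumes [simp]: "b \<in> carrier L" "a \<in> carrier L" "y \<in> carrier L" and "b \<sqsubseteq> a" "b \<noteq> a"
  shows "(\<Sum>x\<in>{x \<in> ivl b y. x \<squnion> a = y}. \<mu> b x) = 0"
  using assms(3)
proof (induction "card (ivl b y)" arbitrary: y rule: less_induct)
  case less
  note [simp] = less.prems
  show ?case
  proof (cases "a \<sqsubseteq> y")
    case False
    then have "{x \<in> ivl b y. x \<squnion> a = y} = {}"
      by (auto simp: ivl_def intro: join_right)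
    then show ?thesis by (simp only: sum.empty)
  next
    case True
    then have by_: "b \<sqsubseteq> y" "b \<noteq> y" using assms(4,5) le_trans[of b a y] le_antisym[of b a] by auto
    have zero: "(\<Sum>x\<in>{x \<in> ivl b y. x \<squnion> a = w}. \<mu> b x) = 0" if w: "w \<in> ivl b y" "w \<noteq> y" for w
    proof -
      have sub: "ivl b w \<subset> ivl b y" using w by (intro ivl_psubset) (auto simp: ivl_def)
      have "(\<Sum>x\<in>{x \<in> ivl b w. x \<squnion> a = w}. \<mu> b x) = 0"
        using less.hyps[of w] w psubset_card_mono[OF finite_ivl sub] by (simp add: ivl_iff)
      moreover have "{x \<in> ivl b w. x \<squnion> a = w} = {x \<in> ivl b y. x \<squnion> a = w}"
        using w by (auto simp: ivl_def join_left intro: le_trans)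
      ultimately show ?thesis by simp
    qed
    have y: "y \<in> ivl b y" using by_ by (simp add: ivl_def)
    have "0 = (\<Sum>x\<in>ivl b y. \<mu> b x)" using sum_moebius_left[of b y] by_ by simp
    also have "\<dots> = (\<Sum>w\<in>ivl b y. \<Sum>x\<in>{x \<in> ivl b y. x \<squnion> a = w}. \<mu> b x)"
      using True by (intro sum.group[symmetric]) (auto simp: ivl_iff)
    also have "\<dots> = (\<Sum>x\<in>{x \<in> ivl b y. x \<squnion> a = y}. \<mu> b x)"
      using zero y by (subst sum.remove[of _ y]) (auto intro: sum.neutral)
    finally show ?thesis by simp
  qed
qed

text \<open>Order dual of \<open>weisner_join\<close>; the total vanishes by
  \<open>sum_moebius_right\<close> instead of the defining recursion.\<close>

lemma weisner_meet:
  assumes [simp]: "s \<in> carrier L" "u \<in> carrier L" "y \<in> carrier L" and "s \<sqsubseteq> u" "s \<noteq> u"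
  shows "(\<Sum>x\<in>{x \<in> ivl y u. x \<sqinter> s = y}. \<mu> x u) = 0"
  using assms(3)
proof (induction "card (ivl y u)" arbitrary: y rule: less_induct)
  case less
  note [simp] = less.prems
  show ?case
  proof (cases "y \<sqsubseteq> s")
    case False
    then have "{x \<in> ivl y u. x \<sqinter> s = y} = {}"
      by (auto simp: ivl_def intro: meet_right)
    then show ?thesis by (simp only: sum.empty)
  next
    case True
    then have yu: "y \<sqsubseteq> u" "y \<noteq> u" using assms(4,5) le_trans[of y s u] le_antisym[of s u] by auto
    have zero: "(\<Sum>x\<in>{x \<in> ivl y u. x \<sqinter> s = w}. \<mu> x u) = 0" if w: "w \<in> ivl y u" "w \<noteq> y" for w
    proof -
      have sub: "ivl w u \<subset> ivl y u" using w by (intro ivl_psubset') (auto simp: ivl_def)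
      have "(\<Sum>x\<in>{x \<in> ivl w u. x \<sqinter> s = w}. \<mu> x u) = 0"
        using less.hyps[of w] w psubset_card_mono[OF finite_ivl sub] by (simp add: ivl_iff)
      moreover have "{x \<in> ivl w u. x \<sqinter> s = w} = {x \<in> ivl y u. x \<sqinter> s = w}"
        using w by (auto simp: ivl_def meet_left intro: le_trans)
      ultimately show ?thesis by simp
    qed
    have y: "y \<in> ivl y u" using yu by (simp add: ivl_def)
    have "0 = (\<Sum>x\<in>ivl y u. \<mu> x u)" using sum_moebius_right[of y u] yu by simp
    also have "\<dots> = (\<Sum>w\<in>ivl y u. \<Sum>x\<in>{x \<in> ivl y u. x \<sqinter> s = w}. \<mu> x u)"
      using True by (intro sum.group[symmetric]) (auto simp: ivl_iff)
    also have "\<dots> = (\<Sum>x\<in>{x \<in> ivl y u. x \<sqinter> s = y}. \<mu> x u)"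
      using zero y by (subst sum.remove[of _ y]) (auto intro: sum.neutral)
    finally show ?thesis by simp
  qed
qed


subsection \<open>Coatoms and the sum of absolute Moebius values\<close>

text \<open>When \<open>a\<close> is an atom over \<open>b\<close>, these coatoms are exactly the
  complements of \<open>a\<close> in the interval from \<open>b\<close> to \<open>t\<close>.\<close>

definition coatoms :: "'a \<Rightarrow> 'a \<Rightarrow> 'a set" where
  "coatoms b a = {c. cov c t \<and> b \<sqsubseteq> c \<and> \<not> a \<sqsubseteq> c}"

lemma finite_coatoms [simp, intro]: "finite (coatoms b a)"
  by (rule finite_subset[OF _ finite_carrier]) (auto simp: coatoms_def dest: covD)

lemma coatoms_complement:
  assumes "cov b a" "c \<in> coatoms b a"
  shows "a \<squnion> c = t" "a \<sqinter> c = b"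
proof -
  have c: "cov c t" "b \<sqsubseteq> c" "\<not> a \<sqsubseteq> c" using assms by (auto simp: coatoms_def)
  show "a \<squnion> c = t" using cov_meet(2)[OF c(1)] covD[OF assms(1)] c by simp
  show "a \<sqinter> c = b" using cov_join(2)[OF assms(1), of c] covD[OF c(1)] c by (simp add: meet_comm[of L a c])
qed

text \<open>Weisner's theorem at \<open>y = t\<close>: the elements with
  \<open>x \<squnion> a = t\<close> are \<open>t\<close> and the complements \<open>c\<close> of
  \<open>a\<close>. For each \<open>c\<close>, the interval from \<open>b\<close> to
  \<open>c\<close> is the transpose of the one from \<open>a\<close> to \<open>t\<close>.\<close>

lemma moebius_atom:
  assumes "cov b a"
  shows "\<mu> b t = - int (card (coatoms b a)) * \<mu> a t"
proof -
  note [simp] = covD[OF assms]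
  have "{x \<in> ivl b t. x \<squnion> a = t} = insert t (coatoms b a)"
  proof (intro Set.set_eqI iffI)
    fix x assume x: "x \<in> {x \<in> ivl b t. x \<squnion> a = t}"
    show "x \<in> insert t (coatoms b a)"
    proof (cases "a \<sqsubseteq> x")
      case True
      then show ?thesis using x by (auto simp: ivl_iff join_absorb)
    next
      case False
      then show ?thesis using x cov_join(1)[OF assms, of x] by (auto simp: ivl_iff coatoms_def)
    qed
  next
    fix x assume x: "x \<in> insert t (coatoms b a)"
    show "x \<in> {x \<in> ivl b t. x \<squnion> a = t}"
    proof (cases "x = t")
      case False
      then have "x \<in> coatoms b a" using x by simp
      then show ?thesis
        using coatoms_complement[OF assms, of x] covD[of x t]
        by (simp add: ivl_iff join_comm[of L x a] coatoms_def)
    qed (simp add: ivl_iff join_absorb)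
  qed
  then have "0 = (\<Sum>x\<in>insert t (coatoms b a). \<mu> b x)"
    using weisner_join[of b a t] by simp
  also have "\<dots> = \<mu> b t + (\<Sum>c\<in>coatoms b a. \<mu> b c)"
    by (subst sum.insert) (use finite_coatoms in \<open>auto simp: coatoms_def dest: covD\<close>)
  also have "(\<Sum>c\<in>coatoms b a. \<mu> b c) = (\<Sum>c\<in>coatoms b a. \<mu> a t)"
  proof (rule sum.cong[OF HOL.refl])
    fix c assume c: "c \<in> coatoms b a"
    then have "c \<in> carrier L" by (auto simp: coatoms_def dest: covD)
    then show "\<mu> b c = \<mu> a t"
      using moebius_diamond[of a c] coatoms_complement[OF assms c] by simp
  qed
  finally show ?thesis by simp
qed

definition abs_moebius_sum :: "'a \<Rightarrow> int" where
  "abs_moebius_sum b = (\<Sum>x\<in>ivl b t. \<bar>\<mu> x t\<bar>)"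

text \<open>The elements above \<open>a\<close> give the summand 1. For \<open>x\<close> not above
  \<open>a\<close>, \<open>moebius_atom\<close> spreads \<open>\<bar>\<mu> x t\<bar>\<close> over
  the coatoms \<open>c\<close> containing \<open>x\<close>; for a fixed \<open>c\<close> the map
  \<open>x \<mapsto> a \<squnion> x\<close> is a bijection onto \<open>ivl a t\<close>, so each
  \<open>c\<close> gives one more copy. Meanwhile \<open>\<bar>\<mu> b t\<bar>\<close> is only the
  number of coatoms times \<open>\<bar>\<mu> a t\<bar>\<close>.\<close>

lemma abs_moebius_sum_atom:
  assumes "cov b a"
  shows "abs_moebius_sum b = (1 + int (card (coatoms b a))) * abs_moebius_sum a"
proof -
  note [simp] = covD[OF assms]
  define X where "X = {x \<in> ivl b t. \<not> a \<sqsubseteq> x}"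
  have abs: "\<bar>\<mu> x t\<bar> = (\<Sum>c\<in>{c \<in> coatoms b a. x \<sqsubseteq> c}. \<bar>\<mu> (a \<squnion> x) t\<bar>)" if "x \<in> X" for x
  proof -
    have x: "x \<in> carrier L" "b \<sqsubseteq> x" "\<not> a \<sqsubseteq> x" using that by (auto simp: X_def ivl_iff)
    \<comment> \<open>\<open>moebius_atom\<close> is applied over \<open>x\<close> in place of
      \<open>b\<close>, where \<open>x \<squnion> a\<close> is an atom; the relevant coatoms are
      those counted for \<open>b\<close> that contain \<open>x\<close>.\<close>
    have "coatoms x (x \<squnion> a) = {c \<in> coatoms b a. x \<sqsubseteq> c}"
      using x by (auto simp: coatoms_def dest: covD intro: le_trans)
    then show ?thesis
      using moebius_atom[OF cov_join(1)[OF assms x]] by (simp add: abs_mult join_comm[of L a x])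
  qed
  have "(\<Sum>x\<in>X. \<bar>\<mu> x t\<bar>) = (\<Sum>x\<in>X. \<Sum>c\<in>{c \<in> coatoms b a. x \<sqsubseteq> c}. \<bar>\<mu> (a \<squnion> x) t\<bar>)"
    by (rule sum.cong[OF HOL.refl abs])
  also have "\<dots> = (\<Sum>c\<in>coatoms b a. \<Sum>x\<in>{x \<in> X. x \<sqsubseteq> c}. \<bar>\<mu> (a \<squnion> x) t\<bar>)"
    by (rule sum.swap_restrict) (simp_all add: X_def)
  also have "\<dots> = (\<Sum>c\<in>coatoms b a. abs_moebius_sum a)"
  proof (rule sum.cong[OF HOL.refl])
    fix c assume c: "c \<in> coatoms b a"
    have cc: "c \<in> carrier L" "b \<sqsubseteq> c" "\<not> a \<sqsubseteq> c" using c by (auto simp: coatoms_def dest: covD)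
    have "{x \<in> X. x \<sqsubseteq> c} = ivl b c"
      using cc by (auto simp: X_def ivl_iff intro: le_trans)
    moreover have "bij_betw (\<lambda>z. a \<squnion> z) (ivl b c) (ivl a t)"
      using diamond(1)[of a c] cc coatoms_complement[OF assms c] by simp
    ultimately show "(\<Sum>x\<in>{x \<in> X. x \<sqsubseteq> c}. \<bar>\<mu> (a \<squnion> x) t\<bar>) = abs_moebius_sum a"
      unfolding abs_moebius_sum_def by (simp add: sum.reindex_bij_betw[of _ _ _ "\<lambda>x. \<bar>\<mu> x t\<bar>"])
  qed
  finally have 1: "(\<Sum>x\<in>X. \<bar>\<mu> x t\<bar>) = int (card (coatoms b a)) * abs_moebius_sum a" by simp
  have "ivl b t = ivl a t \<union> X" "ivl a t \<inter> X = {}"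
    using le_trans[of b a] by (auto simp: X_def ivl_iff)
  moreover have "finite X" by (simp add: X_def)
  ultimately have "abs_moebius_sum b = abs_moebius_sum a + (\<Sum>x\<in>X. \<bar>\<mu> x t\<bar>)"
    unfolding abs_moebius_sum_def by (metis sum.union_disjoint finite_ivl)
  then show ?thesis using 1 by (simp add: algebra_simps)
qed


subsection \<open>Rank\<close>

text \<open>A saturated chain of length \<open>n\<close>. By \<open>chain_unique\<close> the length
  depends only on the ends, so this relation says that the interval has rank
  \<open>n\<close>.\<close>

fun chain :: "nat \<Rightarrow> 'a \<Rightarrow> 'a \<Rightarrow> bool" where
  "chain 0 x y \<longleftrightarrow> x = y \<and> x \<in> carrier L"
| "chain (Suc n) x y \<longleftrightarrow> (\<exists>z. cov x z \<and> chain n z y)"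

lemma chainD:
  assumes "chain n x y"
  shows "x \<in> carrier L" "y \<in> carrier L" "x \<sqsubseteq> y"
proof -
  have "x \<in> carrier L \<and> y \<in> carrier L \<and> x \<sqsubseteq> y"
    using assms
  proof (induction n arbitrary: x)
    case (Suc n)
    then obtain z where "cov x z" "chain n z y" by auto
    with Suc.IH[of z] show ?case using covD[of x z] le_trans[of x z y] by blast
  qed auto
  then show "x \<in> carrier L" "y \<in> carrier L" "x \<sqsubseteq> y" by blast+
qed

lemma chain_append: "chain m x y \<Longrightarrow> chain n y z \<Longrightarrow> chain (m + n) x z"
  by (induction m arbitrary: x) auto

lemma ex_chain:
  assumes "x \<in> carrier L" "y \<in> carrier L" "x \<sqsubseteq> y"
  shows "\<exists>n. chain n x y"
  using assms
proof (induction "card (ivl x y)" arbitrary: x rule: less_induct)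
  case less
  show ?case
  proof (cases "x = y")
    case True
    then have "chain 0 x y" using less.prems by simp
    then show ?thesis by blast
  next
    case False
    then obtain a where a: "cov x a" "a \<sqsubseteq> y" using ex_atom less.prems by blast
    then have "ivl a y \<subset> ivl x y" using less.prems covD[OF a(1)] by (intro ivl_psubset') auto
    then obtain n where "chain n a y"
      using less.hyps[of a] a less.prems psubset_card_mono[OF finite_ivl] covD[OF a(1)] by metis
    then have "chain (Suc n) x y" using a by auto
    then show ?thesis by blast
  qed
qed

text \<open>Jordan-Dedekind. If the chains start with different atoms \<open>a\<close> and
  \<open>a'\<close>, both are covered by \<open>a \<squnion> a'\<close>, and one chain from there to
  \<open>y\<close> compares the two by induction.\<close>

lemma chain_unique: "chain n x y \<Longrightarrow> chain m x y \<Longrightarrow> n = m"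
proof (induction n arbitrary: x m)
  case 0
  then show ?case by (cases m) (auto dest: chainD covD)
next
  case (Suc n)
  obtain a where a: "cov x a" "chain n a y" using Suc.prems by auto
  show ?case
  proof (cases m)
    case 0
    then show ?thesis using Suc.prems a chainD[OF a(2)] covD[OF a(1)] by auto
  next
    case (Suc m')
    then obtain a' where a': "cov x a'" "chain m' a' y" using Suc.prems by auto
    show ?thesis
    proof (cases "a = a'")
      case True
      then show ?thesis using Suc.IH[OF a(2)] a' Suc by auto
    next
      case False
      have w: "cov a (a \<squnion> a')" "cov a' (a \<squnion> a')"
        using cov_join(1)[OF a'(1), of a] cov_join(1)[OF a(1), of a'] cov_unique[OF a(1) a'(1)]
          cov_unique[OF a'(1) a(1)] False covD[OF a(1)] covD[OF a'(1)] join_comm[of L a a'] by auto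
      have "a \<squnion> a' \<sqsubseteq> y" using chainD[OF a(2)] chainD[OF a'(2)] by simp
      then obtain k where k: "chain k (a \<squnion> a') y" using ex_chain[of "a \<squnion> a'" y] covD[OF w(1)] chainD[OF a(2)] by blast
      then have "chain (Suc k) a y" "chain (Suc k) a' y" using w by auto
      then show ?thesis using Suc.IH a' a Suc by metis
    qed
  qed
qed

lemma chain_Suc_cov: "chain n x y \<Longrightarrow> cov y z \<Longrightarrow> chain (Suc n) x z"
  using chain_append[of n x y 1 z] by (auto dest: covD)

text \<open>A Bonferroni-type inequality. Grouping the terms by \<open>x \<squnion> a\<close> for an atom \<open>a\<close>, Weisner's
  theorem cancels every group that is not cut by the truncation.\<close>

lemma truncated_moebius_sum:
  assumes [simp]: "b \<in> carrier L"
  shows "\<bar>(\<Sum>x\<in>{x. \<exists>j\<le>r. chain j b x}. \<mu> b x) - (if b = t then 1 else 0)\<bar>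
    \<le> (\<Sum>x\<in>{x. chain (Suc r) b x}. \<bar>\<mu> b x\<bar>)"
proof (cases "b = t")
  case True
  then have "{x. \<exists>j\<le>r. chain j b x} = {t}"
    by (auto dest: chainD top_unique intro!: exI[of _ 0])
  then show ?thesis using True by (auto intro: sum_nonneg)
next
  case False
  then obtain a where a: "cov b a" using ex_atom[of b t] by auto
  note [simp] = covD[OF a]
  define X where "X = {x. \<exists>j\<le>r. chain j b x}"
  have X: "X \<subseteq> ivl b t" unfolding X_def using chainD le_top ivl_iff by blast
  then have finX: "finite X" by (rule finite_subset) simp
  have fin: "finite {x. chain (Suc r) b x}"
    by (rule finite_subset[OF _ finite_carrier]) (auto simp del: chain.simps dest: chainD)
  have inner: "(\<Sum>x\<in>{x \<in> X. x \<squnion> a = w}. \<mu> b x) = (if chain (Suc r) b w then - \<mu> b w else 0)"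
    if w: "w \<in> ivl a t" for w
  proof -
    have wc [simp]: "w \<in> carrier L" "a \<sqsubseteq> w" "b \<sqsubseteq> w"
      using w le_trans[of b a w] by (auto simp: ivl_iff)
    obtain k where k: "chain k b w" using ex_chain[of b w] by auto
    have cov_w: "cov x w" if "x \<in> ivl b w" "x \<squnion> a = w" "x \<noteq> w" for x
      using that cov_join(1)[OF a, of x] by (auto simp: ivl_iff join_absorb)
    have W: "(\<Sum>x\<in>{x \<in> ivl b w. x \<squnion> a = w}. \<mu> b x) = 0"
      by (rule weisner_join) auto
    have sub: "{x \<in> X. x \<squnion> a = w} \<subseteq> {x \<in> ivl b w. x \<squnion> a = w}"
      using X by (auto simp: ivl_iff)
    \<comment> \<open>An \<open>x\<close> with \<open>x \<squnion> a = w\<close> is \<open>w\<close>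
      itself or is covered by \<open>w\<close>, so its rank is \<open>k\<close> or
      \<open>k - 1\<close>. Truncating at \<open>r\<close> therefore keeps the whole group, or loses
      exactly the term \<open>w\<close>, or loses everything.\<close>
    consider "k \<le> r" | "k = Suc r" | "k > Suc r" by linarith
    then show ?thesis
    proof cases
      case 1
      have "x \<in> X" if "x \<in> ivl b w" for x
      proof -
        have x: "x \<in> carrier L" "b \<sqsubseteq> x" "x \<sqsubseteq> w" using that by (auto simp: ivl_iff)
        obtain i l where il: "chain i b x" "chain l x w" using ex_chain x by (meson assms wc(1))
        then have "i + l = k" using chain_unique[OF chain_append k] by blast
        then show ?thesis using il 1 by (auto simp: X_def intro!: exI[of _ i])
      qed
      then have "{x \<in> X. x \<squnion> a = w} = {x \<in> ivl b w. x \<squnion> a = w}" using sub by blast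
      moreover have "\<not> chain (Suc r) b w" using chain_unique[OF k] 1 by fastforce
      ultimately show ?thesis using W by (simp del: chain.simps)
    next
      case 2
      have "{x \<in> X. x \<squnion> a = w} = {x \<in> ivl b w. x \<squnion> a = w} - {w}"
      proof (intro Set.set_eqI iffI)
        fix x assume x: "x \<in> {x \<in> X. x \<squnion> a = w}"
        have "x \<noteq> w"
        proof
          assume "x = w"
          then obtain j where "j \<le> r" "chain j b w" using x by (auto simp: X_def)
          then show False using chain_unique[OF k] 2 by fastforce
        qed
        then show "x \<in> {x \<in> ivl b w. x \<squnion> a = w} - {w}" using sub x by blast
      next
        fix x assume x: "x \<in> {x \<in> ivl b w. x \<squnion> a = w} - {w}"
        then obtain i where i: "chain i b x" using ex_chain[of b x] by (auto simp: ivl_iff)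
        then have "chain (Suc i) b w" using chain_Suc_cov cov_w x by blast
        then have "i = r" using chain_unique[OF k] 2 by fastforce
        then show "x \<in> {x \<in> X. x \<squnion> a = w}" using i x by (auto simp: X_def)
      qed
      moreover have "w \<in> {x \<in> ivl b w. x \<squnion> a = w}" by (simp add: ivl_iff join_absorb)
      ultimately show ?thesis using W k 2 by (simp add: sum_diff1 del: chain.simps)
    next
      case 3
      have False if x: "x \<in> X" "x \<squnion> a = w" for x
      proof -
        obtain j where j: "j \<le> r" "chain j b x" using x by (auto simp: X_def)
        show False
        proof (cases "x = w")
          case True
          then show ?thesis using chain_unique[OF k] j 3 by fastforce
        next
          case False
          then have "chain (Suc j) b w" using chain_Suc_cov[OF j(2)] cov_w sub x by blast
          then show ?thesis using chain_unique[OF k] j 3 by fastforce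
        qed
      qed
      then have "{x \<in> X. x \<squnion> a = w} = {}" by blast
      moreover have "\<not> chain (Suc r) b w" using chain_unique[OF k] 3 by fastforce
      ultimately show ?thesis by (simp only: sum.empty if_False)
    qed
  qed
  have "(\<Sum>x\<in>X. \<mu> b x) = (\<Sum>w\<in>ivl a t. \<Sum>x\<in>{x \<in> X. x \<squnion> a = w}. \<mu> b x)"
    using X finX by (intro sum.group[symmetric]) (auto simp: ivl_iff)
  also have "\<dots> = (\<Sum>w\<in>ivl a t. if chain (Suc r) b w then - \<mu> b w else 0)"
    by (rule sum.cong[OF HOL.refl inner])
  also have "\<dots> = (\<Sum>w\<in>{w \<in> ivl a t. chain (Suc r) b w}. - \<mu> b w)"
    by (simp add: sum.inter_filter del: chain.simps)
  finally have "\<bar>\<Sum>x\<in>X. \<mu> b x\<bar> \<le> (\<Sum>w\<in>{w \<in> ivl a t. chain (Suc r) b w}. \<bar>\<mu> b w\<bar>)"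
    by (simp add: sum_negf sum_abs del: chain.simps)
  also have "\<dots> \<le> (\<Sum>w\<in>{w. chain (Suc r) b w}. \<bar>\<mu> b w\<bar>)"
    using fin by (intro sum_mono2) auto
  finally show ?thesis using False by (simp add: X_def del: chain.simps)
qed


subsection \<open>Complemented intervals\<close>

definition complemented :: "'a \<Rightarrow> 'a \<Rightarrow> bool" where
  "complemented b u \<longleftrightarrow> b \<in> carrier L \<and> u \<in> carrier L \<and> b \<sqsubseteq> u \<and>
     (\<forall>x\<in>ivl b u. \<exists>y\<in>ivl b u. x \<sqinter> y = b \<and> x \<squnion> y = u)"

lemma complementedD:
  assumes "complemented b u"
  shows "b \<in> carrier L" "u \<in> carrier L" "b \<sqsubseteq> u"
  using assms by (auto simp: complemented_def)

lemma complementedE: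
  assumes "complemented b u" "x \<in> carrier L" "b \<sqsubseteq> x" "x \<sqsubseteq> u"
  obtains y where "y \<in> carrier L" "b \<sqsubseteq> y" "y \<sqsubseteq> u" "x \<sqinter> y = b" "x \<squnion> y = u"
  using assms unfolding complemented_def by (metis ivl_iff)

lemma complementedI:
  assumes "b \<in> carrier L" "u \<in> carrier L" "b \<sqsubseteq> u"
    and "\<And>x. x \<in> carrier L \<Longrightarrow> b \<sqsubseteq> x \<Longrightarrow> x \<sqsubseteq> u \<Longrightarrow>
      \<exists>y\<in>carrier L. b \<sqsubseteq> y \<and> y \<sqsubseteq> u \<and> x \<sqinter> y \<sqsubseteq> b \<and> u \<sqsubseteq> x \<squnion> y"
  shows "complemented b u"
  unfolding complemented_def
proof (intro conjI ballI)
  fix x assume "x \<in> ivl b u"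
  then have x: "x \<in> carrier L" "b \<sqsubseteq> x" "x \<sqsubseteq> u" by (auto simp: ivl_iff)
  then obtain y where y: "y \<in> carrier L" "b \<sqsubseteq> y" "y \<sqsubseteq> u" "x \<sqinter> y \<sqsubseteq> b" "u \<sqsubseteq> x \<squnion> y"
    using assms(4) by blast
  show "\<exists>y\<in>ivl b u. x \<sqinter> y = b \<and> x \<squnion> y = u"
  proof (intro bexI conjI)
    show "x \<sqinter> y = b" using x y assms(1-3) by (intro le_antisym) auto
    show "x \<squnion> y = u" using x y assms(1-3) by (intro le_antisym) auto
  qed (use y in \<open>auto simp: ivl_iff\<close>)
qed (use assms in auto)

lemma complemented_self: "b \<in> carrier L \<Longrightarrow> complemented b b"
  by (rule complementedI) auto

lemma complemented_cov:
  assumes "cov b a"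
  shows "complemented b a"
proof (rule complementedI)
  note [simp] = covD[OF assms]
  fix x assume x: "x \<in> carrier L" "b \<sqsubseteq> x" "x \<sqsubseteq> a"
  then consider "x = b" | "x = a" using cov_between[OF assms] by blast
  then show "\<exists>y\<in>carrier L. b \<sqsubseteq> y \<and> y \<sqsubseteq> a \<and> x \<sqinter> y \<sqsubseteq> b \<and> a \<sqsubseteq> x \<squnion> y"
    by cases (auto intro: bexI[of _ a] bexI[of _ b])
qed (use covD[OF assms] in auto)

text \<open>A complement \<open>v\<close> of \<open>u \<sqinter> x\<close> below \<open>x\<close>
  yields the complement \<open>b \<squnion> w \<squnion> v\<close> of \<open>u\<close>: by the
  modular law its meet with \<open>u\<close> is \<open>b \<squnion> w\<close> joined with
  \<open>v \<sqinter> u\<close>, which is below \<open>b\<close>.\<close>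

lemma complemented_push:
  assumes "complemented b x" and [simp]: "w \<in> carrier L"
  shows "complemented (b \<squnion> w) (x \<squnion> w)"
proof (rule complementedI)
  note [simp] = complementedD[OF assms(1)]
  fix u assume u: "u \<in> carrier L" "b \<squnion> w \<sqsubseteq> u" "u \<sqsubseteq> x \<squnion> w"
  have "b \<sqsubseteq> u" "w \<sqsubseteq> u" using u by auto
  note [simp] = this u
  obtain v where v [simp]: "v \<in> carrier L" "b \<sqsubseteq> v" "v \<sqsubseteq> x" "(u \<sqinter> x) \<sqinter> v = b" "(u \<sqinter> x) \<squnion> v = x"
    by (rule complementedE[OF assms(1), of "u \<sqinter> x"]) auto
  show "\<exists>y\<in>carrier L. b \<squnion> w \<sqsubseteq> y \<and> y \<sqsubseteq> x \<squnion> w \<and> u \<sqinter> y \<sqsubseteq> b \<squnion> w \<and> x \<squnion> w \<sqsubseteq> u \<squnion> y"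
  proof (intro bexI[of _ "b \<squnion> w \<squnion> v"] conjI)
    have "v \<sqinter> u \<sqsubseteq> (u \<sqinter> x) \<sqinter> v" by (simp del: v(4))
    then have "v \<sqinter> u \<sqsubseteq> b" by simp
    then have "(b \<squnion> w) \<squnion> (v \<sqinter> u) \<sqsubseteq> b \<squnion> w" by simp
    then show "u \<sqinter> (b \<squnion> w \<squnion> v) \<sqsubseteq> b \<squnion> w"
      using modular[of "b \<squnion> w" u v] by (simp add: meet_comm[of L u])
    have "(u \<sqinter> x) \<squnion> v \<sqsubseteq> u \<squnion> (b \<squnion> w \<squnion> v)" by (simp del: v(5))
    then show "x \<squnion> w \<sqsubseteq> u \<squnion> (b \<squnion> w \<squnion> v)" by simp
  qed auto
qed (use complementedD[OF assms(1)] in auto)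

lemma complemented_pull:
  assumes "complemented x y" and [simp]: "z \<in> carrier L"
  shows "complemented (x \<sqinter> z) (y \<sqinter> z)"
proof (rule complementedI)
  note [simp] = complementedD[OF assms(1)]
  fix u assume u: "u \<in> carrier L" "x \<sqinter> z \<sqsubseteq> u" "u \<sqsubseteq> y \<sqinter> z"
  have "u \<sqsubseteq> y" "u \<sqsubseteq> z" using u by auto
  note [simp] = this u
  obtain v where v [simp]: "v \<in> carrier L" "x \<sqsubseteq> v" "v \<sqsubseteq> y" "(u \<squnion> x) \<sqinter> v = x" "(u \<squnion> x) \<squnion> v = y"
    by (rule complementedE[OF assms(1), of "u \<squnion> x"]) auto
  show "\<exists>w\<in>carrier L. x \<sqinter> z \<sqsubseteq> w \<and> w \<sqsubseteq> y \<sqinter> z \<and> u \<sqinter> w \<sqsubseteq> x \<sqinter> z \<and> y \<sqinter> z \<sqsubseteq> u \<squnion> w"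
  proof (intro bexI[of _ "v \<sqinter> (y \<sqinter> z)"] conjI)
    have "(u \<squnion> x) \<squnion> v \<sqsubseteq> u \<squnion> v" by (simp del: v(5))
    then have "y \<sqsubseteq> u \<squnion> v" by (simp only: v(5))
    then have "y \<sqinter> z \<sqsubseteq> (u \<squnion> v) \<sqinter> (y \<sqinter> z)" by simp
    then show "y \<sqinter> z \<sqsubseteq> u \<squnion> (v \<sqinter> (y \<sqinter> z))"
      using modular[of u "y \<sqinter> z" v] by simp
    have "u \<sqinter> (v \<sqinter> (y \<sqinter> z)) \<sqsubseteq> (u \<squnion> x) \<sqinter> v" by (simp del: v(4))
    then show "u \<sqinter> (v \<sqinter> (y \<sqinter> z)) \<sqsubseteq> x \<sqinter> z" by simp
  qed auto
qed (use complementedD[OF assms(1)] in auto)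

lemma complemented_lower:
  assumes "complemented b u" "w \<in> carrier L" "b \<sqsubseteq> w" "w \<sqsubseteq> u"
  shows "complemented b w"
  using complemented_pull[OF assms(1,2)] assms complementedD[OF assms(1)]
  by (simp add: meet_absorb meet_absorb')

lemma complemented_upper:
  assumes "complemented b u" "w \<in> carrier L" "b \<sqsubseteq> w" "w \<sqsubseteq> u"
  shows "complemented w u"
  using complemented_push[OF assms(1,2)] assms complementedD[OF assms(1)]
  by (simp add: join_absorb join_absorb')

lemma ex_maximal_elem:
  assumes "S \<subseteq> carrier L" "S \<noteq> {}"
  shows "\<exists>m\<in>S. \<forall>x\<in>S. m \<sqsubseteq> x \<longrightarrow> x = m"
proof -
  have "finite S" using assms finite_carrier finite_subset by blast
  moreover have "asymp_on S (\<lambda>x y. x \<sqsubseteq> y \<and> x \<noteq> y)"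
    using assms(1) by (intro asymp_onI) (meson le_antisym subsetD)
  moreover have "transp_on S (\<lambda>x y. x \<sqsubseteq> y \<and> x \<noteq> y)"
  proof (rule transp_onI)
    fix x y z assume m: "x \<in> S" "y \<in> S" "z \<in> S" "x \<sqsubseteq> y \<and> x \<noteq> y" "y \<sqsubseteq> z \<and> y \<noteq> z"
    then have "x \<in> carrier L" "y \<in> carrier L" "z \<in> carrier L" using assms(1) by auto
    then show "x \<sqsubseteq> z \<and> x \<noteq> z" using m le_trans[of x y z] le_antisym[of x y] by blast
  qed
  ultimately show ?thesis using Finite_Set.bex_max_element[of S "\<lambda>x y. x \<sqsubseteq> y \<and> x \<noteq> y"] assms(2) by blast
qed

lemma ex_minimal_elem:
  assumes "S \<subseteq> carrier L" "S \<noteq> {}"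
  shows "\<exists>m\<in>S. \<forall>x\<in>S. x \<sqsubseteq> m \<longrightarrow> x = m"
proof -
  have "finite S" using assms finite_carrier finite_subset by blast
  moreover have "asymp_on S (\<lambda>x y. x \<sqsubseteq> y \<and> x \<noteq> y)"
    using assms(1) by (intro asymp_onI) (meson le_antisym subsetD)
  moreover have "transp_on S (\<lambda>x y. x \<sqsubseteq> y \<and> x \<noteq> y)"
  proof (rule transp_onI)
    fix x y z assume m: "x \<in> S" "y \<in> S" "z \<in> S" "x \<sqsubseteq> y \<and> x \<noteq> y" "y \<sqsubseteq> z \<and> y \<noteq> z"
    then have "x \<in> carrier L" "y \<in> carrier L" "z \<in> carrier L" using assms(1) by auto
    then show "x \<sqsubseteq> z \<and> x \<noteq> z" using m le_trans[of x y z] le_antisym[of x y] by blast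
  qed
  ultimately show ?thesis using Finite_Set.bex_min_element[of S "\<lambda>x y. x \<sqsubseteq> y \<and> x \<noteq> y"] assms(2) by blast
qed

lemma complemented_atomD:
  assumes "complemented b u" "x \<in> carrier L" "b \<sqsubseteq> x" "x \<sqsubseteq> u" "x \<noteq> u"
  shows "\<exists>p. cov b p \<and> p \<sqsubseteq> u \<and> \<not> p \<sqsubseteq> x"
proof -
  note [simp] = complementedD[OF assms(1)] assms(2-4)
  obtain y where y [simp]: "y \<in> carrier L" "b \<sqsubseteq> y" "y \<sqsubseteq> u" "x \<sqinter> y = b" "x \<squnion> y = u"
    using complementedE[OF assms(1-4)] by blast
  have "b \<noteq> y" using y(5) assms by (metis join_absorb y(1))
  then obtain p where p: "cov b p" "p \<sqsubseteq> y" using ex_atom[of b y] by auto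
  note [simp] = covD[OF p(1)]
  have "\<not> p \<sqsubseteq> x"
  proof
    assume "p \<sqsubseteq> x"
    then have "p \<sqsubseteq> x \<sqinter> y" using p by (simp del: y(4))
    then show False by simp
  qed
  moreover have "p \<sqsubseteq> u" using p le_trans[of p y u] by simp
  ultimately show ?thesis using p by blast
qed

lemma complemented_coatomD:
  assumes "complemented b u" "x \<in> carrier L" "b \<sqsubseteq> x" "x \<sqsubseteq> u" "x \<noteq> b"
  shows "\<exists>c. cov c u \<and> b \<sqsubseteq> c \<and> \<not> x \<sqsubseteq> c"
proof -
  note [simp] = complementedD[OF assms(1)] assms(2-4)
  obtain y where y [simp]: "y \<in> carrier L" "b \<sqsubseteq> y" "y \<sqsubseteq> u" "x \<sqinter> y = b" "x \<squnion> y = u"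
    using complementedE[OF assms(1-4)] by blast
  have "y \<noteq> u" using y(4) assms by (metis meet_absorb y(1))
  then obtain c where c: "cov c u" "y \<sqsubseteq> c" using ex_coatom[of y u] by auto
  note [simp] = covD[OF c(1)]
  have "\<not> x \<sqsubseteq> c"
  proof
    assume "x \<sqsubseteq> c"
    then have "x \<squnion> y \<sqsubseteq> c" using c by (simp del: y(5))
    then show False by simp
  qed
  moreover have "b \<sqsubseteq> c" using c le_trans[of b y c] by simp
  ultimately show ?thesis using c by blast
qed

text \<open>A modular interval is complemented as soon as its atoms detect every proper element;
  \<open>complemented_atomD\<close> is the converse. A maximal \<open>y\<close> disjoint from
  \<open>x\<close> is a complement: an atom not below \<open>x \<squnion> y\<close> could be joined
  to \<open>y\<close> without meeting \<open>x\<close>.\<close>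

lemma complemented_atomI:
  assumes [simp]: "b \<in> carrier L" "u \<in> carrier L" "b \<sqsubseteq> u"
    and "\<And>x. x \<in> carrier L \<Longrightarrow> b \<sqsubseteq> x \<Longrightarrow> x \<sqsubseteq> u \<Longrightarrow> x \<noteq> u \<Longrightarrow> \<exists>p. cov b p \<and> p \<sqsubseteq> u \<and> \<not> p \<sqsubseteq> x"
  shows "complemented b u"
proof (rule complementedI)
  fix x assume x [simp]: "x \<in> carrier L" "b \<sqsubseteq> x" "x \<sqsubseteq> u"
  have sub: "{y \<in> ivl b u. x \<sqinter> y = b} \<subseteq> carrier L" by (auto simp: ivl_iff)
  have "b \<in> {y \<in> ivl b u. x \<sqinter> y = b}" by (simp add: ivl_iff)
  then obtain y where "y \<in> {y \<in> ivl b u. x \<sqinter> y = b}"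
    and max: "\<forall>z\<in>{y \<in> ivl b u. x \<sqinter> y = b}. y \<sqsubseteq> z \<longrightarrow> z = y"
    using ex_maximal_elem[OF sub] by blast
  then have y [simp]: "y \<in> carrier L" "b \<sqsubseteq> y" "y \<sqsubseteq> u" "x \<sqinter> y = b" by (auto simp: ivl_iff)
  have "x \<squnion> y = u"
  proof (rule ccontr)
    assume "x \<squnion> y \<noteq> u"
    then obtain p where p: "cov b p" "p \<sqsubseteq> u" "\<not> p \<sqsubseteq> x \<squnion> y"
      using assms(4)[of "x \<squnion> y"] by auto
    note [simp] = covD[OF p(1)] p(2)
    have "(x \<squnion> y) \<sqinter> p = b" using cov_join(2)[OF p(1), of "x \<squnion> y"] p by simp
    then have "(y \<squnion> p) \<sqinter> (x \<squnion> y) = y"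
      using modular[of y "x \<squnion> y" p] by (simp add: meet_comm[of L p] join_absorb)
    moreover have "x \<sqinter> (y \<squnion> p) \<sqsubseteq> (y \<squnion> p) \<sqinter> (x \<squnion> y)" by simp
    ultimately have "x \<sqinter> (y \<squnion> p) \<sqsubseteq> x \<sqinter> y" by (simp del: y(4))
    then have "x \<sqinter> (y \<squnion> p) = b" by (intro le_antisym) auto
    then have "y \<squnion> p = y" using max by (auto simp: ivl_iff)
    then have "p \<sqsubseteq> y" by simp
    then show False using p by simp
  qed
  then show "\<exists>y\<in>carrier L. b \<sqsubseteq> y \<and> y \<sqsubseteq> u \<and> x \<sqinter> y \<sqsubseteq> b \<and> u \<sqsubseteq> x \<squnion> y"
    by (auto intro: bexI[of _ y])
qed auto

lemma complemented_coatomI: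
  assumes [simp]: "b \<in> carrier L" "u \<in> carrier L" "b \<sqsubseteq> u"
    and "\<And>x. x \<in> carrier L \<Longrightarrow> b \<sqsubseteq> x \<Longrightarrow> x \<sqsubseteq> u \<Longrightarrow> x \<noteq> b \<Longrightarrow> \<exists>c. cov c u \<and> b \<sqsubseteq> c \<and> \<not> x \<sqsubseteq> c"
  shows "complemented b u"
proof (rule complementedI)
  fix x assume x [simp]: "x \<in> carrier L" "b \<sqsubseteq> x" "x \<sqsubseteq> u"
  have sub: "{y \<in> ivl b u. x \<squnion> y = u} \<subseteq> carrier L" by (auto simp: ivl_iff)
  have "u \<in> {y \<in> ivl b u. x \<squnion> y = u}" by (simp add: ivl_iff)
  then obtain y where "y \<in> {y \<in> ivl b u. x \<squnion> y = u}"
    and min: "\<forall>z\<in>{y \<in> ivl b u. x \<squnion> y = u}. z \<sqsubseteq> y \<longrightarrow> z = y"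
    using ex_minimal_elem[OF sub] by blast
  then have y [simp]: "y \<in> carrier L" "b \<sqsubseteq> y" "y \<sqsubseteq> u" "x \<squnion> y = u" by (auto simp: ivl_iff)
  have "x \<sqinter> y = b"
  proof (rule ccontr)
    assume "x \<sqinter> y \<noteq> b"
    then obtain c where c: "cov c u" "b \<sqsubseteq> c" "\<not> x \<sqinter> y \<sqsubseteq> c"
      using assms(4)[of "x \<sqinter> y"] by auto
    note [simp] = covD[OF c(1)] c(2)
    have "(x \<sqinter> y) \<squnion> c = u" using cov_meet(2)[OF c(1), of "x \<sqinter> y"] c by simp
    then have "(x \<sqinter> y) \<squnion> (c \<sqinter> y) = y"
      using modular[of "x \<sqinter> y" y c] by (simp add: meet_absorb' del: meet_leI1)
    moreover have "(x \<sqinter> y) \<squnion> (c \<sqinter> y) \<sqsubseteq> x \<squnion> (y \<sqinter> c)" by simp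
    ultimately have "x \<squnion> y \<sqsubseteq> x \<squnion> (y \<sqinter> c)" by (simp del: y(4))
    then have "x \<squnion> (y \<sqinter> c) = u" by (intro le_antisym) auto
    then have "y \<sqinter> c = y" using min by (auto simp: ivl_iff)
    then have "y \<sqsubseteq> c" by simp
    then show False using c by simp
  qed
  then show "\<exists>y\<in>carrier L. b \<sqsubseteq> y \<and> y \<sqsubseteq> u \<and> x \<sqinter> y \<sqsubseteq> b \<and> u \<sqsubseteq> x \<squnion> y"
    by (auto intro: bexI[of _ y])
qed auto

text \<open>By the atom criterion: a \<open>z\<close> properly below \<open>x \<squnion> y\<close>
  misses \<open>x\<close> or \<open>y\<close>, and hence an atom below that one.\<close>

lemma complemented_join:
  assumes "complemented b x" "complemented b y"
  shows "complemented b (x \<squnion> y)"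
proof (rule complemented_atomI)
  note [simp] = complementedD[OF assms(1)] complementedD[OF assms(2)]
  fix z assume z [simp]: "z \<in> carrier L" "b \<sqsubseteq> z" "z \<sqsubseteq> x \<squnion> y" "z \<noteq> x \<squnion> y"
  have *: "\<exists>p. cov b p \<and> p \<sqsubseteq> x \<squnion> y \<and> \<not> p \<sqsubseteq> z"
    if w: "complemented b w" "w \<sqsubseteq> x \<squnion> y" "\<not> w \<sqsubseteq> z" for w
  proof -
    note [simp] = complementedD[OF w(1)]
    have "z \<sqinter> w \<noteq> w" using w by simp
    then obtain p where p: "cov b p" "p \<sqsubseteq> w" "\<not> p \<sqsubseteq> z \<sqinter> w"
      using complemented_atomD[OF w(1), of "z \<sqinter> w"] by auto
    note [simp] = covD[OF p(1)]
    show ?thesis using p w le_trans[of p w "x \<squnion> y"] by auto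
  qed
  have "\<not> (x \<sqsubseteq> z \<and> y \<sqsubseteq> z)"
    using le_antisym[of z "x \<squnion> y"] z by auto
  then show "\<exists>p. cov b p \<and> p \<sqsubseteq> x \<squnion> y \<and> \<not> p \<sqsubseteq> z"
    using *[OF assms(1)] *[OF assms(2)] by auto
qed (use complementedD[OF assms(1)] complementedD[OF assms(2)] in auto)

lemma complemented_meet:
  assumes "complemented x u" "complemented y u"
  shows "complemented (x \<sqinter> y) u"
proof (rule complemented_coatomI)
  note [simp] = complementedD[OF assms(1)] complementedD[OF assms(2)]
  fix z assume z [simp]: "z \<in> carrier L" "x \<sqinter> y \<sqsubseteq> z" "z \<sqsubseteq> u" "z \<noteq> x \<sqinter> y"
  have *: "\<exists>c. cov c u \<and> x \<sqinter> y \<sqsubseteq> c \<and> \<not> z \<sqsubseteq> c"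
    if w: "complemented w u" "x \<sqinter> y \<sqsubseteq> w" "\<not> z \<sqsubseteq> w" for w
  proof -
    note [simp] = complementedD[OF w(1)]
    have "z \<squnion> w \<noteq> w" using w by simp
    then obtain c where c: "cov c u" "w \<sqsubseteq> c" "\<not> z \<squnion> w \<sqsubseteq> c"
      using complemented_coatomD[OF w(1), of "z \<squnion> w"] by auto
    note [simp] = covD[OF c(1)]
    show ?thesis using c w le_trans[of "x \<sqinter> y" w c] by auto
  qed
  have "\<not> (z \<sqsubseteq> x \<and> z \<sqsubseteq> y)"
    using le_antisym[of z "x \<sqinter> y"] z by auto
  then show "\<exists>c. cov c u \<and> x \<sqinter> y \<sqsubseteq> c \<and> \<not> z \<sqsubseteq> c"
    using *[OF assms(1)] *[OF assms(2)] by auto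
qed (use complementedD[OF assms(1)] complementedD[OF assms(2)] in auto)

text \<open>Every \<open>z\<close> above \<open>x\<close> contains an atom \<open>a\<close>, and
  \<open>moebius_atom\<close> with a nonzero left side provides a coatom avoiding \<open>a\<close>.
  So the coatoms detect everything above \<open>x\<close>.\<close>

lemma complemented_if_moebius:
  assumes "x \<in> carrier L" "\<mu> x t \<noteq> 0"
  shows "complemented x t"
proof (rule complemented_coatomI)
  fix z assume z: "z \<in> carrier L" "x \<sqsubseteq> z" "z \<sqsubseteq> t" "z \<noteq> x"
  then obtain a where a: "cov x a" "a \<sqsubseteq> z" using ex_atom[of x z] assms by auto
  have "coatoms x a \<noteq> {}" using moebius_atom[OF a(1)] assms(2) by auto
  then obtain c where "cov c t" "x \<sqsubseteq> c" "\<not> a \<sqsubseteq> c" by (auto simp: coatoms_def)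
  then show "\<exists>c. cov c t \<and> x \<sqsubseteq> c \<and> \<not> z \<sqsubseteq> c"
    using a z covD[of c t] covD[OF a(1)] le_trans[of a z c] by blast
qed (use assms in auto)


subsection \<open>Iterated complemented intervals\<close>

text \<open>The steps need not be maximal: \<open>x\<close> is reached from \<open>b\<close> by some
  \<open>i\<close> complemented intervals, which says that the Loewy length is at most
  \<open>i\<close>. This form is stable under the lattice operations; the Loewy series itself is
  recovered in \<open>ex_greatest_loewy\<close>.\<close>

fun loewy :: "nat \<Rightarrow> 'a \<Rightarrow> 'a \<Rightarrow> bool" where
  "loewy 0 b x \<longleftrightarrow> x = b \<and> b \<in> carrier L"
| "loewy (Suc i) b x \<longleftrightarrow> (\<exists>y. loewy i b y \<and> complemented y x)"

lemma loewyD: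
  assumes "loewy i b x"
  shows "b \<in> carrier L" "x \<in> carrier L" "b \<sqsubseteq> x"
proof -
  have "b \<in> carrier L \<and> x \<in> carrier L \<and> b \<sqsubseteq> x"
    using assms
  proof (induction i arbitrary: x)
    case (Suc i)
    then obtain y where "loewy i b y" "complemented y x" by auto
    with Suc.IH[of y] show ?case using complementedD[of y x] le_trans[of b y x] by blast
  qed auto
  then show "b \<in> carrier L" "x \<in> carrier L" "b \<sqsubseteq> x" by blast+
qed

lemma loewy_refl: "b \<in> carrier L \<Longrightarrow> loewy i b b"
  by (induction i) (auto intro: complemented_self)

lemma loewy_Suc: "loewy i b x \<Longrightarrow> loewy (Suc i) b x"
  using complemented_self loewyD(2) by auto

lemma loewy_mono: "i \<le> j \<Longrightarrow> loewy i b x \<Longrightarrow> loewy j b x"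
  by (induction j rule: dec_induct) (auto simp del: loewy.simps intro: loewy_Suc)

lemma loewy_lower: "loewy i b x \<Longrightarrow> z \<in> carrier L \<Longrightarrow> b \<sqsubseteq> z \<Longrightarrow> z \<sqsubseteq> x \<Longrightarrow> loewy i b z"
proof (induction i arbitrary: x z)
  case 0
  then show ?case by (auto dest: le_antisym)
next
  case (Suc i)
  then obtain y where y: "loewy i b y" "complemented y x" by auto
  note [simp] = loewyD[OF y(1)] complementedD[OF y(2)] Suc.prems(2-)
  have "loewy i b (y \<sqinter> z)" by (rule Suc.IH[OF y(1)]) auto
  moreover have "complemented (y \<sqinter> z) z"
    using complemented_pull[OF y(2), of z] by (simp add: meet_absorb')
  ultimately show ?case by auto
qed

text \<open>Both last steps are pushed up to the common lower end \<open>y \<squnion> y'\<close>,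
  where complemented intervals can be joined.\<close>

lemma loewy_join: "loewy i b x \<Longrightarrow> loewy i b x' \<Longrightarrow> loewy i b (x \<squnion> x')"
proof (induction i arbitrary: x x')
  case 0
  then show ?case by (auto simp: join_absorb)
next
  case (Suc i)
  then obtain y y' where y: "loewy i b y" "complemented y x" "loewy i b y'" "complemented y' x'" by auto
  note [simp] = loewyD[OF y(1)] complementedD[OF y(2)] loewyD[OF y(3)] complementedD[OF y(4)]
  have "complemented (y \<squnion> y') ((x \<squnion> y') \<squnion> (x' \<squnion> y))"
    using complemented_join[OF complemented_push[OF y(2), of y'], of "x' \<squnion> y"]
      complemented_push[OF y(4), of y] by (simp add: join_comm[of L y' y])
  moreover have "(x \<squnion> y') \<squnion> (x' \<squnion> y) = x \<squnion> x'"
    by (rule le_antisym) auto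
  ultimately have "complemented (y \<squnion> y') (x \<squnion> x')" by simp
  then show ?case using Suc.IH[OF y(1,3)] by auto
qed

lemma loewy_push: "loewy i b x \<Longrightarrow> c \<in> carrier L \<Longrightarrow> b \<sqsubseteq> c \<Longrightarrow> loewy i c (x \<squnion> c)"
proof (induction i arbitrary: x)
  case 0
  then show ?case by (auto simp: join_absorb')
next
  case (Suc i)
  then obtain y where "loewy i b y" "complemented y x" by auto
  then show ?case using Suc.IH[of y] Suc.prems(2,3) complemented_push[of y x c] by auto
qed

lemma ex_loewy:
  assumes "b \<in> carrier L" "x \<in> carrier L" "b \<sqsubseteq> x"
  shows "\<exists>i. loewy i b x"
proof -
  obtain n where n: "chain n b x" using ex_chain assms by blast
  have "chain n b x \<Longrightarrow> loewy m c b \<Longrightarrow> loewy (m + n) c x" for m c b x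
  proof (induction n arbitrary: b m)
    case (Suc n)
    then obtain z where z: "cov b z" "chain n z x" by auto
    then have "loewy (Suc m) c z" using Suc.prems complemented_cov by auto
    then show ?case using Suc.IH[OF z(2)] by fastforce
  qed auto
  from this[OF n, of 0 b] assms show ?thesis by auto
qed

text \<open>Closure under joins turns a maximal element into a greatest one; it is the
  \<open>i\<close>-th term of the Loewy series over \<open>b\<close>.\<close>

lemma ex_greatest_loewy:
  assumes "b \<in> carrier L"
  shows "\<exists>s. loewy i b s \<and> (\<forall>y. loewy i b y \<longrightarrow> y \<sqsubseteq> s)"
proof -
  have "{s. loewy i b s} \<subseteq> carrier L" "b \<in> {s. loewy i b s}"
    using loewyD loewy_refl assms by auto
  then obtain s where s: "loewy i b s" "\<forall>x. loewy i b x \<longrightarrow> s \<sqsubseteq> x \<longrightarrow> x = s"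
    using ex_maximal_elem[of "{s. loewy i b s}"] by auto
  have "y \<sqsubseteq> s" if "loewy i b y" for y
    using s(2) loewy_join[OF s(1) that] loewyD[OF s(1)] loewyD[OF that] by auto
  then show ?thesis using s by blast
qed

end

context finite_modular_lattice
begin

subsection \<open>Perspectivity of atoms\<close>

text \<open>For distinct atoms the third atom \<open>r\<close> on their line is a common complement
  of \<open>p\<close> and \<open>q\<close> inside \<open>p \<squnion> q\<close>, so this is
  perspectivity in the usual sense.\<close>

definition perspective :: "'a \<Rightarrow> 'a \<Rightarrow> 'a \<Rightarrow> bool" where
  "perspective b p q \<longleftrightarrow> cov b p \<and> cov b q \<and>
     (p = q \<or> (\<exists>r. cov b r \<and> r \<noteq> p \<and> r \<noteq> q \<and> r \<sqsubseteq> p \<squnion> q))"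

lemma atom_not_le: "cov b p \<Longrightarrow> cov b q \<Longrightarrow> p \<noteq> q \<Longrightarrow> \<not> q \<sqsubseteq> p"
  using cov_unique by blast

lemma cov_atoms_join: "cov b p \<Longrightarrow> cov b q \<Longrightarrow> p \<noteq> q \<Longrightarrow> cov p (p \<squnion> q)"
  using cov_join(1)[of b q p] atom_not_le[of b p q] covD[of b p] by blast

lemma line_eq:
  assumes "cov b p" "cov b q" "cov b r" "p \<noteq> q" "r \<noteq> p" "r \<sqsubseteq> p \<squnion> q"
  shows "p \<squnion> r = p \<squnion> q"
  using cov_join_eq[OF cov_atoms_join[OF assms(1,2,4)], of r] atom_not_le[OF assms(1,3)] assms covD[OF assms(3)]
  by auto

lemma perspective_sym: "perspective b p q \<Longrightarrow> perspective b q p"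
  unfolding perspective_def by (metis join_comm)

text \<open>Projective geometry: with \<open>s\<close> a third point on the line \<open>p q\<close>
  and \<open>u\<close> one on the line \<open>q r\<close>, the lines \<open>s u\<close> and
  \<open>p r\<close> lie in a common plane and meet in a point, which is the third point on
  \<open>p r\<close>.\<close>

lemma perspective_trans:
  assumes "perspective b p q" "perspective b q r"
  shows "perspective b p r"
proof -
  have at: "cov b p" "cov b q" "cov b r" using assms by (auto simp: perspective_def)
  note [simp] = covD[OF at(1)] covD[OF at(2)] covD[OF at(3)]
  show ?thesis
  proof (cases "p = q \<or> q = r \<or> p = r")
    case True
    then show ?thesis using assms at by (auto simp: perspective_def)
  next
    case False
    then have d: "p \<noteq> q" "q \<noteq> r" "p \<noteq> r" by auto
    obtain s where s: "cov b s" "s \<noteq> p" "s \<noteq> q" "s \<sqsubseteq> p \<squnion> q" using assms d by (auto simp: perspective_def)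
    obtain u where u: "cov b u" "u \<noteq> q" "u \<noteq> r" "u \<sqsubseteq> q \<squnion> r" using assms d by (auto simp: perspective_def)
    note [simp] = covD[OF s(1)] covD[OF u(1)]
    have ps: "p \<squnion> s = p \<squnion> q" using line_eq[OF at(1,2) s(1)] s d by blast
    have qs: "q \<squnion> s = p \<squnion> q" using line_eq[OF at(2,1) s(1)] s d by (simp add: join_comm[of L q p])
    have qu: "q \<squnion> u = q \<squnion> r" using line_eq[OF at(2,3) u(1)] u d by blast
    have ru: "r \<squnion> u = q \<squnion> r" using line_eq[OF at(3,2) u(1)] u d by (simp add: join_comm[of L r q])
    show ?thesis
    \<comment> \<open>If the three atoms are collinear, \<open>q\<close> itself is the third atom on
      the line of \<open>p\<close> and \<open>r\<close>.\<close>
    proof (cases "r \<sqsubseteq> p \<squnion> q")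
      case True
      then have "p \<squnion> r = p \<squnion> q" using line_eq[OF at(1,2,3)] d by blast
      then have "q \<sqsubseteq> p \<squnion> r" by simp
      then show ?thesis using at d unfolding perspective_def by metis
    next
      case False
      have nq: "\<not> q \<sqsubseteq> p \<squnion> r"
      proof
        assume "q \<sqsubseteq> p \<squnion> r"
        then have "p \<squnion> q = p \<squnion> r" using line_eq[OF at(1,3,2)] d by blast
        then show False using False by simp
      qed
      have ns: "\<not> s \<sqsubseteq> p \<squnion> r"
      proof
        assume "s \<sqsubseteq> p \<squnion> r"
        then have "p \<squnion> s \<sqsubseteq> p \<squnion> r" by simp
        then show False using ps nq by simp
      qed
      have "s \<noteq> u"
      proof
        assume "s = u"
        then have "p \<squnion> q = q \<squnion> r" using qs qu by simp
        then show False using False le_joinI2[of r r q] by simp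
      qed
      then have su: "cov s (s \<squnion> u)" "cov u (s \<squnion> u)"
        using cov_atoms_join[OF s(1) u(1)] cov_atoms_join[OF u(1) s(1)] by (auto simp: join_comm[of L u s])
      \<comment> \<open>The intersection of the two lines. Since the line
        \<open>p \<squnion> r\<close> is covered by the plane and does not contain \<open>s\<close>,
        it cuts \<open>s \<squnion> u\<close> in a coatom of that line, that is, in an atom over
        \<open>b\<close>.\<close>
      define v where "v = (s \<squnion> u) \<sqinter> (p \<squnion> r)"
      have [simp]: "v \<in> carrier L" "b \<sqsubseteq> v" "v \<sqsubseteq> p \<squnion> r" "v \<sqsubseteq> s \<squnion> u" by (simp_all add: v_def)
      have cl: "cov (p \<squnion> r) ((p \<squnion> r) \<squnion> q)" by (rule cov_join(1)[OF at(2)]) (use nq in auto)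
      have "p \<squnion> q \<sqsubseteq> (p \<squnion> r) \<squnion> q" "q \<squnion> r \<sqsubseteq> (p \<squnion> r) \<squnion> q" by auto
      then have "s \<sqsubseteq> (p \<squnion> r) \<squnion> q" "u \<sqsubseteq> (p \<squnion> r) \<squnion> q"
        using s(4) u(4) le_trans[of s "p \<squnion> q" "(p \<squnion> r) \<squnion> q"] le_trans[of u "q \<squnion> r" "(p \<squnion> r) \<squnion> q"] by auto
      then have cv: "cov v (s \<squnion> u)"
        unfolding v_def using ns by (intro cov_meet(1)[OF cl]) auto
      have nv: "\<not> v \<sqsubseteq> s"
      proof
        assume "v \<sqsubseteq> s"
        then have "s = v \<or> s = s \<squnion> u" using cov_between[OF cv, of s] by simp
        moreover have "s \<noteq> s \<squnion> u" using covD[OF su(1)] by blast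
        moreover have "s \<noteq> v" using ns by (metis \<open>v \<sqsubseteq> p \<squnion> r\<close>)
        ultimately show False by blast
      qed
      have "cov (v \<sqinter> s) v" using nv by (intro cov_meet(1)[OF su(1)]) auto
      moreover have "v \<sqinter> s = b"
      proof -
        have "v \<sqinter> s = b \<or> v \<sqinter> s = s" using cov_between[OF s(1), of "v \<sqinter> s"] by simp
        moreover have "v \<sqinter> s \<noteq> s"
        proof
          assume "v \<sqinter> s = s"
          then have "s \<sqsubseteq> v" by simp
          then show False using ns le_trans[of s v "p \<squnion> r"] by simp
        qed
        ultimately show ?thesis by blast
      qed
      ultimately have v: "cov b v" by simp
      have "v \<noteq> p"
      proof
        assume "v = p"
        then have "p \<sqsubseteq> s \<squnion> u" using \<open>v \<sqsubseteq> s \<squnion> u\<close> by simp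
        then have "s \<squnion> p = s \<squnion> u" using cov_join_eq[OF su(1), of p] atom_not_le[OF s(1) at(1)] s by auto
        then have "u \<sqsubseteq> s \<squnion> p" by simp
        then have "q \<squnion> u \<sqsubseteq> p \<squnion> q" using ps join_comm[of L s p] by simp
        then show False using qu False by simp
      qed
      moreover have "v \<noteq> r"
      proof
        assume "v = r"
        then have "r \<sqsubseteq> s \<squnion> u" using \<open>v \<sqsubseteq> s \<squnion> u\<close> by simp
        then have "u \<squnion> r = s \<squnion> u" using cov_join_eq[OF su(2), of r] atom_not_le[OF u(1) at(3)] u by auto
        then have "s \<sqsubseteq> u \<squnion> r" by simp
        then have "s \<sqsubseteq> q \<squnion> r" using ru join_comm[of L u r] by simp
        then have "q \<squnion> s \<sqsubseteq> q \<squnion> r" by simp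
        then have "p \<squnion> q \<sqsubseteq> q \<squnion> r" using qs by simp
        then have "p \<sqsubseteq> q \<squnion> r" by simp
        then have "q \<squnion> p = q \<squnion> r" using line_eq[OF at(2,3,1)] d by blast
        then show False using False le_joinI2[of r r q] join_comm[of L q p] by simp
      qed
      ultimately show ?thesis
        unfolding perspective_def using v at \<open>v \<sqsubseteq> p \<squnion> r\<close> by blast
    qed
  qed
qed

text \<open>The join of a set of atoms closed under perspectivity acquires no atoms outside the set.
  This converts a partition of the atoms into a decomposition of the lattice.\<close>

lemma join_of_perspective_closed:
  assumes b [simp]: "b \<in> carrier L" and S: "\<And>p. p \<in> S \<Longrightarrow> cov b p"
    and closed: "\<And>p q. p \<in> S \<Longrightarrow> perspective b p q \<Longrightarrow> q \<in> S"
  shows "\<exists>h. complemented b h \<and> (\<forall>p\<in>S. p \<sqsubseteq> h) \<and> (\<forall>q. cov b q \<longrightarrow> q \<sqsubseteq> h \<longrightarrow> q \<in> S)"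
proof -
  have "finite S" using S covD(2) finite_carrier by (meson finite_subset subsetI)
  have "T \<subseteq> S \<Longrightarrow> \<exists>h. complemented b h \<and> (\<forall>p\<in>T. p \<sqsubseteq> h) \<and> (\<forall>q. cov b q \<longrightarrow> q \<sqsubseteq> h \<longrightarrow> q \<in> S)"
    if "finite T" for T
    using that
  proof (induction T rule: finite_induct)
    case empty
    show ?case using complemented_self[OF b] covD(5) by blast
  next
    case (insert p T)
    then obtain h where h: "complemented b h" "\<forall>p\<in>T. p \<sqsubseteq> h" "\<And>q. cov b q \<Longrightarrow> q \<sqsubseteq> h \<Longrightarrow> q \<in> S" by auto
    have p: "p \<in> S" "cov b p" using insert S by auto
    note [simp] = complementedD[OF h(1)] covD[OF p(2)]
    have "q \<in> S" if q: "cov b q" "q \<sqsubseteq> h \<squnion> p" for q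
    proof (cases "q \<sqsubseteq> h \<or> p \<sqsubseteq> h \<or> q = p")
      case True
      then show ?thesis using h(3)[OF q(1)] q p by (auto simp: join_absorb)
    next
      case False
      note [simp] = covD[OF q(1)] q(2)
      have ph: "cov h (h \<squnion> p)" "h \<sqinter> p = b" using cov_join[OF p(2), of h] False by auto
      have pq: "cov p (p \<squnion> q)" using cov_atoms_join[OF p(2) q(1)] False by auto
      \<comment> \<open>A new atom \<open>q\<close> below \<open>h \<squnion> p\<close> spans with
        \<open>p\<close> a line that meets \<open>h\<close> in a third atom, so \<open>q\<close> is
        perspective to \<open>p\<close>.\<close>
      define r where "r = (p \<squnion> q) \<sqinter> h"
      have [simp]: "r \<in> carrier L" "b \<sqsubseteq> r" "r \<sqsubseteq> h" "r \<sqsubseteq> p \<squnion> q" by (simp_all add: r_def)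
      have rc: "cov r (p \<squnion> q)" unfolding r_def using False by (intro cov_meet(1)[OF ph(1)]) auto
      have nrp: "\<not> r \<sqsubseteq> p"
      proof
        assume "r \<sqsubseteq> p"
        then have "p = r" using cov_between[OF rc, of p] covD[OF pq] by simp
        then show False using False \<open>r \<sqsubseteq> h\<close> by simp
      qed
      have "r \<sqinter> p \<sqsubseteq> h \<sqinter> p" by simp
      then have "r \<sqinter> p = b" using ph by (intro le_antisym) auto
      then have r: "cov b r" using cov_meet(1)[OF pq, of r] nrp by simp
      have "r \<noteq> p" "r \<noteq> q" using False \<open>r \<sqsubseteq> h\<close> by blast+
      then have "perspective b p q" unfolding perspective_def using p q r \<open>r \<sqsubseteq> p \<squnion> q\<close> by blast
      then show ?thesis using closed p by blast
    qed
    moreover have "complemented b (h \<squnion> p)" by (rule complemented_join[OF h(1) complemented_cov[OF p(2)]])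
    moreover have "\<forall>q\<in>insert p T. q \<sqsubseteq> h \<squnion> p"
    proof
      fix q assume q: "q \<in> insert p T"
      then have "q \<in> carrier L" using insert.prems S[of q] covD(2)[of b q] by auto
      then show "q \<sqsubseteq> h \<squnion> p" using q h(2) by auto
    qed
    ultimately show ?case by blast
  qed
  from this[OF \<open>finite S\<close>] show ?thesis by simp
qed


subsection \<open>Distributive elements\<close>

definition distributive :: "'a \<Rightarrow> 'a set" where
  "distributive b = {H \<in> ivl b t. \<forall>K\<^sub>1\<in>ivl b t. \<forall>K\<^sub>2\<in>ivl b t.
     H \<squnion> (K\<^sub>1 \<sqinter> K\<^sub>2) = (H \<squnion> K\<^sub>1) \<sqinter> (H \<squnion> K\<^sub>2)}"

lemma finite_distributive [simp, intro]: "finite (distributive b)"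
  by (simp add: distributive_def)

lemma distributiveI:
  assumes "H \<in> carrier L" "b \<sqsubseteq> H"
    and "\<And>k l. k \<in> carrier L \<Longrightarrow> l \<in> carrier L \<Longrightarrow> b \<sqsubseteq> k \<Longrightarrow> b \<sqsubseteq> l \<Longrightarrow>
      (H \<squnion> k) \<sqinter> (H \<squnion> l) \<sqsubseteq> H \<squnion> (k \<sqinter> l)"
  shows "H \<in> distributive b"
  unfolding distributive_def
proof (intro CollectI conjI ballI)
  fix k l assume "k \<in> ivl b t" "l \<in> ivl b t"
  then have [simp]: "k \<in> carrier L" "l \<in> carrier L" "b \<sqsubseteq> k" "b \<sqsubseteq> l" by (auto simp: ivl_iff)
  show "H \<squnion> (k \<sqinter> l) = (H \<squnion> k) \<sqinter> (H \<squnion> l)"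
    using assms by (intro le_antisym) auto
qed (use assms in \<open>auto simp: ivl_iff\<close>)

lemma distributiveD:
  assumes "H \<in> distributive b"
  shows "H \<in> carrier L" "b \<sqsubseteq> H"
    and "\<And>k l. k \<in> carrier L \<Longrightarrow> l \<in> carrier L \<Longrightarrow> b \<sqsubseteq> k \<Longrightarrow> b \<sqsubseteq> l \<Longrightarrow>
      H \<squnion> (k \<sqinter> l) = (H \<squnion> k) \<sqinter> (H \<squnion> l)"
  using assms by (auto simp: distributive_def ivl_iff)

lemma top_distributive: "b \<in> carrier L \<Longrightarrow> t \<in> distributive b"
  by (rule distributiveI) (auto simp: join_absorb)

lemma card_distributive_pos: "b \<in> carrier L \<Longrightarrow> card (distributive b) \<ge> 1"
  using top_distributive card_gt_0_iff[of "distributive b"] by fastforce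

text \<open>An internal direct product: \<open>k \<mapsto> (k \<sqinter> h, k \<sqinter> h')\<close>
  identifies the interval from \<open>b\<close> to \<open>t\<close> with the product of those from
  \<open>b\<close> to \<open>h\<close> and from \<open>b\<close> to \<open>h'\<close>.\<close>

definition splits :: "'a \<Rightarrow> 'a \<Rightarrow> 'a \<Rightarrow> bool" where
  "splits b h h' \<longleftrightarrow> b \<in> carrier L \<and> h \<in> carrier L \<and> h' \<in> carrier L \<and> b \<sqsubseteq> h \<and> b \<sqsubseteq> h' \<and> h \<sqinter> h' = b \<and>
     (\<forall>k\<in>carrier L. b \<sqsubseteq> k \<longrightarrow> k = (k \<sqinter> h) \<squnion> (k \<sqinter> h'))"

lemma splits_sym: "splits b h h' \<Longrightarrow> splits b h' h"
  unfolding splits_def by (metis join_comm meet_comm)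

text \<open>In a complemented interval every element is detected by its atoms, so it suffices that
  each atom lies in exactly one of the two factors.\<close>

lemma splitsI:
  assumes "complemented b t" "h \<in> carrier L" "h' \<in> carrier L" "b \<sqsubseteq> h" "b \<sqsubseteq> h'"
    and cover: "\<And>p. cov b p \<Longrightarrow> p \<sqsubseteq> h \<or> p \<sqsubseteq> h'"
    and disj: "\<And>p. cov b p \<Longrightarrow> p \<sqsubseteq> h \<Longrightarrow> \<not> p \<sqsubseteq> h'"
  shows "splits b h h'"
  unfolding splits_def
proof (intro conjI ballI impI)
  note [simp] = complementedD[OF assms(1)] assms(2-5)
  show "h \<sqinter> h' = b"
  proof (rule ccontr)
    assume "h \<sqinter> h' \<noteq> b"
    then obtain p where p: "cov b p" "p \<sqsubseteq> h \<sqinter> h'" using ex_atom[of b "h \<sqinter> h'"] by auto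
    then show False using disj covD[OF p(1)] by auto
  qed
  fix k assume k [simp]: "k \<in> carrier L" "b \<sqsubseteq> k"
  show "k = (k \<sqinter> h) \<squnion> (k \<sqinter> h')"
  proof (rule ccontr)
    assume "k \<noteq> (k \<sqinter> h) \<squnion> (k \<sqinter> h')"
    then have ne: "(k \<sqinter> h) \<squnion> (k \<sqinter> h') \<noteq> k" by (rule not_sym)
    have "complemented b k" by (rule complemented_lower[OF assms(1)]) auto
    from complemented_atomD[OF this _ _ _ ne]
    obtain p where p: "cov b p" "p \<sqsubseteq> k" "\<not> p \<sqsubseteq> (k \<sqinter> h) \<squnion> (k \<sqinter> h')" by auto
    then show False using cover[OF p(1)] covD[OF p(1)] by auto
  qed
qed (use assms complementedD[OF assms(1)] in auto)

text \<open>Projection to a factor preserves joins. After sorting the components of \<open>k\<close>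
  and \<open>l\<close> by factor, the part \<open>U\<close> in \<open>h\<close> meets
  \<open>h'\<close> only in \<open>b\<close>, and the modular law removes it.\<close>

lemma splits_meet_join:
  assumes "splits b h h'" "k \<in> carrier L" "l \<in> carrier L" "b \<sqsubseteq> k" "b \<sqsubseteq> l"
  shows "(k \<squnion> l) \<sqinter> h' = (k \<sqinter> h') \<squnion> (l \<sqinter> h')"
proof -
  have [simp]: "b \<in> carrier L" "h \<in> carrier L" "h' \<in> carrier L" "b \<sqsubseteq> h" "b \<sqsubseteq> h'" "h \<sqinter> h' = b"
    and eq: "\<And>k. k \<in> carrier L \<Longrightarrow> b \<sqsubseteq> k \<Longrightarrow> k = (k \<sqinter> h) \<squnion> (k \<sqinter> h')"
    using assms(1) unfolding splits_def by blast+
  note [simp] = assms(2-5)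
  define U where "U = (k \<sqinter> h) \<squnion> (l \<sqinter> h)"
  define V where "V = (k \<sqinter> h') \<squnion> (l \<sqinter> h')"
  have [simp]: "U \<in> carrier L" "V \<in> carrier L" "U \<sqsubseteq> h" "V \<sqsubseteq> h'" "b \<sqsubseteq> V" by (simp_all add: U_def V_def)
  have "(k \<sqinter> h) \<squnion> (k \<sqinter> h') \<sqsubseteq> V \<squnion> U" "(l \<sqinter> h) \<squnion> (l \<sqinter> h') \<sqsubseteq> V \<squnion> U"
    by (simp_all add: U_def V_def)
  then have "k \<sqsubseteq> V \<squnion> U" "l \<sqsubseteq> V \<squnion> U" using eq[of k] eq[of l] by simp_all
  then have "(k \<squnion> l) \<sqinter> h' \<sqsubseteq> (V \<squnion> U) \<sqinter> h'" by simp
  also have "(V \<squnion> U) \<sqinter> h' = V \<squnion> (U \<sqinter> h')" using modular[of V h' U] by simp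
  also have "U \<sqinter> h' \<sqsubseteq> h \<sqinter> h'" by (simp del: \<open>h \<sqinter> h' = b\<close>)
  then have "V \<squnion> (U \<sqinter> h') = V" using le_trans[of "U \<sqinter> h'" b V] by simp
  finally have "(k \<squnion> l) \<sqinter> h' \<sqsubseteq> V" .
  then show ?thesis unfolding V_def by (intro le_antisym) auto
qed

lemma splits_meet_join':
  assumes "splits b h h'" "k \<in> carrier L" "b \<sqsubseteq> k" "y \<in> carrier L" "b \<sqsubseteq> y" "y \<sqsubseteq> h"
  shows "(y \<squnion> k) \<sqinter> h' \<sqsubseteq> k"
proof -
  have [simp]: "b \<in> carrier L" "h \<in> carrier L" "h' \<in> carrier L" "b \<sqsubseteq> h" "b \<sqsubseteq> h'" and hh: "h \<sqinter> h' = b"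
    using assms(1) unfolding splits_def by blast+
  note [simp] = assms(2-6)
  have "y \<sqinter> h' \<sqsubseteq> h \<sqinter> h'" by simp
  then have "y \<sqinter> h' \<sqsubseteq> k" using hh le_trans[of "y \<sqinter> h'" b k] by simp
  then show ?thesis using splits_meet_join[OF assms(1), of y k] by simp
qed

lemma splits_leI:
  assumes "splits b h h'" "z \<in> carrier L" "b \<sqsubseteq> z" "w \<in> carrier L" "z \<sqinter> h \<sqsubseteq> w" "z \<sqinter> h' \<sqsubseteq> w"
  shows "z \<sqsubseteq> w"
proof -
  have [simp]: "h \<in> carrier L" "h' \<in> carrier L" and "z = (z \<sqinter> h) \<squnion> (z \<sqinter> h')"
    using assms unfolding splits_def by blast+
  moreover have "(z \<sqinter> h) \<squnion> (z \<sqinter> h') \<sqsubseteq> w" using assms by simp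
  ultimately show ?thesis by simp
qed

text \<open>The inequality may be tested on the factors by \<open>splits_leI\<close>. On
  \<open>h\<close> it is clear, and on \<open>h'\<close> the joins with \<open>h\<close> disappear
  by \<open>splits_meet_join'\<close>.\<close>

lemma splits_distributive:
  assumes "splits b h h'"
  shows "h \<in> distributive b"
proof -
  have [simp]: "b \<in> carrier L" "h \<in> carrier L" "h' \<in> carrier L" "b \<sqsubseteq> h" "b \<sqsubseteq> h'"
    using assms unfolding splits_def by blast+
  show ?thesis
  proof (rule distributiveI)
    fix k l assume kl [simp]: "k \<in> carrier L" "l \<in> carrier L" "b \<sqsubseteq> k" "b \<sqsubseteq> l"
    define z where "z = (h \<squnion> k) \<sqinter> (h \<squnion> l)"
    have [simp]: "z \<in> carrier L" "b \<sqsubseteq> z" "z \<sqsubseteq> h \<squnion> k" "z \<sqsubseteq> h \<squnion> l" by (simp_all add: z_def)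
    have "z \<sqinter> h' \<sqsubseteq> m" if "m \<in> {k, l}" for m
    proof -
      have "z \<sqinter> h' \<sqsubseteq> (h \<squnion> m) \<sqinter> h'" using that by auto
      moreover have "(h \<squnion> m) \<sqinter> h' \<sqsubseteq> m" using that by (intro splits_meet_join'[OF assms]) auto
      moreover have "m \<in> carrier L" using that by auto
      ultimately show ?thesis using le_trans[of "z \<sqinter> h'" "(h \<squnion> m) \<sqinter> h'" m] by simp
    qed
    then have 1: "z \<sqinter> h' \<sqsubseteq> h \<squnion> (k \<sqinter> l)" by simp
    show "(h \<squnion> k) \<sqinter> (h \<squnion> l) \<sqsubseteq> h \<squnion> (k \<sqinter> l)"
      unfolding z_def[symmetric] by (rule splits_leI[OF assms]) (use 1 in auto)
  qed auto
qed

text \<open>Since \<open>h\<close> is below \<open>x\<close>, it may be inserted into every join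
  with \<open>x\<close>; then distributivity of \<open>x\<close> over \<open>h\<close> and of
  \<open>h\<close> over \<open>b\<close> are used in turn.\<close>

lemma distributive_lift:
  assumes "h \<in> distributive b" "x \<in> distributive h" "b \<in> carrier L"
  shows "x \<in> distributive b"
proof -
  note [simp] = distributiveD(1,2)[OF assms(1)] distributiveD(1,2)[OF assms(2)] assms(3)
  have bx: "b \<sqsubseteq> x" using le_trans[of b h x] by simp
  show ?thesis
  proof (rule distributiveI)
    fix k l assume kl [simp]: "k \<in> carrier L" "l \<in> carrier L" "b \<sqsubseteq> k" "b \<sqsubseteq> l"
    have "(x \<squnion> k) \<sqinter> (x \<squnion> l) \<sqsubseteq> (x \<squnion> (h \<squnion> k)) \<sqinter> (x \<squnion> (h \<squnion> l))" by simp
    also have "\<dots> = x \<squnion> ((h \<squnion> k) \<sqinter> (h \<squnion> l))"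
      using distributiveD(3)[OF assms(2), of "h \<squnion> k" "h \<squnion> l"] by simp
    also have "\<dots> = x \<squnion> (h \<squnion> (k \<sqinter> l))"
      using distributiveD(3)[OF assms(1), of k l] by simp
    also have "\<dots> = x \<squnion> (k \<sqinter> l)"
      by (rule le_antisym) auto
    finally show "(x \<squnion> k) \<sqinter> (x \<squnion> l) \<sqsubseteq> x \<squnion> (k \<sqinter> l)" .
  qed (use bx in auto)
qed

text \<open>Again tested on the factors: on \<open>h\<close> the element
  \<open>x \<sqinter> h'\<close> contributes nothing, and on \<open>h'\<close> it agrees with
  \<open>x\<close>, which is distributive over \<open>b\<close>.\<close>

lemma distributive_meet_complement:
  assumes "splits b h h'" "x \<in> distributive h"
  shows "x \<sqinter> h' \<in> distributive b"
proof -
  have [simp]: "b \<in> carrier L" "h \<in> carrier L" "h' \<in> carrier L" "b \<sqsubseteq> h" "b \<sqsubseteq> h'"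
    using assms(1) unfolding splits_def by blast+
  note [simp] = distributiveD(1,2)[OF assms(2)]
  have bx [simp]: "b \<sqsubseteq> x" using le_trans[of b h x] by simp
  have xb: "x \<in> distributive b" using distributive_lift[OF splits_distributive[OF assms(1)] assms(2)] by simp
  define y where "y = x \<sqinter> h'"
  have [simp]: "y \<in> carrier L" "b \<sqsubseteq> y" "y \<sqsubseteq> h'" "y \<sqsubseteq> x" by (simp_all add: y_def)
  have "y \<in> distributive b"
  proof (rule distributiveI)
    fix k l assume kl [simp]: "k \<in> carrier L" "l \<in> carrier L" "b \<sqsubseteq> k" "b \<sqsubseteq> l"
    define z where "z = (y \<squnion> k) \<sqinter> (y \<squnion> l)"
    have z [simp]: "z \<in> carrier L" "b \<sqsubseteq> z" "z \<sqsubseteq> y \<squnion> k" "z \<sqsubseteq> y \<squnion> l" by (simp_all add: z_def)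
    have "z \<sqinter> h \<sqsubseteq> m" if "m \<in> {k, l}" for m
    proof -
      have "z \<sqinter> h \<sqsubseteq> (y \<squnion> m) \<sqinter> h" using that by auto
      moreover have "(y \<squnion> m) \<sqinter> h \<sqsubseteq> m"
        using that by (intro splits_meet_join'[OF splits_sym[OF assms(1)]]) auto
      moreover have "m \<in> carrier L" using that by auto
      ultimately show ?thesis using le_trans[of "z \<sqinter> h" "(y \<squnion> m) \<sqinter> h" m] by simp
    qed
    then have 1: "z \<sqinter> h \<sqsubseteq> y \<squnion> (k \<sqinter> l)" by simp
    have "y \<squnion> k \<sqsubseteq> x \<squnion> k" "y \<squnion> l \<sqsubseteq> x \<squnion> l" by auto
    then have "z \<sqsubseteq> (x \<squnion> k) \<sqinter> (x \<squnion> l)"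
      using le_trans[of z "y \<squnion> k" "x \<squnion> k"] le_trans[of z "y \<squnion> l" "x \<squnion> l"] by simp
    then have "z \<sqsubseteq> x \<squnion> (k \<sqinter> l)" using distributiveD(3)[OF xb, of k l] by simp
    then have "z \<sqinter> h' \<sqsubseteq> (x \<squnion> (k \<sqinter> l)) \<sqinter> h'" by simp
    also have "\<dots> = y \<squnion> ((k \<sqinter> l) \<sqinter> h')"
      unfolding y_def by (rule splits_meet_join[OF assms(1)]) auto
    also have "\<dots> \<sqsubseteq> y \<squnion> (k \<sqinter> l)" by simp
    finally have 2: "z \<sqinter> h' \<sqsubseteq> y \<squnion> (k \<sqinter> l)" by simp
    show "(y \<squnion> k) \<sqinter> (y \<squnion> l) \<sqsubseteq> y \<squnion> (k \<sqinter> l)"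
      unfolding z_def[symmetric] by (rule splits_leI[OF assms(1)]) (use 1 2 in auto)
  qed auto
  then show ?thesis by (simp add: y_def)
qed

text \<open>Each \<open>x\<close> distributive over \<open>h\<close> yields two elements
  distributive over \<open>b\<close>, namely \<open>x\<close> and \<open>x \<sqinter> h'\<close>.
  The first family lies above \<open>h\<close> and the second does not, and \<open>x\<close> is
  recovered as \<open>h \<squnion> (x \<sqinter> h')\<close>.\<close>

lemma card_distributive_splits:
  assumes "splits b h h'" "h \<noteq> b"
  shows "2 * card (distributive h) \<le> card (distributive b)"
proof -
  have [simp]: "b \<in> carrier L" "h \<in> carrier L" "h' \<in> carrier L" "b \<sqsubseteq> h" "b \<sqsubseteq> h'" and hh: "h \<sqinter> h' = b"
    and eq: "\<And>k. k \<in> carrier L \<Longrightarrow> b \<sqsubseteq> k \<Longrightarrow> k = (k \<sqinter> h) \<squnion> (k \<sqinter> h')"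
    using assms(1) unfolding splits_def by blast+
  let ?f = "\<lambda>x. x \<sqinter> h'"
  have rec: "x = h \<squnion> ?f x" if "x \<in> distributive h" for x
  proof -
    note [simp] = distributiveD(1,2)[OF that]
    have "b \<sqsubseteq> x" using le_trans[of b h x] by simp
    then show ?thesis using eq[of x] by (simp add: meet_absorb')
  qed
  have inj: "inj_on ?f (distributive h)" 
  proof (rule inj_onI)
    fix x y assume "x \<in> distributive h" "y \<in> distributive h" "?f x = ?f y"
    then show "x = y" using rec[of x] rec[of y] by argo
  qed
  have disj: "distributive h \<inter> ?f ` distributive h = {}"
  proof (rule ccontr)
    assume "distributive h \<inter> ?f ` distributive h \<noteq> {}"
    then obtain x where x: "x \<in> distributive h" "x \<sqinter> h' \<in> distributive h" by auto
    then have "h \<sqsubseteq> x \<sqinter> h'" using distributiveD(2) by blast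
    then have "h \<sqsubseteq> h'" using distributiveD(1)[OF x(1)] by simp
    then show False using hh assms(2) by (simp add: meet_absorb)
  qed
  have "distributive h \<union> ?f ` distributive h \<subseteq> distributive b"
    using distributive_lift[OF splits_distributive[OF assms(1)]] distributive_meet_complement[OF assms(1)] by auto
  then have "card (distributive h \<union> ?f ` distributive h) \<le> card (distributive b)"
    by (intro card_mono) auto
  also have "card (distributive h \<union> ?f ` distributive h) = 2 * card (distributive h)"
    using disj inj by (simp add: card_Un_disjoint card_image)
  finally show ?thesis .
qed


subsection \<open>Growth of the number of complements\<close>

text \<open>Three points \<open>u\<close>, \<open>r\<close>, \<open>s\<close> lie on the line
  \<open>e\<close>. A hyperplane \<open>x\<close> through \<open>s\<close> but not through
  \<open>e\<close> serves as a mirror: a coatom through \<open>u\<close> is determined by its trace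
  on \<open>x\<close>, and the same trace together with \<open>r\<close> spans a coatom through
  \<open>r\<close>.\<close>

lemma card_coatoms_le:
  assumes a: "cov a u" "cov a r" "cov a s" and d: "u \<noteq> r" "u \<noteq> s" "r \<noteq> s"
    and l: "u \<squnion> s = e" "r \<squnion> s = e" and comp: "complemented a t"
  shows "card (coatoms u e) \<le> card (coatoms r e)"
proof -
  note [simp] = covD[OF a(1)] covD[OF a(2)] covD[OF a(3)]
  have [simp]: "e \<in> carrier L" "s \<sqsubseteq> e" "u \<sqsubseteq> e" using l by auto
  have [simp]: "r \<sqsubseteq> e" using l(2) join_left[of r s] covD(2)[OF a(2)] covD(2)[OF a(3)] by metis
  have "complemented s t" by (rule complemented_upper[OF comp]) auto
  moreover have "e \<noteq> s" using l(1) atom_not_le[OF a(3,1)] d by auto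
  ultimately obtain x where x: "cov x t" "s \<sqsubseteq> x" "\<not> e \<sqsubseteq> x"
    using complemented_coatomD[of s t e] by auto
  note [simp] = covD[OF x(1)] x(2)
  have ax [simp]: "a \<sqsubseteq> x" using le_trans[of a s x] by simp
  have nu: "\<not> u \<sqsubseteq> x" "\<not> r \<sqsubseteq> x" using x(3) l join_le_iff[of u s x] join_le_iff[of r s x] by auto
  have xu: "x \<squnion> u = t" "x \<squnion> r = t"
    using cov_join_eq[OF x(1), of u] cov_join_eq[OF x(1), of r] nu by auto
  have xr: "x \<sqinter> r = a" using cov_join(2)[OF a(2), of x] nu by simp
  \<comment> \<open>The trace of \<open>c\<close> on \<open>x\<close> is kept and \<open>u\<close>
    is exchanged for \<open>r\<close>; \<open>f\<close> is injective because
    \<open>f c \<sqinter> x = c \<sqinter> x\<close> and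
    \<open>c = u \<squnion> (x \<sqinter> c)\<close>.\<close>
  define f where "f c = (c \<sqinter> x) \<squnion> r" for c
  have f: "f c \<sqinter> x = c \<sqinter> x" "c = u \<squnion> (x \<sqinter> c)" "f c \<in> coatoms r e" if c: "c \<in> coatoms u e" for c
  proof -
    have cc: "cov c t" "u \<sqsubseteq> c" "\<not> e \<sqsubseteq> c" using c by (auto simp: coatoms_def)
    note [simp] = covD[OF cc(1)] cc(2)
    have [simp]: "a \<sqsubseteq> c" using le_trans[of a u c] by simp
    have fc [simp]: "f c \<in> carrier L" "r \<sqsubseteq> f c" "c \<sqinter> x \<sqsubseteq> f c" by (simp_all add: f_def)
    have ns: "\<not> s \<sqsubseteq> c" using cc(3) l(1) join_le_iff[of u s c] by auto
    have nxc: "\<not> x \<sqsubseteq> c" using ns le_trans[of s x c] by auto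
    show 1: "f c \<sqinter> x = c \<sqinter> x"
    proof -
      have "f c \<sqinter> x = (c \<sqinter> x) \<squnion> (r \<sqinter> x)" unfolding f_def using modular[of "c \<sqinter> x" x r] by simp
      also have "\<dots> = c \<sqinter> x" using xr by (simp add: meet_comm[of L r x] del: meet_eq_iff)
      finally show ?thesis .
    qed
    show "c = u \<squnion> (x \<sqinter> c)"
      using modular[of u c x] xu by (simp add: join_comm[of L u x] meet_absorb')
    have "cov (x \<sqinter> c) x" using cov_meet(1)[OF cc(1), of x] nxc by simp
    moreover have nxf: "\<not> x \<sqsubseteq> f c"
    proof
      assume "x \<sqsubseteq> f c"
      then have "x = c \<sqinter> x" using 1 by (simp add: meet_absorb')
      then show False using nxc by simp
    qed
    ultimately have "cov (f c) (f c \<squnion> x)" by (intro cov_join(1)[of "x \<sqinter> c" x]) (simp_all add: meet_comm[of L x c])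
    moreover have "f c \<squnion> x = t"
    proof -
      have "x \<squnion> r \<sqsubseteq> f c \<squnion> x" by (simp del: xu)
      then show ?thesis using xu by (intro top_unique) auto
    qed
    moreover have "\<not> e \<sqsubseteq> f c"
    proof
      assume "e \<sqsubseteq> f c"
      then have "s \<sqsubseteq> f c" using le_trans[of s e "f c"] by simp
      then have "s \<sqsubseteq> f c \<sqinter> x" by simp
      then show False using 1 ns by simp
    qed
    ultimately show "f c \<in> coatoms r e" by (simp add: coatoms_def)
  qed
  have "inj_on f (coatoms u e)"
  proof (rule inj_onI)
    fix c d assume cd: "c \<in> coatoms u e" "d \<in> coatoms u e" "f c = f d"
    then have "c \<sqinter> x = d \<sqinter> x" using f(1) by metis
    then show "c = d" using f(2)[OF cd(1)] f(2)[OF cd(2)] by (metis meet_comm)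
  qed
  then show ?thesis using f(3) by (intro card_inj_on_le[of f]) auto
qed

text \<open>A coatom containing \<open>r\<close> or \<open>s\<close> but not the line
  \<open>e\<close> avoids \<open>a\<^sub>1\<close>. It cannot contain both, as
  \<open>r \<squnion> s = e\<close>, so the two families are disjoint, and
  \<open>card_coatoms_le\<close> makes each at least as large as the family through
  \<open>a\<^sub>1\<close>.\<close>

lemma coatoms_doubling:
  assumes "cov a a\<^sub>1" "cov a r" "cov a s" "r \<noteq> a\<^sub>1" "s \<noteq> a\<^sub>1" "r \<noteq> s" and e: "a\<^sub>1 \<squnion> r = e" "s \<sqsubseteq> e"
    and comp: "complemented a t"
  shows "2 * card (coatoms a\<^sub>1 e) \<le> card (coatoms a a\<^sub>1)"
proof -
  note [simp] = covD[OF assms(1)] covD[OF assms(2)] covD[OF assms(3)]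
  have [simp]: "e \<in> carrier L" "a\<^sub>1 \<sqsubseteq> e" "r \<sqsubseteq> e" using e by auto
  have l: "a\<^sub>1 \<squnion> s = e" using line_eq[of a a\<^sub>1 r s] assms by auto
  have ra: "r \<squnion> a\<^sub>1 = e" using e by (simp add: join_comm)
  then have rs: "r \<squnion> s = e" using line_eq[of a r a\<^sub>1 s] assms by auto
  have sr: "s \<squnion> r = e" using rs by (simp add: join_comm)
  have "card (coatoms a\<^sub>1 e) \<le> card (coatoms r e)"
    by (rule card_coatoms_le[OF assms(1,2,3)]) (use assms l rs in auto)
  moreover have "card (coatoms a\<^sub>1 e) \<le> card (coatoms s e)"
    by (rule card_coatoms_le[OF assms(1,3,2)]) (use assms l sr in auto)
  moreover have "coatoms r e \<inter> coatoms s e = {}"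
  proof -
    have False if c: "cov c t" "r \<sqsubseteq> c" "s \<sqsubseteq> c" "\<not> e \<sqsubseteq> c" for c
      using c rs covD[OF c(1)] join_le_iff[of r s c] by auto
    then show ?thesis by (auto simp: coatoms_def)
  qed
  then have "card (coatoms r e \<union> coatoms s e) = card (coatoms r e) + card (coatoms s e)"
    by (simp add: card_Un_disjoint)
  moreover have "coatoms r e \<union> coatoms s e \<subseteq> coatoms a a\<^sub>1"
  proof -
    have "a \<sqsubseteq> c \<and> \<not> a\<^sub>1 \<sqsubseteq> c" if c: "cov c t" "p \<sqsubseteq> c" "\<not> e \<sqsubseteq> c" and p: "p \<in> {r, s}" for c p
    proof -
      have "a \<sqsubseteq> p" "p \<in> carrier L" "a\<^sub>1 \<squnion> p = e" using p e(1) l by auto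
      then show ?thesis using c covD[OF c(1)] le_trans[of a p c] join_le_iff[of a\<^sub>1 p c] by auto
    qed
    then show ?thesis by (auto simp: coatoms_def)
  qed
  then have "card (coatoms r e \<union> coatoms s e) \<le> card (coatoms a a\<^sub>1)"
    by (intro card_mono) auto
  ultimately show ?thesis by linarith
qed

text \<open>The third-point property passes from atoms over \<open>b\<close> to atoms over
  \<open>a\<close>: choose atoms \<open>p\<close>, \<open>p'\<close> over \<open>b\<close> that
  generate \<open>e\<close>, \<open>e'\<close> modulo \<open>a\<close>, take a third atom
  \<open>r\<close> on their line, and use \<open>a \<squnion> r\<close>.\<close>

lemma third_atom_upper:
  assumes ch: "complemented b h"
    and conn: "\<And>p q. cov b p \<Longrightarrow> cov b q \<Longrightarrow> p \<sqsubseteq> h \<Longrightarrow> q \<sqsubseteq> h \<Longrightarrow> perspective b p q"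
    and "b \<sqsubseteq> a" "cov a e" "cov a e'" "e \<noteq> e'" "e \<sqsubseteq> h" "e' \<sqsubseteq> h"
  shows "\<exists>f. cov a f \<and> f \<noteq> e \<and> f \<noteq> e' \<and> f \<sqsubseteq> e \<squnion> e'"
proof -
  note [simp] = complementedD[OF ch] covD[OF assms(4)] covD[OF assms(5)] assms(3,7,8)
  have be [simp]: "b \<sqsubseteq> e" "b \<sqsubseteq> e'" using le_trans[of b a e] le_trans[of b a e'] by auto
  have *: "\<exists>p. cov b p \<and> p \<sqsubseteq> e \<and> \<not> p \<sqsubseteq> a \<and> a \<squnion> p = e" if "cov a e" "e \<sqsubseteq> h" for e
  proof -
    note [simp] = covD[OF that(1)] that(2)
    have "b \<sqsubseteq> e" using le_trans[of b a e] by simp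
    then have "complemented b e" by (intro complemented_lower[OF ch]) auto
    then obtain p where p: "cov b p" "p \<sqsubseteq> e" "\<not> p \<sqsubseteq> a"
      using complemented_atomD[of b e a] by auto
    then show ?thesis using cov_join_eq[OF that(1), of p] covD[OF p(1)] by auto
  qed
  obtain p where p: "cov b p" "p \<sqsubseteq> e" "\<not> p \<sqsubseteq> a" "a \<squnion> p = e" using *[OF assms(4,7)] by blast
  obtain p' where p': "cov b p'" "p' \<sqsubseteq> e'" "\<not> p' \<sqsubseteq> a" "a \<squnion> p' = e'" using *[OF assms(5,8)] by blast
  note [simp] = covD[OF p(1)] covD[OF p'(1)]
  have npe: "\<not> p' \<sqsubseteq> e" "\<not> p \<sqsubseteq> e'"
  proof -
    show "\<not> p' \<sqsubseteq> e"
    proof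
      assume "p' \<sqsubseteq> e"
      then have "e = e'" using cov_join_eq[OF assms(4), of p'] p' by simp
      then show False using assms(6) by simp
    qed
    show "\<not> p \<sqsubseteq> e'"
    proof
      assume "p \<sqsubseteq> e'"
      then have "e = e'" using cov_join_eq[OF assms(5), of p] p by simp
      then show False using assms(6) by simp
    qed
  qed
  then have pne: "p \<noteq> p'" using p by auto
  have "p \<sqsubseteq> h" "p' \<sqsubseteq> h" using p p' le_trans[of p e h] le_trans[of p' e' h] by auto
  then obtain r where r: "cov b r" "r \<noteq> p" "r \<noteq> p'" "r \<sqsubseteq> p \<squnion> p'"
    using conn[OF p(1) p'(1)] pne by (auto simp: perspective_def)
  note [simp] = covD[OF r(1)]
  have pr: "p \<squnion> r = p \<squnion> p'" "p' \<squnion> r = p \<squnion> p'"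
    using line_eq[OF p(1) p'(1) r(1)] line_eq[OF p'(1) p(1) r(1)] pne r join_comm[of L p p'] by auto
  have nre: "\<not> r \<sqsubseteq> e"
  proof
    assume "r \<sqsubseteq> e"
    then have "p \<squnion> r \<sqsubseteq> e" using p by simp
    then show False using pr npe by simp
  qed
  have nre': "\<not> r \<sqsubseteq> e'"
  proof
    assume "r \<sqsubseteq> e'"
    then have "p' \<squnion> r \<sqsubseteq> e'" using p' by simp
    then show False using pr npe by simp
  qed
  have nra: "\<not> r \<sqsubseteq> a" using nre le_trans[of r a e] by auto
  have "cov a (a \<squnion> r)" using cov_join(1)[OF r(1), of a] nra by simp
  moreover have "a \<squnion> r \<noteq> e" "a \<squnion> r \<noteq> e'" using nre nre' join_right[of a r] by auto
  moreover have "r \<sqsubseteq> e \<squnion> e'"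
    using r(4) p(2) p'(2) le_trans[of r "p \<squnion> p'" "e \<squnion> e'"] by simp
  ultimately show ?thesis by (intro exI[of _ "a \<squnion> r"]) auto
qed

text \<open>At the top of \<open>h\<close> there is at least one complementary coatom, and each step
  down doubles the number: perspectivity supplies the third atom that
  \<open>coatoms_doubling\<close> requires.\<close>

lemma coatoms_exponential:
  assumes ch: "complemented b h" and ct: "complemented b t"
    and conn: "\<And>p q. cov b p \<Longrightarrow> cov b q \<Longrightarrow> p \<sqsubseteq> h \<Longrightarrow> q \<sqsubseteq> h \<Longrightarrow> perspective b p q"
  shows "b \<sqsubseteq> a \<Longrightarrow> cov a a\<^sub>1 \<Longrightarrow> chain n a\<^sub>1 h \<Longrightarrow> 2 ^ n \<le> card (coatoms a a\<^sub>1)"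
proof (induction n arbitrary: a a\<^sub>1)
  case 0
  note [simp] = complementedD[OF ch] covD[OF 0(2)] 0(1)
  have "complemented a t" by (rule complemented_upper[OF ct]) auto
  then obtain c where c: "cov c t" "a \<sqsubseteq> c" "\<not> a\<^sub>1 \<sqsubseteq> c" 
    using complemented_coatomD[of a t a\<^sub>1] covD(4)[OF 0(2)] by auto
  then have "coatoms a a\<^sub>1 \<noteq> {}" by (auto simp: coatoms_def)
  then show ?case by (simp add: Suc_le_eq card_gt_0_iff)
next
  case (Suc n)
  then obtain e where e: "cov a\<^sub>1 e" "chain n e h" by auto
  note [simp] = complementedD[OF ch] covD[OF Suc.prems(2)] Suc.prems(1) covD[OF e(1)] chainD[OF e(2)]
  have [simp]: "b \<sqsubseteq> a\<^sub>1" "a \<sqsubseteq> e" "a\<^sub>1 \<sqsubseteq> h" "a \<sqsubseteq> h"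
    using le_trans[of b a a\<^sub>1] le_trans[of a a\<^sub>1 e] le_trans[of a\<^sub>1 e h] le_trans[of a a\<^sub>1 h] by auto
  have IH: "2 ^ n \<le> card (coatoms a\<^sub>1 e)" by (rule Suc.IH) (use e in auto)
  have cat: "complemented a t" by (rule complemented_upper[OF ct]) auto
  have "complemented a h" by (rule complemented_upper[OF ch]) auto
  then have "complemented a e" by (rule complemented_lower) auto
  then obtain r where r: "cov a r" "r \<sqsubseteq> e" "\<not> r \<sqsubseteq> a\<^sub>1"
    using complemented_atomD[of a e a\<^sub>1] covD(4)[OF e(1)] by auto
  note [simp] = covD[OF r(1)] r(2)
  have re: "a\<^sub>1 \<squnion> r = e" using cov_join_eq[OF e(1), of r] r by simp
  have "r \<noteq> a\<^sub>1" using r(3) by auto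
  moreover have "r \<sqsubseteq> h" using le_trans[of r e h] by simp
  ultimately obtain s where s: "cov a s" "s \<noteq> a\<^sub>1" "s \<noteq> r" "s \<sqsubseteq> a\<^sub>1 \<squnion> r"
    using third_atom_upper[OF ch conn, of a a\<^sub>1 r] Suc.prems(2) r(1) by auto
  have "2 * card (coatoms a\<^sub>1 e) \<le> card (coatoms a a\<^sub>1)"
    by (rule coatoms_doubling[OF Suc.prems(2) r(1) s(1)]) (use s re cat \<open>r \<noteq> a\<^sub>1\<close> in auto)
  then show ?case using IH by simp
qed

text \<open>Going down one atom multiplies the sum by \<open>1 + m\<close> and
  \<open>\<bar>\<mu>\<bar>\<close> by \<open>m\<close>, where \<open>m\<close> is the number of
  coatoms. Since \<open>m\<close> is at least \<open>2 ^ n\<close> at distance \<open>n\<close>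
  below \<open>h\<close>, the ratio grows by at most \<open>1 + 1 / 2 ^ n\<close>.\<close>

lemma abs_moebius_sum_chain:
  assumes ch: "complemented b h" and ct: "complemented b t"
    and conn: "\<And>p q. cov b p \<Longrightarrow> cov b q \<Longrightarrow> p \<sqsubseteq> h \<Longrightarrow> q \<sqsubseteq> h \<Longrightarrow> perspective b p q"
    and Z: "real_of_int (abs_moebius_sum h) \<le> Z * \<bar>real_of_int (\<mu> h t)\<bar>" "0 \<le> Z"
  shows "b \<sqsubseteq> a \<Longrightarrow> chain n a h \<Longrightarrow>
    real_of_int (abs_moebius_sum a) \<le> (\<Prod>i<n. 1 + 1 / 2 ^ i) * Z * \<bar>real_of_int (\<mu> a t)\<bar>"
proof (induction n arbitrary: a)
  case 0
  then show ?case using Z by simp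
next
  case (Suc n)
  then obtain a' where a': "cov a a'" "chain n a' h" by auto
  note [simp] = covD[OF a'(1)] complementedD[OF ch] Suc.prems(1)
  define m where "m = real (card (coatoms a a'))"
  define P where "P = (\<Prod>i<n. 1 + 1 / 2 ^ i :: real)"
  have P: "0 \<le> P" unfolding P_def by (rule prod_nonneg) auto
  have "b \<sqsubseteq> a'" using le_trans[of b a a'] by simp
  then have IH: "real_of_int (abs_moebius_sum a') \<le> P * Z * \<bar>real_of_int (\<mu> a' t)\<bar>"
    unfolding P_def by (rule Suc.IH) (use a' in auto)
  have "2 ^ n \<le> card (coatoms a a')"
    by (rule coatoms_exponential[OF ch ct conn]) (use a' in auto)
  then have m: "2 ^ n \<le> m" unfolding m_def by (metis of_nat_le_iff of_nat_numeral of_nat_power)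
  then have m': "1 + m \<le> (1 + 1 / 2 ^ n) * m" by (simp add: field_simps)
  have "real_of_int (abs_moebius_sum a) = (1 + m) * real_of_int (abs_moebius_sum a')"
    using abs_moebius_sum_atom[OF a'(1)] by (simp add: m_def)
  also have "\<dots> \<le> ((1 + 1 / 2 ^ n) * m) * (P * Z * \<bar>real_of_int (\<mu> a' t)\<bar>)"
    using m' IH m P Z by (intro mult_mono) (auto simp: abs_moebius_sum_def m_def intro: sum_nonneg)
  also have "\<dots> = (\<Prod>i<Suc n. 1 + 1 / 2 ^ i) * Z * (m * \<bar>real_of_int (\<mu> a' t)\<bar>)"
    by (simp add: P_def)
  also have "m * \<bar>real_of_int (\<mu> a' t)\<bar> = \<bar>real_of_int (\<mu> a t)\<bar>"
    using moebius_atom[OF a'(1)] by (simp add: m_def abs_mult)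
  finally show ?case .
qed

lemma prod_le_8: "(\<Prod>i<n. 1 + 1 / 2 ^ i :: real) \<le> 8"
proof -
  \<comment> \<open>The bare bound 8 is not inductive. The slack \<open>1 - x\<close> absorbs the
    next factor, since \<open>(1 - x) * (1 + x / 2) \<le> 1 - x / 2\<close>; with fewer than two
    factors the strengthened bound would be false, hence the shift by 2.\<close>
  have *: "(\<Prod>i<n + 2. 1 + 1 / 2 ^ i :: real) \<le> 8 * (1 - 1 / 2 ^ (n + 1))" for n
  proof (induction n)
    case 0
    show ?case by (simp add: numeral_2_eq_2)
  next
    case (Suc n)
    define x where "x = (1 / 2 ^ (n + 1) :: real)"
    have "(\<Prod>i<Suc n + 2. 1 + 1 / 2 ^ i :: real) = (\<Prod>i<n + 2. 1 + 1 / 2 ^ i) * (1 + x / 2)"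
      by (simp add: x_def)
    also have "\<dots> \<le> 8 * (1 - x) * (1 + x / 2)"
      using Suc by (intro mult_right_mono) (auto simp: x_def)
    also have "\<dots> = 8 * (1 - x / 2) - 4 * (x * x)" by (simp add: algebra_simps)
    also have "\<dots> \<le> 8 * (1 - x / 2)" by simp
    finally show ?case by (simp add: x_def)
  qed
  consider "n = 0" | "n = 1" | k where "n = k + 2" by (metis One_nat_def add_2_eq_Suc' not0_implies_Suc)
  then show ?thesis
  proof cases
    case 3
    have "8 * (1 - 1 / 2 ^ (k + 1)) \<le> (8 :: real)" by simp
    then show ?thesis using *[of k] unfolding 3 by linarith
  qed auto
qed

text \<open>Each perspectivity class of atoms contributes at most the factor 8, and it doubles the number of
  distributive elements.\<close>

lemma abs_moebius_sum_le:
  assumes "complemented b t"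
  shows "real_of_int (abs_moebius_sum b) \<le> real (card (distributive b)) ^ 3 * \<bar>real_of_int (\<mu> b t)\<bar>"
  using assms
proof (induction "card (ivl b t)" arbitrary: b rule: less_induct)
  case less
  note ct = less.prems
  note [simp] = complementedD[OF ct]
  show ?case
  proof (cases "b = t")
    case True
    then show ?thesis
      using card_distributive_pos[of b] by (auto simp: abs_moebius_sum_def ivl_self)
  next
    case False
    then obtain p where p: "cov b p" using ex_atom[of b t] by auto
    define K where "K = {q. perspective b p q}"
    have pK: "p \<in> K" using p by (simp add: K_def perspective_def)
    have Kcov: "cov b q" if "q \<in> K" for q using that by (simp add: K_def perspective_def)
    have Kcl: "r \<in> K" if "q \<in> K" "perspective b q r" for q r
      using that perspective_trans by (auto simp: K_def)
    have Kcl': "r \<in> {q. cov b q} - K" if "q \<in> {q. cov b q} - K" "perspective b q r" for q r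
      using that perspective_sym Kcl unfolding perspective_def by blast
    obtain h where h: "complemented b h" "\<And>q. q \<in> K \<Longrightarrow> q \<sqsubseteq> h" "\<And>q. cov b q \<Longrightarrow> q \<sqsubseteq> h \<Longrightarrow> q \<in> K"
    proof -
      have "\<exists>h. complemented b h \<and> (\<forall>p\<in>K. p \<sqsubseteq> h) \<and> (\<forall>q. cov b q \<longrightarrow> q \<sqsubseteq> h \<longrightarrow> q \<in> K)"
        by (rule join_of_perspective_closed) (simp, fact Kcov, rule Kcl)
      then show ?thesis using that by blast
    qed
    obtain h' where h': "complemented b h'" "\<And>q. q \<in> {q. cov b q} - K \<Longrightarrow> q \<sqsubseteq> h'"
      "\<And>q. cov b q \<Longrightarrow> q \<sqsubseteq> h' \<Longrightarrow> q \<in> {q. cov b q} - K"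
    proof -
      have "\<exists>h. complemented b h \<and> (\<forall>p\<in>{q. cov b q} - K. p \<sqsubseteq> h) \<and>
          (\<forall>q. cov b q \<longrightarrow> q \<sqsubseteq> h \<longrightarrow> q \<in> {q. cov b q} - K)"
        by (rule join_of_perspective_closed) (simp, blast, rule Kcl')
      then show ?thesis using that by blast
    qed
    note [simp] = complementedD[OF h(1)] complementedD[OF h'(1)]
    \<comment> \<open>The atoms below \<open>h\<close> are exactly the class \<open>K\<close>, those
      below \<open>h'\<close> exactly the rest.\<close>
    have sp: "splits b h h'"
    proof (rule splitsI[OF ct])
      show "q \<sqsubseteq> h \<or> q \<sqsubseteq> h'" if "cov b q" for q using h(2)[of q] h'(2)[of q] that by blast
      show "\<not> q \<sqsubseteq> h'" if "cov b q" "q \<sqsubseteq> h" for q using h(3)[of q] h'(3)[of q] that by blast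
    qed auto
    have hb: "h \<noteq> b" using h(2)[OF pK] covD(5)[OF p] by auto
    have conn: "perspective b q r" if "cov b q" "cov b r" "q \<sqsubseteq> h" "r \<sqsubseteq> h" for q r
      using h(3)[of q] h(3)[of r] that perspective_sym perspective_trans unfolding K_def by blast
    have sub: "ivl h t \<subset> ivl b t" using hb by (intro ivl_psubset') auto
    have cht: "complemented h t" by (rule complemented_upper[OF ct]) auto
    have IH: "real_of_int (abs_moebius_sum h) \<le> real (card (distributive h)) ^ 3 * \<bar>real_of_int (\<mu> h t)\<bar>"
      by (rule less.hyps[OF psubset_card_mono[OF finite_ivl sub] cht])
    obtain n where n: "chain n b h" using ex_chain[of b h] by auto
    have "real_of_int (abs_moebius_sum b)
        \<le> (\<Prod>i<n. 1 + 1 / 2 ^ i) * real (card (distributive h)) ^ 3 * \<bar>real_of_int (\<mu> b t)\<bar>"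
      by (rule abs_moebius_sum_chain[OF h(1) ct conn IH]) (use n in auto)
    also have "\<dots> \<le> 8 * real (card (distributive h)) ^ 3 * \<bar>real_of_int (\<mu> b t)\<bar>"
      by (intro mult_right_mono prod_le_8) auto
    \<comment> \<open>Since \<open>8 = 2 ^ 3\<close>, the loss is absorbed by the doubling of the
      number of distributive elements between \<open>h\<close> and \<open>b\<close>.\<close>
    also have "8 * real (card (distributive h)) ^ 3 = (2 * real (card (distributive h))) ^ 3"
      by (simp add: power_mult_distrib)
    also have "\<dots> \<le> real (card (distributive b)) ^ 3"
      using card_distributive_splits[OF sp hb] by (intro power_mono) auto
    finally show ?thesis by (simp add: mult_right_mono)
  qed
qed


subsection \<open>Summation over a layer of the Loewy filtration\<close>

text \<open>When \<open>loewy i b c\<close> holds, these are the \<open>q\<close> for which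
  \<open>c\<close> is the \<open>i\<close>-th Loewy term of the interval from \<open>b\<close> to
  \<open>q\<close>.\<close>

definition loewy_layer :: "nat \<Rightarrow> 'a \<Rightarrow> 'a \<Rightarrow> 'a set" where
  "loewy_layer i b c = {q \<in> ivl c t. \<forall>y. loewy i b y \<longrightarrow> y \<sqsubseteq> q \<longrightarrow> y \<sqsubseteq> c}"

text \<open>By \<open>loewy_lower\<close>, \<open>q \<sqinter> s\<close> is the greatest
  \<open>loewy i b\<close> element below \<open>q\<close>. So the layer is a fibre of meeting with
  \<open>s\<close>, the shape required by Weisner's theorem.\<close>

lemma loewy_layer_eq:
  assumes c: "loewy i b c" and s: "loewy i b s" "\<forall>y. loewy i b y \<longrightarrow> y \<sqsubseteq> s"
  shows "loewy_layer i b c = {q \<in> ivl c t. q \<sqinter> s = c}"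
proof (intro Set.set_eqI iffI)
  note [simp] = loewyD[OF c] loewyD[OF s(1)] s(2)[rule_format, OF c]
  fix q
  {
    assume q: "q \<in> loewy_layer i b c"
    then have [simp]: "q \<in> carrier L" "c \<sqsubseteq> q" by (auto simp: loewy_layer_def ivl_iff)
    have "b \<sqsubseteq> q" using le_trans[of b c q] by simp
    then have "loewy i b (q \<sqinter> s)" by (intro loewy_lower[OF s(1)]) auto
    then have "q \<sqinter> s \<sqsubseteq> c" using q by (auto simp: loewy_layer_def)
    then have "q \<sqinter> s = c" by (intro le_antisym) auto
    then show "q \<in> {q \<in> ivl c t. q \<sqinter> s = c}" by (simp add: ivl_iff)
  next
    assume q: "q \<in> {q \<in> ivl c t. q \<sqinter> s = c}"
    have "y \<sqsubseteq> c" if "loewy i b y" "y \<sqsubseteq> q" for y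
    proof -
      have "y \<sqsubseteq> q \<sqinter> s" using that s(2)[rule_format, OF that(1)] q loewyD[OF that(1)] by (auto simp: ivl_iff)
      then show ?thesis using q by simp
    qed
    then show "q \<in> loewy_layer i b c" using q by (simp add: loewy_layer_def)
  }
qed

text \<open>If the greatest \<open>loewy i b\<close> element \<open>s\<close> is not
  \<open>t\<close>, the layer is a Weisner fibre and sums to 0; if it is \<open>t\<close>, the layer
  is just \<open>c\<close>.\<close>

lemma sum_moebius_loewy_layer:
  assumes c: "loewy i b c"
  shows "(\<Sum>q\<in>loewy_layer i b c. \<mu> q t) = (if loewy i b t then \<mu> c t else 0)"
proof -
  note [simp] = loewyD[OF c]
  obtain s where s: "loewy i b s" "\<forall>y. loewy i b y \<longrightarrow> y \<sqsubseteq> s" using ex_greatest_loewy by (metis loewyD(1)[OF c])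
  note [simp] = loewyD[OF s(1)]
  show ?thesis
  proof (cases "s = t")
    case True
    then have "loewy_layer i b c = {c}"
      unfolding loewy_layer_eq[OF c s] by (auto simp: ivl_iff meet_absorb)
    then show ?thesis using True s by simp
  next
    case False
    then have "\<not> loewy i b t" using s(2)[rule_format, of t] top_unique[of s] by auto
    then show ?thesis
      unfolding loewy_layer_eq[OF c s] using False by (simp add: weisner_meet)
  qed
qed

text \<open>If some \<open>\<mu> q t\<close> in the layer is nonzero, then \<open>q\<close> and the
  greatest \<open>loewy i b\<close> element \<open>s\<close> are both lower ends of complemented
  intervals up to \<open>t\<close>, hence so is their meet \<open>c\<close>, and
  \<open>abs_moebius_sum_le\<close> applies. Otherwise the left side is 0.\<close>

lemma sum_abs_moebius_loewy_layer:
  assumes c: "loewy i b c" and t: "loewy (Suc i) b t"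
  shows "(\<Sum>q\<in>loewy_layer i b c. \<bar>real_of_int (\<mu> q t)\<bar>)
    \<le> real (card (distributive c)) ^ 3 * \<bar>real_of_int (\<mu> c t)\<bar>"
proof -
  note [simp] = loewyD[OF c]
  obtain s where s: "loewy i b s" "\<forall>y. loewy i b y \<longrightarrow> y \<sqsubseteq> s" using ex_greatest_loewy by (metis loewyD(1)[OF c])
  note [simp] = loewyD[OF s(1)]
  obtain y where y: "loewy i b y" "complemented y t" using t by auto
  \<comment> \<open>The bound \<open>Suc i\<close> on \<open>t\<close> enters here: \<open>t\<close>
    is complemented over some \<open>y\<close> of length \<open>i\<close>, and \<open>y\<close> is
    below \<open>s\<close>.\<close>
  have st: "complemented s t" using complemented_upper[OF y(2), of s] s(2)[rule_format, OF y(1)] by simp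
  show ?thesis
  proof (cases "\<exists>q\<in>loewy_layer i b c. \<mu> q t \<noteq> 0")
    case True
    then obtain q where q: "q \<in> carrier L" "q \<sqinter> s = c" "\<mu> q t \<noteq> 0"
      unfolding loewy_layer_eq[OF c s] by (auto simp: ivl_iff)
    have "complemented c t" using complemented_meet[OF complemented_if_moebius st] q by blast
    have "(\<Sum>q\<in>loewy_layer i b c. \<bar>real_of_int (\<mu> q t)\<bar>) \<le> (\<Sum>q\<in>ivl c t. \<bar>real_of_int (\<mu> q t)\<bar>)"
      by (intro sum_mono2) (auto simp: loewy_layer_def)
    also have "\<dots> = real_of_int (abs_moebius_sum c)" by (simp add: abs_moebius_sum_def)
    also have "\<dots> \<le> real (card (distributive c)) ^ 3 * \<bar>real_of_int (\<mu> c t)\<bar>"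
      by (rule abs_moebius_sum_le) fact
    finally show ?thesis .
  qed simp
qed

end

section \<open>Transport along embeddings onto a lower set\<close>

text \<open>The model is an epimorphism from H to K: quotients of K are the quotients of H below K.
  The tops \<open>s\<close> and \<open>t\<close> do not correspond, and nothing is assumed about
  joins and meets.\<close>

locale lower_embedding =
  P: finite_modular_lattice P s + Q: finite_modular_lattice Q t
  for P :: "'a gorder" and s :: 'a and Q :: "'b gorder" and t :: 'b +
  fixes f :: "'a \<Rightarrow> 'b"
  assumes closed [simp]: "x \<in> carrier P \<Longrightarrow> f x \<in> carrier Q"
    and le_iff: "\<lbrakk>x \<in> carrier P; y \<in> carrier P\<rbrakk> \<Longrightarrow> f x \<sqsubseteq>\<^bsub>Q\<^esub> f y \<longleftrightarrow> x \<sqsubseteq>\<^bsub>P\<^esub> y"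
    and lower: "\<lbrakk>y \<in> carrier P; z \<in> carrier Q; z \<sqsubseteq>\<^bsub>Q\<^esub> f y\<rbrakk> \<Longrightarrow> \<exists>x\<in>carrier P. f x = z"
begin

lemma eq_iff: "\<lbrakk>x \<in> carrier P; y \<in> carrier P\<rbrakk> \<Longrightarrow> f x = f y \<longleftrightarrow> x = y"
  using le_iff[of x y] le_iff[of y x] P.le_antisym[of x y] by auto

lemma ivl_image:
  assumes "x \<in> carrier P" "y \<in> carrier P"
  shows "Q.ivl (f x) (f y) = f ` P.ivl x y"
proof (intro Set.set_eqI iffI)
  fix z assume z: "z \<in> Q.ivl (f x) (f y)"
  then obtain u where "u \<in> carrier P" "f u = z" using lower[of y z] assms by (auto simp: Q.ivl_iff)
  then show "z \<in> f ` P.ivl x y" using z assms by (auto simp: Q.ivl_iff P.ivl_iff le_iff)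
qed (use assms in \<open>auto simp: Q.ivl_iff P.ivl_iff le_iff\<close>)

lemma moebius_eq:
  assumes "x \<in> carrier P" "y \<in> carrier P" "x \<sqsubseteq>\<^bsub>P\<^esub> y"
  shows "moebius Q (f x) (f y) = moebius P x y"
proof (rule moebius_interval_iso[symmetric, OF P.finite_poset_axioms Q.finite_poset_axioms])
  have "inj_on f (P.ivl x y)" by (rule inj_onI) (auto simp: P.ivl_iff eq_iff)
  then show "interval_iso P x y Q (f x) (f y) f"
    unfolding interval_iso_def P.ivl_def[symmetric] Q.ivl_def[symmetric]
    using ivl_image[OF assms(1,2)] by (auto simp: bij_betw_def P.ivl_iff le_iff)
qed (use assms in \<open>auto simp: le_iff\<close>)

lemma cov_iff:
  assumes "x \<in> carrier P" "y \<in> carrier P"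
  shows "Q.cov (f x) (f y) \<longleftrightarrow> P.cov x y"
proof -
  have P: "P.cov x y \<longleftrightarrow> x \<sqsubseteq>\<^bsub>P\<^esub> y \<and> x \<noteq> y \<and> (\<forall>z\<in>P.ivl x y. z = x \<or> z = y)"
    using assms by (auto simp: P.cov_def P.ivl_iff)
  have Q: "Q.cov (f x) (f y) \<longleftrightarrow> f x \<sqsubseteq>\<^bsub>Q\<^esub> f y \<and> f x \<noteq> f y \<and> (\<forall>z\<in>Q.ivl (f x) (f y). z = f x \<or> z = f y)"
    using assms by (auto simp: Q.cov_def Q.ivl_iff)
  have "\<And>z. z \<in> P.ivl x y \<Longrightarrow> z \<in> carrier P" by (auto simp: P.ivl_iff)
  then show ?thesis unfolding P Q ivl_image[OF assms] using assms by (auto simp: le_iff eq_iff)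
qed

lemma chain_iff:
  assumes "x \<in> carrier P" "y \<in> carrier P"
  shows "Q.chain n (f x) (f y) \<longleftrightarrow> P.chain n x y"
  using assms(1)
proof (induction n arbitrary: x)
  case 0
  then show ?case using assms(2) by (simp add: eq_iff)
next
  case (Suc n)
  show ?case
  proof
    assume "Q.chain (Suc n) (f x) (f y)"
    then obtain z where z: "Q.cov (f x) z" "Q.chain n z (f y)" by auto
    then obtain u where u: "u \<in> carrier P" "f u = z"
      using lower[OF assms(2)] Q.chainD[OF z(2)] by blast
    then show "P.chain (Suc n) x y" using z Suc cov_iff[of x u] by auto
  next
    assume "P.chain (Suc n) x y"
    then obtain z where z: "P.cov x z" "P.chain n z y" by auto
    then show "Q.chain (Suc n) (f x) (f y)" using Suc cov_iff[of x z] P.covD[OF z(1)] by auto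
  qed
qed

end

context finite_modular_lattice
begin

text \<open>Complements are described by the order of the interval alone, so that
  \<open>complemented\<close> can be transported along maps known only to preserve and reflect the
  order.\<close>

lemma complemented_order_iff:
  "complemented b u \<longleftrightarrow> b \<in> carrier L \<and> u \<in> carrier L \<and> b \<sqsubseteq> u \<and>
    (\<forall>x\<in>ivl b u. \<exists>y\<in>ivl b u. (\<forall>z\<in>ivl b u. z \<sqsubseteq> x \<and> z \<sqsubseteq> y \<longrightarrow> z = b) \<and>
       (\<forall>z\<in>ivl b u. x \<sqsubseteq> z \<and> y \<sqsubseteq> z \<longrightarrow> z = u))"
proof (cases "b \<in> carrier L \<and> u \<in> carrier L \<and> b \<sqsubseteq> u")
  case True
  then have [simp]: "b \<in> carrier L" "u \<in> carrier L" "b \<sqsubseteq> u" by auto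
  have "x \<sqinter> y = b \<longleftrightarrow> (\<forall>z\<in>ivl b u. z \<sqsubseteq> x \<and> z \<sqsubseteq> y \<longrightarrow> z = b)" (is ?m)
    and "x \<squnion> y = u \<longleftrightarrow> (\<forall>z\<in>ivl b u. x \<sqsubseteq> z \<and> y \<sqsubseteq> z \<longrightarrow> z = u)" (is ?j)
    if "x \<in> ivl b u" "y \<in> ivl b u" for x y
  proof -
    have [simp]: "x \<in> carrier L" "y \<in> carrier L" "b \<sqsubseteq> x" "b \<sqsubseteq> y" "x \<sqsubseteq> u" "y \<sqsubseteq> u"
      using that by (auto simp: ivl_iff)
    have m: "x \<sqinter> y \<in> ivl b u" "x \<squnion> y \<in> ivl b u" by (auto simp: ivl_iff)
    show ?m
    proof
      assume eq: "x \<sqinter> y = b"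
      show "\<forall>z\<in>ivl b u. z \<sqsubseteq> x \<and> z \<sqsubseteq> y \<longrightarrow> z = b"
      proof (intro ballI impI)
        fix z assume z: "z \<in> ivl b u" "z \<sqsubseteq> x \<and> z \<sqsubseteq> y"
        then have "z \<sqsubseteq> x \<sqinter> y" by (simp add: ivl_iff)
        then show "z = b" using eq z by (intro le_antisym) (auto simp: ivl_iff)
      qed
    next
      assume "\<forall>z\<in>ivl b u. z \<sqsubseteq> x \<and> z \<sqsubseteq> y \<longrightarrow> z = b"
      then show "x \<sqinter> y = b" using m(1) by (meson meet_left meet_right \<open>x \<in> carrier L\<close> \<open>y \<in> carrier L\<close>)
    qed
    show ?j
    proof
      assume eq: "x \<squnion> y = u"
      show "\<forall>z\<in>ivl b u. x \<sqsubseteq> z \<and> y \<sqsubseteq> z \<longrightarrow> z = u"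
      proof (intro ballI impI)
        fix z assume z: "z \<in> ivl b u" "x \<sqsubseteq> z \<and> y \<sqsubseteq> z"
        then have "x \<squnion> y \<sqsubseteq> z" by (simp add: ivl_iff)
        then show "z = u" using eq z by (intro le_antisym) (auto simp: ivl_iff)
      qed
    next
      assume "\<forall>z\<in>ivl b u. x \<sqsubseteq> z \<and> y \<sqsubseteq> z \<longrightarrow> z = u"
      then show "x \<squnion> y = u" using m(2) by (meson join_left join_right \<open>x \<in> carrier L\<close> \<open>y \<in> carrier L\<close>)
    qed
  qed
  then show ?thesis unfolding complemented_def using True by (simp cong: bex_cong ball_cong)
qed (auto simp: complemented_def)

end

context lower_embedding
begin

lemma complemented_iff:
  assumes "x \<in> carrier P" "y \<in> carrier P"
  shows "Q.complemented (f x) (f y) \<longleftrightarrow> P.complemented x y"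
proof -
  have c: "\<And>z. z \<in> P.ivl x y \<Longrightarrow> z \<in> carrier P" by (auto simp: P.ivl_iff)
  show ?thesis
    unfolding P.complemented_order_iff Q.complemented_order_iff ivl_image[OF assms]
    using assms c by (simp add: le_iff eq_iff cong: bex_cong ball_cong)
qed

lemma loewy_iff:
  assumes "x \<in> carrier P" "y \<in> carrier P"
  shows "Q.loewy i (f x) (f y) \<longleftrightarrow> P.loewy i x y"
  using assms(2)
proof (induction i arbitrary: y)
  case 0
  then show ?case using assms(1) by (auto simp: eq_iff)
next
  case (Suc i)
  show ?case
  proof
    assume "Q.loewy (Suc i) (f x) (f y)"
    then obtain z where z: "Q.loewy i (f x) z" "Q.complemented z (f y)" by auto
    then obtain u where u: "u \<in> carrier P" "f u = z"
      using lower[OF Suc.prems] Q.complementedD[OF z(2)] by blast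
    then show "P.loewy (Suc i) x y" using z Suc complemented_iff[of u y] by auto
  next
    assume "P.loewy (Suc i) x y"
    then obtain z where z: "P.loewy i x z" "P.complemented z y" by auto
    then show "Q.loewy (Suc i) (f x) (f y)" using Suc complemented_iff[of z y] P.complementedD[OF z(2)] by auto
  qed
qed

end


section \<open>Quotients in a category\<close>

context small_category
begin

abbreviation comp (infixl \<open>\<cdot>\<close> 70) where "g \<cdot> f \<equiv> Comp C g f"
abbreviation qposet where "qposet \<equiv> quotient_poset C"
abbreviation cls where "cls \<equiv> quotient_class C"
abbreviation idt where "idt \<equiv> Ident C"

lemma HomD:
  assumes "f \<in> Hom C X Y"
  shows "Dom C f = X" "Cod C f = Y" "X \<in> Obj C" "Y \<in> Obj C"
  using assms Dom_in_Obj Cod_in_Obj unfolding Hom_def by auto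

lemma Epi_Hom: "f \<in> Epi C X Y \<Longrightarrow> f \<in> Hom C X Y"
  by (simp add: Epi_def)

lemma Iso_Hom: "f \<in> Iso C X Y \<Longrightarrow> f \<in> Hom C X Y"
  by (simp add: Iso_def)

lemma EpiD:
  assumes "f \<in> Epi C X Y"
  shows "Dom C f = X" "Cod C f = Y" "X \<in> Obj C" "Y \<in> Obj C"
  using HomD[OF Epi_Hom[OF assms]] .

lemma Epi_cancel:
  assumes "f \<in> Epi C X Y" "g \<in> Hom C Y Z" "h \<in> Hom C Y Z" "g \<cdot> f = h \<cdot> f"
  shows "g = h"
  using assms HomD(4)[OF assms(2)] unfolding Epi_def by blast

lemma EpiI:
  assumes "f \<in> Hom C X Y"
    and "\<And>Z g h. g \<in> Hom C Y Z \<Longrightarrow> h \<in> Hom C Y Z \<Longrightarrow> g \<cdot> f = h \<cdot> f \<Longrightarrow> g = h"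
  shows "f \<in> Epi C X Y"
  using assms unfolding Epi_def by blast

lemma Epi_comp:
  assumes "f \<in> Epi C X Y" "g \<in> Epi C Y Z"
  shows "g \<cdot> f \<in> Epi C X Z"
proof (rule EpiI)
  note h = Epi_Hom[OF assms(1)] Epi_Hom[OF assms(2)]
  show "g \<cdot> f \<in> Hom C X Z" using Comp_in_Hom h by blast
  fix W u v assume uv: "u \<in> Hom C Z W" "v \<in> Hom C Z W" "u \<cdot> (g \<cdot> f) = v \<cdot> (g \<cdot> f)"
  have "(u \<cdot> g) \<cdot> f = (v \<cdot> g) \<cdot> f" using uv(3) Comp_assoc[OF h uv(1)] Comp_assoc[OF h uv(2)] by simp
  then have "u \<cdot> g = v \<cdot> g"
    using Epi_cancel[OF assms(1) Comp_in_Hom[OF h(2) uv(1)] Comp_in_Hom[OF h(2) uv(2)]] by blast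
  then show "u = v" using Epi_cancel[OF assms(2)] uv by blast
qed

lemma Epi_of_comp:
  assumes "f \<in> Hom C X Y" "g \<in> Hom C Y Z" "g \<cdot> f \<in> Epi C X Z"
  shows "g \<in> Epi C Y Z"
proof (rule EpiI[OF assms(2)])
  fix W u v assume uv: "u \<in> Hom C Z W" "v \<in> Hom C Z W" "u \<cdot> g = v \<cdot> g"
  have "u \<cdot> (g \<cdot> f) = v \<cdot> (g \<cdot> f)" using uv(3) Comp_assoc[OF assms(1,2) uv(1)] Comp_assoc[OF assms(1,2) uv(2)] by simp
  then show "u = v" using Epi_cancel[OF assms(3)] uv by blast
qed

lemma Iso_inverse:
  assumes "f \<in> Iso C X Y"
  obtains g where "g \<in> Iso C Y X" "g \<cdot> f = idt X" "f \<cdot> g = idt Y"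
  using assms unfolding Iso_def by blast

lemma Iso_Epi:
  assumes "f \<in> Iso C X Y"
  shows "f \<in> Epi C X Y"
proof -
  obtain g where g: "g \<in> Iso C Y X" "f \<cdot> g = idt Y" using Iso_inverse[OF assms] by blast
  show ?thesis
  proof (rule EpiI[OF Iso_Hom[OF assms]])
    fix W u v assume uv: "u \<in> Hom C Y W" "v \<in> Hom C Y W" "u \<cdot> f = v \<cdot> f"
    have "u = u \<cdot> (f \<cdot> g)" using g uv by (simp add: Comp_Ident)
    also have "\<dots> = v \<cdot> (f \<cdot> g)" 
      using uv(3) Comp_assoc[OF Iso_Hom[OF g(1)] Iso_Hom[OF assms] uv(1)]
        Comp_assoc[OF Iso_Hom[OF g(1)] Iso_Hom[OF assms] uv(2)] by simp
    also have "\<dots> = v" using g uv by (simp add: Comp_Ident)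
    finally show "u = v" .
  qed
qed

lemma Ident_Iso: "X \<in> Obj C \<Longrightarrow> idt X \<in> Iso C X X"
  unfolding Iso_def using Ident_in_Hom Comp_Ident by blast

lemma Ident_Epi: "X \<in> Obj C \<Longrightarrow> idt X \<in> Epi C X X"
  using Ident_Iso Iso_Epi by blast

lemma Iso_comp:
  assumes "f \<in> Iso C X Y" "g \<in> Iso C Y Z"
  shows "g \<cdot> f \<in> Iso C X Z"
proof -
  obtain f' where f': "f' \<in> Iso C Y X" "f' \<cdot> f = idt X" "f \<cdot> f' = idt Y" using Iso_inverse[OF assms(1)] by blast
  obtain g' where g': "g' \<in> Iso C Z Y" "g' \<cdot> g = idt Y" "g \<cdot> g' = idt Z" using Iso_inverse[OF assms(2)] by blast
  note h = Iso_Hom[OF assms(1)] Iso_Hom[OF assms(2)] Iso_Hom[OF f'(1)] Iso_Hom[OF g'(1)]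
  have gf: "g \<cdot> f \<in> Hom C X Z" and fg: "f' \<cdot> g' \<in> Hom C Z X" using Comp_in_Hom h by blast+
  have "(f' \<cdot> g') \<cdot> (g \<cdot> f) = ((f' \<cdot> g') \<cdot> g) \<cdot> f" using Comp_assoc[OF h(1) h(2) fg] by simp
  also have "(f' \<cdot> g') \<cdot> g = f' \<cdot> (g' \<cdot> g)" using Comp_assoc[OF h(2) h(4) h(3)] by simp
  finally have 1: "(f' \<cdot> g') \<cdot> (g \<cdot> f) = idt X" using f' g' h by (simp add: Comp_Ident)
  have "(g \<cdot> f) \<cdot> (f' \<cdot> g') = ((g \<cdot> f) \<cdot> f') \<cdot> g'" using Comp_assoc[OF h(4) h(3) gf] by simp
  also have "(g \<cdot> f) \<cdot> f' = g \<cdot> (f \<cdot> f')" using Comp_assoc[OF h(3) h(1) h(2)] by simp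
  finally have 2: "(g \<cdot> f) \<cdot> (f' \<cdot> g') = idt Z" using f' g' h by (simp add: Comp_Ident)
  show ?thesis unfolding Iso_def using gf fg 1 2 by blast
qed

lemma equiv_quotient_iso: "equiv (quotients C G) (quotient_iso C G)"
proof (rule equivI)
  show "quotient_iso C G \<subseteq> quotients C G \<times> quotients C G" by (auto simp: quotient_iso_def)
  show "refl_on (quotients C G) (quotient_iso C G)"
  proof (rule refl_onI)
    fix x assume x: "x \<in> quotients C G"
    obtain F \<pi> where [simp]: "x = (F, \<pi>)" by (cases x)
    have "F \<in> Obj C" "\<pi> \<in> Epi C G F" using x by (auto simp: quotients_def)
    then have "idt F \<in> Iso C F F" "\<pi> = idt F \<cdot> \<pi>"
      using Ident_Iso Ident_Comp[OF Epi_Hom, of \<pi> G F] by auto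
    then show "(x, x) \<in> quotient_iso C G" using x unfolding quotient_iso_def by auto
  qed
  show "sym (quotient_iso C G)"
  proof (rule symI)
    fix x y assume "(x, y) \<in> quotient_iso C G"
    then obtain F \<pi> F' \<pi>' \<rho> where *: "x = (F, \<pi>)" "y = (F', \<pi>')" "x \<in> quotients C G" "y \<in> quotients C G"
      "\<rho> \<in> Iso C F F'" "\<pi>' = \<rho> \<cdot> \<pi>" by (auto simp: quotient_iso_def)
    obtain \<sigma> where \<sigma>: "\<sigma> \<in> Iso C F' F" "\<sigma> \<cdot> \<rho> = idt F" using Iso_inverse[OF *(5)] by blast
    have "\<pi> \<in> Hom C G F" using * Epi_Hom by (auto simp: quotients_def)
    then have "\<sigma> \<cdot> \<pi>' = \<pi>" using * \<sigma> Comp_assoc[of \<pi> G F \<rho> F' \<sigma> F] Iso_Hom Ident_Comp by simp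
    then have "\<exists>\<rho>\<in>Iso C F' F. \<pi> = \<rho> \<cdot> \<pi>'" using \<sigma> by (intro bexI[of _ \<sigma>]) simp_all
    then show "(y, x) \<in> quotient_iso C G" using *(3,4) unfolding quotient_iso_def *(1,2) by blast
  qed
  show "trans (quotient_iso C G)"
  proof (rule transI)
    fix x y z assume "(x, y) \<in> quotient_iso C G" "(y, z) \<in> quotient_iso C G"
    then obtain F \<pi> F' \<pi>' F'' \<pi>'' \<rho> \<rho>' where *: "x = (F, \<pi>)" "y = (F', \<pi>')" "z = (F'', \<pi>'')"
      "x \<in> quotients C G" "y \<in> quotients C G" "z \<in> quotients C G"
      "\<rho> \<in> Iso C F F'" "\<pi>' = \<rho> \<cdot> \<pi>" "\<rho>' \<in> Iso C F' F''" "\<pi>'' = \<rho>' \<cdot> \<pi>'" by (auto simp: quotient_iso_def)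
    have "\<pi> \<in> Hom C G F" using * Epi_Hom by (auto simp: quotients_def)
    then have "\<pi>'' = (\<rho>' \<cdot> \<rho>) \<cdot> \<pi>" using * Comp_assoc[of \<pi> G F \<rho> F' \<rho>' F''] Iso_Hom by simp
    moreover have "\<rho>' \<cdot> \<rho> \<in> Iso C F F''" using Iso_comp * by blast
    ultimately show "(x, z) \<in> quotient_iso C G" using * unfolding quotient_iso_def by auto
  qed
qed

lemma quotient_mem: "(F, \<pi>) \<in> quotients C G \<longleftrightarrow> \<pi> \<in> Epi C G F"
  using EpiD(4) by (auto simp: quotients_def)

lemma cls_carrier: "\<pi> \<in> Epi C G F \<Longrightarrow> cls \<pi> \<in> carrier (qposet G)"
  using EpiD[of \<pi> G F] by (auto simp: quotient_poset_def quotient_class_def quotient_mem intro!: quotientI)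

lemma carrier_cls:
  assumes "q \<in> carrier (qposet G)"
  obtains F \<pi> where "\<pi> \<in> Epi C G F" "q = cls \<pi>"
proof -
  from assms obtain x where x: "x \<in> quotients C G" "q = quotient_iso C G `` {x}"
    by (auto simp: quotient_poset_def elim: quotientE)
  obtain F \<pi> where [simp]: "x = (F, \<pi>)" by (cases x)
  have "\<pi> \<in> Epi C G F" using x by (simp add: quotient_mem)
  then show ?thesis using that[of \<pi> F] x EpiD by (simp add: quotient_class_def)
qed

lemma mem_cls: 
  assumes "\<pi> \<in> Epi C G F"
  shows "(F', \<pi>') \<in> cls \<pi> \<longleftrightarrow> (\<exists>\<rho>\<in>Iso C F F'. \<pi>' = \<rho> \<cdot> \<pi>)"
  using assms EpiD[OF assms] Epi_comp[OF assms] Iso_Epi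
  by (auto simp: quotient_class_def quotient_iso_def quotient_mem)

lemma cls_eq_iff:
  assumes "\<pi> \<in> Epi C G F" "\<pi>' \<in> Epi C G F'"
  shows "cls \<pi> = cls \<pi>' \<longleftrightarrow> (\<exists>\<rho>\<in>Iso C F F'. \<pi>' = \<rho> \<cdot> \<pi>)"
proof -
  have "cls \<pi> = cls \<pi>' \<longleftrightarrow> ((F, \<pi>), (F', \<pi>')) \<in> quotient_iso C G"
    unfolding quotient_class_def using assms EpiD eq_equiv_class_iff[OF equiv_quotient_iso, of "(F, \<pi>)" G "(F', \<pi>')"]
    by (simp add: quotient_mem)
  also have "\<dots> \<longleftrightarrow> (\<exists>\<rho>\<in>Iso C F F'. \<pi>' = \<rho> \<cdot> \<pi>)"
    using assms by (auto simp: quotient_iso_def quotient_mem)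
  finally show ?thesis .
qed

text \<open>A morphism under \<open>G\<close> between quotients is itself epi by
  \<open>Epi_of_comp\<close>, and a change of representatives is corrected by composing with
  isomorphisms.\<close>

lemma cls_le_iff:
  assumes "\<pi> \<in> Epi C G F" "\<eta> \<in> Epi C G H"
  shows "cls \<pi> \<sqsubseteq>\<^bsub>qposet G\<^esub> cls \<eta> \<longleftrightarrow> (\<exists>h\<in>Epi C H F. \<pi> = h \<cdot> \<eta>)"
proof
  assume "cls \<pi> \<sqsubseteq>\<^bsub>qposet G\<^esub> cls \<eta>"
  then obtain F' \<pi>' H' \<eta>' h where 1: "(F', \<pi>') \<in> cls \<pi>" "(H', \<eta>') \<in> cls \<eta>" "h \<in> Hom C H' F'" "\<pi>' = h \<cdot> \<eta>'"
    by (auto simp: quotient_poset_def)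
  obtain \<rho> where \<rho>: "\<rho> \<in> Iso C F F'" "\<pi>' = \<rho> \<cdot> \<pi>" using 1 mem_cls[OF assms(1)] by blast
  obtain \<sigma> where \<sigma>: "\<sigma> \<in> Iso C H H'" "\<eta>' = \<sigma> \<cdot> \<eta>" using 1 mem_cls[OF assms(2)] by blast
  obtain \<rho>' where \<rho>': "\<rho>' \<in> Iso C F' F" "\<rho>' \<cdot> \<rho> = idt F" using Iso_inverse[OF \<rho>(1)] by blast
  note hm = Epi_Hom[OF assms(1)] Epi_Hom[OF assms(2)] Iso_Hom[OF \<rho>(1)] Iso_Hom[OF \<sigma>(1)] Iso_Hom[OF \<rho>'(1)] 1(3)
  have h\<sigma>: "h \<cdot> \<sigma> \<in> Hom C H F'" using Comp_in_Hom[OF hm(4,6)] .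
  have k: "\<rho>' \<cdot> (h \<cdot> \<sigma>) \<in> Hom C H F" using Comp_in_Hom[OF h\<sigma> hm(5)] .
  have "\<pi> = (\<rho>' \<cdot> \<rho>) \<cdot> \<pi>" using \<rho>' hm(1) by (simp add: Ident_Comp)
  also have "\<dots> = \<rho>' \<cdot> (h \<cdot> (\<sigma> \<cdot> \<eta>))" using Comp_assoc[OF hm(1,3,5)] \<rho> \<sigma> 1 by simp
  also have "\<dots> = \<rho>' \<cdot> ((h \<cdot> \<sigma>) \<cdot> \<eta>)" using Comp_assoc[OF hm(2,4,6)] by simp
  also have "\<dots> = (\<rho>' \<cdot> (h \<cdot> \<sigma>)) \<cdot> \<eta>" using Comp_assoc[OF hm(2) h\<sigma> hm(5)] by simp
  finally have eq: "\<pi> = (\<rho>' \<cdot> (h \<cdot> \<sigma>)) \<cdot> \<eta>" .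
  then have "\<rho>' \<cdot> (h \<cdot> \<sigma>) \<in> Epi C H F" using Epi_of_comp[OF hm(2) k] assms by simp
  then show "\<exists>h\<in>Epi C H F. \<pi> = h \<cdot> \<eta>" using eq by blast
next
  assume "\<exists>h\<in>Epi C H F. \<pi> = h \<cdot> \<eta>"
  then have "\<exists>h\<in>Hom C H F. \<pi> = h \<cdot> \<eta>" using Epi_Hom by blast
  moreover have "(F, \<pi>) \<in> cls \<pi>" "(H, \<eta>) \<in> cls \<eta>"
    using mem_cls[OF assms(1)] mem_cls[OF assms(2)] Ident_Iso Ident_Comp Epi_Hom assms EpiD(4) by metis+
  ultimately have "\<exists>a\<in>cls \<pi>. \<exists>b\<in>cls \<eta>. \<exists>h\<in>Hom C (fst b) (fst a). snd a = h \<cdot> snd b"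
    by (intro bexI[of _ "(F, \<pi>)"] bexI[of _ "(H, \<eta>)"]) simp_all
  then show "cls \<pi> \<sqsubseteq>\<^bsub>qposet G\<^esub> cls \<eta>" by (simp add: quotient_poset_def split_beta)
qed

lemma cls_Ident_eq_iff:
  assumes "\<pi> \<in> Epi C G F"
  shows "cls \<pi> = cls (idt G) \<longleftrightarrow> \<pi> \<in> Iso C G F"
proof -
  have G: "G \<in> Obj C" using assms EpiD by blast
  have "cls \<pi> = cls (idt G) \<longleftrightarrow> cls (idt G) = cls \<pi>" by auto
  also have "\<dots> \<longleftrightarrow> (\<exists>\<rho>\<in>Iso C G F. \<pi> = \<rho> \<cdot> idt G)" by (rule cls_eq_iff[OF Ident_Epi[OF G] assms])
  also have "\<dots> \<longleftrightarrow> (\<exists>\<rho>\<in>Iso C G F. \<pi> = \<rho>)"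
    by (rule bex_cong[OF refl]) (simp add: Comp_Ident[OF Iso_Hom])
  finally show ?thesis by simp
qed

definition along :: "'m \<Rightarrow> ('o \<times> 'm) set \<Rightarrow> ('o \<times> 'm) set" where
  "along \<eta> q = (\<lambda>(F, \<sigma>). (F, \<sigma> \<cdot> \<eta>)) ` q"

text \<open>Precomposition with \<open>\<eta>\<close> commutes with postcomposition by the
  isomorphisms that generate a class, so a whole class goes to a whole class.\<close>

lemma along_cls:
  assumes "\<eta> \<in> Epi C H K" "\<pi> \<in> Epi C K F"
  shows "along \<eta> (cls \<pi>) = cls (\<pi> \<cdot> \<eta>)"
proof (intro Set.set_eqI)
  fix x :: "'o \<times> 'm"
  obtain F' \<sigma> where [simp]: "x = (F', \<sigma>)" by (cases x)
  have assoc: "\<rho> \<in> Iso C F F' \<Longrightarrow> (\<rho> \<cdot> \<pi>) \<cdot> \<eta> = \<rho> \<cdot> (\<pi> \<cdot> \<eta>)" for \<rho>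
    using Comp_assoc[OF Epi_Hom[OF assms(1)] Epi_Hom[OF assms(2)] Iso_Hom, of \<rho> F'] by simp
  have "x \<in> along \<eta> (cls \<pi>) \<longleftrightarrow> (\<exists>\<sigma>'. (F', \<sigma>') \<in> cls \<pi> \<and> \<sigma> = \<sigma>' \<cdot> \<eta>)"
    by (auto simp: along_def)
  also have "\<dots> \<longleftrightarrow> (\<exists>\<rho>\<in>Iso C F F'. \<sigma> = (\<rho> \<cdot> \<pi>) \<cdot> \<eta>)" by (auto simp: mem_cls[OF assms(2)])
  also have "\<dots> \<longleftrightarrow> (\<exists>\<rho>\<in>Iso C F F'. \<sigma> = \<rho> \<cdot> (\<pi> \<cdot> \<eta>))" using assoc by auto
  also have "\<dots> \<longleftrightarrow> x \<in> cls (\<pi> \<cdot> \<eta>)" using mem_cls[OF Epi_comp[OF assms]] by simp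
  finally show "x \<in> along \<eta> (cls \<pi>) \<longleftrightarrow> x \<in> cls (\<pi> \<cdot> \<eta>)" .
qed

lemma equiv_iso_rel: "equiv (Obj C) (iso_rel C)"
proof (rule equivI)
  show "iso_rel C \<subseteq> Obj C \<times> Obj C" by (auto simp: iso_rel_def)
  show "refl_on (Obj C) (iso_rel C)"
    using Ident_Iso by (fastforce simp: iso_rel_def intro: refl_onI)
  show "sym (iso_rel C)"
    by (rule symI) (auto simp: iso_rel_def elim: Iso_inverse)
  show "trans (iso_rel C)"
    by (rule transI) (auto simp: iso_rel_def dest: Iso_comp)
qed

lemma iso_class_eq_iff:
  "\<lbrakk>X \<in> Obj C; Y \<in> Obj C\<rbrakk> \<Longrightarrow> iso_class C X = iso_class C Y \<longleftrightarrow> Iso C X Y \<noteq> {}"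
  unfolding iso_class_def by (subst eq_equiv_class_iff[OF equiv_iso_rel]) (auto simp: iso_rel_def)

lemma mem_iso_class: "Y \<in> iso_class C X \<longleftrightarrow> X \<in> Obj C \<and> Y \<in> Obj C \<and> Iso C X Y \<noteq> {}"
  by (auto simp: iso_class_def iso_rel_def)

lemma iso_class_in: "X \<in> Obj C \<Longrightarrow> iso_class C X \<in> iso_classes C"
  by (simp add: iso_class_def iso_classes_def quotientI)

lemma rep_iso_class:
  assumes "c \<in> iso_classes C"
  shows "rep c \<in> c" "rep c \<in> Obj C" "iso_class C (rep c) = c"
proof -
  obtain X where X: "X \<in> Obj C" "c = iso_class C X"
    using assms by (auto simp: iso_classes_def iso_class_def elim: quotientE)
  then have "X \<in> c" using mem_iso_class Ident_Iso by blast
  then show 1: "rep c \<in> c" unfolding rep_def by (rule someI)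
  then show 2: "rep c \<in> Obj C" using X mem_iso_class by blast
  show "iso_class C (rep c) = c" using 1 2 X mem_iso_class iso_class_eq_iff by metis
qed

lemma Iso_rep: "X \<in> Obj C \<Longrightarrow> \<exists>\<rho>. \<rho> \<in> Iso C X (rep (iso_class C X))"
  using rep_iso_class[OF iso_class_in, of X] mem_iso_class by blast

end

section \<open>Quotient posets of a diamond category as finite modular lattices\<close>

context diamond_category
begin

lemma finite_modular_lattice_qposet:
  assumes "G \<in> Obj C"
  shows "finite_modular_lattice (qposet G) (cls (idt G))"
proof -
  have lat: "lattice (qposet G)" and
    modular: "\<And>a b x. a \<in> carrier (qposet G) \<Longrightarrow> b \<in> carrier (qposet G) \<Longrightarrow> x \<in> carrier (qposet G) \<Longrightarrow>
      a \<sqsubseteq>\<^bsub>qposet G\<^esub> b \<Longrightarrow> a \<squnion>\<^bsub>qposet G\<^esub> (x \<sqinter>\<^bsub>qposet G\<^esub> b) = (a \<squnion>\<^bsub>qposet G\<^esub> x) \<sqinter>\<^bsub>qposet G\<^esub> b"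
    using modular_quotients[OF assms] unfolding modular_lattice_def by blast+
  interpret lattice "qposet G" by (rule lat)
  show ?thesis
  proof unfold_locales
    show "finite (carrier (qposet G))" by (rule finite_quotients[OF assms])
    show "cls (idt G) \<in> carrier (qposet G)" by (rule cls_carrier[OF Ident_Epi[OF assms]])
    fix x assume "x \<in> carrier (qposet G)"
    then obtain F \<pi> where \<pi>: "\<pi> \<in> Epi C G F" "x = cls \<pi>" by (rule carrier_cls)
    have "\<exists>h\<in>Epi C G F. \<pi> = h \<cdot> idt G"
      using \<pi>(1) Comp_Ident[OF Epi_Hom[OF \<pi>(1)]] by (intro bexI[of _ \<pi>]) simp_all
    then show "x \<sqsubseteq>\<^bsub>qposet G\<^esub> cls (idt G)"
      using cls_le_iff[OF \<pi>(1) Ident_Epi[OF assms]] \<pi>(2) by simp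
  qed (rule modular)
qed

text \<open>Cancelling the epimorphism \<open>\<eta>\<close> shows that the order is reflected; a
  quotient of \<open>H\<close> below one that factors through \<open>\<eta>\<close> factors through
  \<open>\<eta>\<close> as well.\<close>

lemma lower_embedding_along:
  assumes "\<eta> \<in> Epi C H K"
  shows "lower_embedding (qposet K) (cls (idt K)) (qposet H) (cls (idt H)) (along \<eta>)"
proof -
  have obj: "H \<in> Obj C" "K \<in> Obj C" using assms EpiD by blast+
  interpret P: finite_modular_lattice "qposet K" "cls (idt K)" by (rule finite_modular_lattice_qposet[OF obj(2)])
  interpret Q: finite_modular_lattice "qposet H" "cls (idt H)" by (rule finite_modular_lattice_qposet[OF obj(1)])
  show ?thesis
  proof unfold_locales
    fix x assume "x \<in> carrier (qposet K)"
    then obtain F \<pi> where \<pi>: "\<pi> \<in> Epi C K F" "x = cls \<pi>" by (rule carrier_cls)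
    then show "along \<eta> x \<in> carrier (qposet H)"
      using along_cls[OF assms \<pi>(1)] cls_carrier[OF Epi_comp[OF assms \<pi>(1)]] by simp
    fix y assume "y \<in> carrier (qposet K)"
    then obtain F' \<pi>' where \<pi>': "\<pi>' \<in> Epi C K F'" "y = cls \<pi>'" by (rule carrier_cls)
    have "\<pi> \<cdot> \<eta> = h \<cdot> (\<pi>' \<cdot> \<eta>) \<longleftrightarrow> \<pi> = h \<cdot> \<pi>'" if h: "h \<in> Epi C F' F" for h
    proof -
      have "h \<cdot> (\<pi>' \<cdot> \<eta>) = (h \<cdot> \<pi>') \<cdot> \<eta>"
        using Comp_assoc[OF Epi_Hom[OF assms] Epi_Hom[OF \<pi>'(1)] Epi_Hom[OF h]] .
      then show ?thesis
        using Epi_cancel[OF assms Epi_Hom[OF \<pi>(1)] Comp_in_Hom[OF Epi_Hom[OF \<pi>'(1)] Epi_Hom[OF h]]] by auto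
    qed
    then show "along \<eta> x \<sqsubseteq>\<^bsub>qposet H\<^esub> along \<eta> y \<longleftrightarrow> x \<sqsubseteq>\<^bsub>qposet K\<^esub> y"
      using \<pi>(2) \<pi>'(2) along_cls[OF assms \<pi>(1)] along_cls[OF assms \<pi>'(1)] cls_le_iff[OF \<pi>(1) \<pi>'(1)]
        cls_le_iff[OF Epi_comp[OF assms \<pi>(1)] Epi_comp[OF assms \<pi>'(1)]] by auto
  next
    fix y z assume "y \<in> carrier (qposet K)" "z \<in> carrier (qposet H)" and le: "z \<sqsubseteq>\<^bsub>qposet H\<^esub> along \<eta> y"
    obtain F \<pi> where \<pi>: "\<pi> \<in> Epi C K F" "y = cls \<pi>" using \<open>y \<in> _\<close> by (rule carrier_cls)
    obtain F' \<psi> where \<psi>: "\<psi> \<in> Epi C H F'" "z = cls \<psi>" using \<open>z \<in> _\<close> by (rule carrier_cls)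
    obtain h where h: "h \<in> Epi C F F'" "\<psi> = h \<cdot> (\<pi> \<cdot> \<eta>)"
      using le \<pi> \<psi> along_cls[OF assms \<pi>(1)] cls_le_iff[OF \<psi>(1) Epi_comp[OF assms \<pi>(1)]] by auto
    have "\<psi> = (h \<cdot> \<pi>) \<cdot> \<eta>"
      using h Comp_assoc[OF Epi_Hom[OF assms] Epi_Hom[OF \<pi>(1)] Epi_Hom[OF h(1)]] by simp
    then have "along \<eta> (cls (h \<cdot> \<pi>)) = z"
      using \<psi> along_cls[OF assms Epi_comp[OF \<pi>(1) h(1)]] by simp
    then show "\<exists>x\<in>carrier (qposet K). along \<eta> x = z"
      using cls_carrier[OF Epi_comp[OF \<pi>(1) h(1)]] by blast
  qed
qed

lemma along_Ident: "\<eta> \<in> Epi C H K \<Longrightarrow> along \<eta> (cls (idt K)) = cls \<eta>"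
  using along_cls[of \<eta> H K "idt K" K] EpiD[of \<eta> H K] Ident_Epi Ident_Comp[OF Epi_Hom] by auto

text \<open>Lattice notions named by the object, so that several quotient lattices can be compared
  without interpreting the locale for each.\<close>

definition qloewy :: "'a \<Rightarrow> nat \<Rightarrow> ('a \<times> 'b) set \<Rightarrow> ('a \<times> 'b) set \<Rightarrow> bool" where
  "qloewy G = finite_modular_lattice.loewy (qposet G)"

definition qchain :: "'a \<Rightarrow> nat \<Rightarrow> ('a \<times> 'b) set \<Rightarrow> ('a \<times> 'b) set \<Rightarrow> bool" where
  "qchain G = finite_modular_lattice.chain (qposet G)"

lemma mu_along:
  assumes "\<eta> \<in> Epi C H K" "\<pi> \<in> Epi C K F"
  shows "moebius (qposet H) (cls (\<pi> \<cdot> \<eta>)) (cls \<eta>) = mu C \<pi>"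
proof -
  interpret lower_embedding "qposet K" "cls (idt K)" "qposet H" "cls (idt H)" "along \<eta>"
    by (rule lower_embedding_along[OF assms(1)])
  show ?thesis
    using moebius_eq[of "cls \<pi>" "cls (idt K)"] cls_carrier[OF assms(2)] EpiD[OF assms(2)]
    by (simp add: along_cls[OF assms] along_Ident[OF assms(1)] mu_def)
qed

lemma qloewy_along:
  assumes "\<eta> \<in> Epi C H K" "x \<in> carrier (qposet K)" "y \<in> carrier (qposet K)"
  shows "qloewy H i (along \<eta> x) (along \<eta> y) \<longleftrightarrow> qloewy K i x y"
proof -
  interpret lower_embedding "qposet K" "cls (idt K)" "qposet H" "cls (idt H)" "along \<eta>"
    by (rule lower_embedding_along[OF assms(1)])
  show ?thesis using loewy_iff assms by (simp add: qloewy_def)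
qed

lemma qchain_along:
  assumes "\<eta> \<in> Epi C H K" "x \<in> carrier (qposet K)" "y \<in> carrier (qposet K)"
  shows "qchain H n (along \<eta> x) (along \<eta> y) \<longleftrightarrow> qchain K n x y"
proof -
  interpret lower_embedding "qposet K" "cls (idt K)" "qposet H" "cls (idt H)" "along \<eta>"
    by (rule lower_embedding_along[OF assms(1)])
  show ?thesis using chain_iff assms by (simp add: qchain_def)
qed

lemma finite_AutD: "G \<in> Obj C \<Longrightarrow> finite (Aut C G) \<and> card (Aut C G) > 0"
  using finite_Aut[of G] Ident_Iso[of G] by (auto simp: Aut_def card_gt_0_iff)

text \<open>Equal classes differ by an isomorphism of the target, here an automorphism of
  \<open>F\<close>; it is unique because \<open>\<phi>\<close> is epi.\<close>

lemma Epi_fibre: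
  assumes "\<phi> \<in> Epi C H F"
  shows "{\<psi> \<in> Epi C H F. cls \<psi> = cls \<phi>} = (\<lambda>\<sigma>. \<sigma> \<cdot> \<phi>) ` Aut C F"
    and "inj_on (\<lambda>\<sigma>. \<sigma> \<cdot> \<phi>) (Aut C F)"
proof -
  show "inj_on (\<lambda>\<sigma>. \<sigma> \<cdot> \<phi>) (Aut C F)"
    using Epi_cancel[OF assms] Iso_Hom unfolding Aut_def by (blast intro: inj_onI)
  have "\<psi> \<in> Epi C H F \<and> cls \<psi> = cls \<phi> \<longleftrightarrow> \<psi> \<in> (\<lambda>\<sigma>. \<sigma> \<cdot> \<phi>) ` Aut C F" for \<psi>
    using cls_eq_iff[OF assms, of \<psi> F] Epi_comp[OF assms Iso_Epi] unfolding Aut_def by auto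
  then show "{\<psi> \<in> Epi C H F. cls \<psi> = cls \<phi>} = (\<lambda>\<sigma>. \<sigma> \<cdot> \<phi>) ` Aut C F" by blast
qed

lemma card_Epi_fibre:
  assumes "\<phi> \<in> Epi C H F"
  shows "card {\<psi> \<in> Epi C H F. cls \<psi> = cls \<phi>} = card (Aut C F)"
  unfolding Epi_fibre(1)[OF assms] by (rule card_image[OF Epi_fibre(2)[OF assms]])

lemma finite_Epi: "finite (Epi C H F)"
proof (cases "Epi C H F = {}")
  case False
  then have obj: "H \<in> Obj C" "F \<in> Obj C" using EpiD by blast+
  have "Epi C H F = (\<Union>q\<in>carrier (qposet H). {\<psi> \<in> Epi C H F. cls \<psi> = q})"
    using cls_carrier[of _ H F] by auto
  moreover have "finite {\<psi> \<in> Epi C H F. cls \<psi> = q}" for q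
  proof (cases "\<exists>\<phi>\<in>Epi C H F. cls \<phi> = q")
    case True
    then obtain \<phi> where "\<phi> \<in> Epi C H F" "cls \<phi> = q" by blast
    then show ?thesis using Epi_fibre(1)[of \<phi> H F] finite_Aut[OF obj(2)] by auto
  next
    case False
    then have "{\<psi> \<in> Epi C H F. cls \<psi> = q} = {}" by blast
    then show ?thesis by (simp only: finite.emptyI)
  qed
  ultimately show ?thesis using finite_quotients[OF obj(1)] by (metis (no_types, lifting) finite_UN)
qed simp

text \<open>The orbits of \<open>Aut C F\<close> are the fibres of \<open>cls\<close>; each has
  \<open>card (Aut C F)\<close> elements since the action is free, and \<open>mu\<close> depends
  only on the class. This replaces orbit sums by sums over epimorphisms.\<close>

lemma mu_hat_eq:
  assumes "G \<in> Obj C" "F \<in> Obj C"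
  shows "real (card (Aut C F)) * real_of_int (mu_hat C F G) = (\<Sum>\<pi>\<in>Epi C G F. real_of_int (mu C \<pi>))"
proof -
  define orb where "orb \<pi> = (\<lambda>\<sigma>. \<sigma> \<cdot> \<pi>) ` Aut C F" for \<pi>
  have orb: "orb \<pi> = {\<psi> \<in> Epi C G F. cls \<psi> = cls \<pi>}" if "\<pi> \<in> Epi C G F" for \<pi>
    unfolding orb_def using Epi_fibre(1)[OF that] by simp
  have mu_const: "mu C \<psi> = mu C \<pi>" if "\<pi> \<in> Epi C G F" "\<psi> \<in> orb \<pi>" for \<pi> \<psi>
  proof -
    have "\<psi> \<in> Epi C G F" "cls \<psi> = cls \<pi>" using that orb[OF that(1)] by simp_all
    then show ?thesis using EpiD(1)[OF that(1)] EpiD(1)[of \<psi> G F] by (simp add: mu_def)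
  qed
  have eq: "{\<psi> \<in> Epi C G F. orb \<psi> = B} = B \<and> card B = card (Aut C F) \<and> (\<forall>\<psi>\<in>B. mu C \<psi> = the_elem (mu C ` B))"
    if B: "B \<in> Epi_orbits C G F" for B
  proof -
    obtain \<pi> where \<pi>: "\<pi> \<in> Epi C G F" "B = orb \<pi>" using B by (auto simp: Epi_orbits_def orb_def)
    have Beq: "B = {\<psi> \<in> Epi C G F. cls \<psi> = cls \<pi>}" using orb[OF \<pi>(1)] \<pi>(2) by simp
    have const: "mu C \<psi> = mu C \<pi>" if "\<psi> \<in> B" for \<psi>
      using mu_const[OF \<pi>(1), of \<psi>] \<pi>(2) that by simp
    have "\<pi> \<in> B" using \<pi>(1) Beq by simp
    then have img: "mu C ` B = {mu C \<pi>}" using const by blast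
    have "{\<psi> \<in> Epi C G F. orb \<psi> = B} = B"
    proof (intro Set.set_eqI iffI)
      fix \<psi> assume \<psi>: "\<psi> \<in> {\<psi> \<in> Epi C G F. orb \<psi> = B}"
      then have "\<psi> \<in> orb \<psi>" using orb[of \<psi>] by simp
      then show "\<psi> \<in> B" using \<psi> by simp
    next
      fix \<psi> assume "\<psi> \<in> B"
      then have "\<psi> \<in> Epi C G F" "cls \<psi> = cls \<pi>" using Beq by simp_all
      then show "\<psi> \<in> {\<psi> \<in> Epi C G F. orb \<psi> = B}" using orb[of \<psi>] Beq by simp
    qed
    moreover have "card B = card (Aut C F)" unfolding Beq by (rule card_Epi_fibre[OF \<pi>(1)])
    ultimately show ?thesis using const img by simp
  qed
  have "(\<Sum>\<pi>\<in>Epi C G F. real_of_int (mu C \<pi>))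
      = (\<Sum>B\<in>Epi_orbits C G F. \<Sum>\<pi>\<in>{\<psi> \<in> Epi C G F. orb \<psi> = B}. real_of_int (mu C \<pi>))"
    by (rule sum.group[symmetric]) (auto simp: finite_Epi Epi_orbits_def orb_def)
  also have "\<dots> = (\<Sum>B\<in>Epi_orbits C G F. real (card (Aut C F)) * real_of_int (the_elem (mu C ` B)))"
  proof (rule sum.cong)
    fix B assume B: "B \<in> Epi_orbits C G F"
    have "(\<Sum>\<pi>\<in>{\<psi> \<in> Epi C G F. orb \<psi> = B}. real_of_int (mu C \<pi>)) = (\<Sum>\<pi>\<in>B. real_of_int (the_elem (mu C ` B)))"
      using eq[OF B] by (intro sum.cong) auto
    then show "(\<Sum>\<pi>\<in>{\<psi> \<in> Epi C G F. orb \<psi> = B}. real_of_int (mu C \<pi>))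
        = real (card (Aut C F)) * real_of_int (the_elem (mu C ` B))"
      using eq[OF B] by simp
  qed simp
  finally show ?thesis by (simp add: mu_hat_def sum_distrib_left)
qed

lemma Z_count_eq:
  assumes "\<pi> \<in> Epi C G F"
  shows "Z_count C \<pi> = card (finite_modular_lattice.distributive (qposet G) (cls (idt G)) (cls \<pi>))"
proof -
  have G: "Dom C \<pi> = G" "G \<in> Obj C" using EpiD[OF assms] by auto
  interpret finite_modular_lattice "qposet G" "cls (idt G)" by (rule finite_modular_lattice_qposet[OF G(2)])
  have "interval C \<pi> = ivl (cls \<pi>) (cls (idt G))"
    unfolding interval_def G(1) by (auto simp: ivl_iff)
  then show ?thesis unfolding Z_count_def distributive_def Let_def G(1) by simp
qed

end

section \<open>Levels\<close>

context diamond_category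
begin

lemma formation_iso_classes: "formation C (iso_classes C)"
proof -
  have "c \<in> iso_classes C" if "c \<in> minimal_classes C" for c
    using that iso_class_in by (auto simp: minimal_classes_def minimal_object_def)
  then show ?thesis
    using iso_class_in EpiD
    by (auto simp: formation_def downward_closed_def join_closed_def quotients_def)
qed

lemma downward_closedD:
  assumes "downward_closed C S" "\<pi> \<in> Epi C G F" "iso_class C G \<in> S"
  shows "iso_class C F \<in> S"
  using assms EpiD[OF assms(2)] unfolding downward_closed_def by (force simp: quotient_mem)

lemma qloewy_iso:
  assumes "\<rho> \<in> Iso C X Y" and X: "\<forall>b\<in>carrier (qposet X). qloewy X k b (cls (idt X))"
  shows "\<forall>b\<in>carrier (qposet Y). qloewy Y k b (cls (idt Y))"
proof
  fix b assume b: "b \<in> carrier (qposet Y)"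
  have \<rho>: "\<rho> \<in> Epi C X Y" using Iso_Epi assms(1) .
  interpret lower_embedding "qposet Y" "cls (idt Y)" "qposet X" "cls (idt X)" "along \<rho>"
    by (rule lower_embedding_along[OF \<rho>])
  have "along \<rho> (cls (idt Y)) = cls (idt X)"
    using along_Ident[OF \<rho>] cls_Ident_eq_iff[OF \<rho>] assms(1) by simp
  then show "qloewy Y k b (cls (idt Y))"
    using qloewy_along[OF \<rho> b, of "cls (idt Y)" k] X b closed by simp
qed

text \<open>Loewy length at most \<open>k\<close> over every quotient. These sets serve as
  formations large enough to contain a given level.\<close>

definition loewy_classes :: "nat \<Rightarrow> 'a set set" where
  "loewy_classes k = {c \<in> iso_classes C. \<forall>b\<in>carrier (qposet (rep c)). qloewy (rep c) k b (cls (idt (rep c)))}"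

lemma loewy_classes_iff:
  assumes "X \<in> Obj C"
  shows "iso_class C X \<in> loewy_classes k \<longleftrightarrow> (\<forall>b\<in>carrier (qposet X). qloewy X k b (cls (idt X)))"
proof -
  obtain \<rho> where \<rho>: "\<rho> \<in> Iso C X (rep (iso_class C X))" using Iso_rep[OF assms] by blast
  obtain \<rho>' where \<rho>': "\<rho>' \<in> Iso C (rep (iso_class C X)) X" using Iso_inverse[OF \<rho>] by blast
  show ?thesis
    unfolding loewy_classes_def using qloewy_iso[OF \<rho>, of k] qloewy_iso[OF \<rho>', of k] iso_class_in[OF assms] by blast
qed

lemma qloewy_mono: "X \<in> Obj C \<Longrightarrow> i \<le> j \<Longrightarrow> qloewy X i b u \<Longrightarrow> qloewy X j b u"
  using finite_modular_lattice.loewy_mono[OF finite_modular_lattice_qposet] unfolding qloewy_def by blast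

lemma loewy_classes_mono: "i \<le> j \<Longrightarrow> loewy_classes i \<subseteq> loewy_classes j"
  unfolding loewy_classes_def using qloewy_mono rep_iso_class(2) by blast

text \<open>For a join \<open>J\<close> of \<open>H\<close> and \<open>F\<close> and any
  \<open>b\<close> below \<open>J\<close>, both \<open>H \<squnion> b\<close> and
  \<open>F \<squnion> b\<close> have length at most \<open>k\<close> over \<open>b\<close>; so does
  their join, and hence \<open>J\<close> beneath it.\<close>

lemma formation_loewy_classes: "formation C (loewy_classes k)"
  unfolding formation_def
proof (intro conjI)
  show "loewy_classes k \<subseteq> iso_classes C" by (auto simp: loewy_classes_def)
  have "iso_class C F \<in> loewy_classes k"
    if \<pi>: "\<pi> \<in> Epi C G F" and G: "iso_class C G \<in> loewy_classes k" for G F \<pi>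
  proof -
    have obj: "G \<in> Obj C" "F \<in> Obj C" using EpiD[OF \<pi>] by auto
    interpret lower_embedding "qposet F" "cls (idt F)" "qposet G" "cls (idt G)" "along \<pi>"
      by (rule lower_embedding_along[OF \<pi>])
    show ?thesis unfolding loewy_classes_iff[OF obj(2)]
    proof
      fix b assume b: "b \<in> carrier (qposet F)"
      have "Q.loewy k (along \<pi> b) (cls (idt G))"
        using G loewy_classes_iff[OF obj(1)] b closed unfolding qloewy_def by blast
      then have "Q.loewy k (along \<pi> b) (along \<pi> (cls (idt F)))"
        by (rule Q.loewy_lower) (use b in \<open>auto simp: le_iff\<close>)
      then show "qloewy F k b (cls (idt F))" using b loewy_iff by (simp add: qloewy_def)
    qed
  qed
  then show "downward_closed C (loewy_classes k)"
    unfolding downward_closed_def by (auto simp: quotient_mem)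
  show "join_closed C (loewy_classes k)"
    unfolding join_closed_def
  proof (intro ballI, clarsimp simp: quotient_mem)
    fix G H \<eta> F \<pi> J \<sigma>
    assume G: "G \<in> Obj C" and \<eta>: "\<eta> \<in> Epi C G H" and \<pi>: "\<pi> \<in> Epi C G F" and \<sigma>: "\<sigma> \<in> Epi C G J"
      and HL: "iso_class C H \<in> loewy_classes k" and FL: "iso_class C F \<in> loewy_classes k"
      and l: "least (qposet G) (cls \<sigma>) (Upper (qposet G) {cls \<eta>, cls \<pi>})"
    have J: "J \<in> Obj C" using EpiD[OF \<sigma>] by simp
    interpret E: lower_embedding "qposet J" "cls (idt J)" "qposet G" "cls (idt G)" "along \<sigma>"
      by (rule lower_embedding_along[OF \<sigma>])
    note [simp] = cls_carrier[OF \<eta>] cls_carrier[OF \<pi>] cls_carrier[OF \<sigma>]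
    \<comment> \<open>The meet of \<open>b\<close> and \<open>cls \<phi>\<close> is a quotient of
      \<open>K\<close>, so \<open>cls \<phi>\<close> has length at most \<open>k\<close> over it;
      joining with \<open>b\<close> moves the lower end to \<open>b\<close>.\<close>
    have *: "E.Q.loewy k b (cls \<phi> \<squnion>\<^bsub>qposet G\<^esub> b)"
      if \<phi>: "\<phi> \<in> Epi C G K" and K: "iso_class C K \<in> loewy_classes k" and b: "b \<in> carrier (qposet G)" for \<phi> K b
    proof -
      note [simp] = cls_carrier[OF \<phi>] b
      interpret K: lower_embedding "qposet K" "cls (idt K)" "qposet G" "cls (idt G)" "along \<phi>"
        by (rule lower_embedding_along[OF \<phi>])
      have m: "b \<sqinter>\<^bsub>qposet G\<^esub> cls \<phi> \<sqsubseteq>\<^bsub>qposet G\<^esub> along \<phi> (cls (idt K))"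
        using along_Ident[OF \<phi>] by simp
      obtain x where x: "x \<in> carrier (qposet K)" "along \<phi> x = b \<sqinter>\<^bsub>qposet G\<^esub> cls \<phi>"
        using K.lower[OF _ _ m] by auto
      have "qloewy K k x (cls (idt K))" using K x(1) loewy_classes_iff EpiD[OF \<phi>] by blast
      then have "E.Q.loewy k (b \<sqinter>\<^bsub>qposet G\<^esub> cls \<phi>) (cls \<phi>)"
        using K.loewy_iff[OF x(1), of "cls (idt K)" k] x(2) along_Ident[OF \<phi>] by (simp add: qloewy_def)
      then show ?thesis by (rule E.Q.loewy_push) auto
    qed
    show "iso_class C J \<in> loewy_classes k" unfolding loewy_classes_iff[OF J]
    proof
      fix b assume b: "b \<in> carrier (qposet J)"
      define b' where "b' = along \<sigma> b"
      have [simp]: "b' \<in> carrier (qposet G)" using b by (simp add: b'_def)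
      have le: "b' \<sqsubseteq>\<^bsub>qposet G\<^esub> cls \<sigma>"
        using b E.le_iff[of b "cls (idt J)"] along_Ident[OF \<sigma>] by (simp add: b'_def)
      define u where "u = (cls \<eta> \<squnion>\<^bsub>qposet G\<^esub> b') \<squnion>\<^bsub>qposet G\<^esub> (cls \<pi> \<squnion>\<^bsub>qposet G\<^esub> b')"
      have [simp]: "u \<in> carrier (qposet G)" by (simp add: u_def)
      have "E.Q.loewy k b' u" unfolding u_def by (rule E.Q.loewy_join) (rule *[OF \<eta> HL], simp, rule *[OF \<pi> FL], simp)
      moreover have "cls \<sigma> \<sqsubseteq>\<^bsub>qposet G\<^esub> u"
      proof (rule least_le[OF l])
        show "u \<in> Upper (qposet G) {cls \<eta>, cls \<pi>}" by (auto simp: Upper_def u_def)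
      qed
      ultimately have "E.Q.loewy k b' (cls \<sigma>)" using le E.Q.loewy_lower[of k b' u "cls \<sigma>"] by simp
      then show "qloewy J k b (cls (idt J))"
        using E.loewy_iff[OF b, of "cls (idt J)" k] along_Ident[OF \<sigma>] by (simp add: qloewy_def b'_def)
    qed
  qed
  show "minimal_classes C \<subseteq> loewy_classes k"
  proof
    fix c assume "c \<in> minimal_classes C"
    then obtain G where G: "c = iso_class C G" "G \<in> Obj C" "carrier (qposet G) = {cls (idt G)}"
      by (auto simp: minimal_classes_def minimal_object_def)
    interpret finite_modular_lattice "qposet G" "cls (idt G)" by (rule finite_modular_lattice_qposet[OF G(2)])
    show "c \<in> loewy_classes k"
      unfolding G(1) loewy_classes_iff[OF G(2)] G(3) qloewy_def using loewy_refl by simp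
  qed
qed

lemma ex_loewy_classes:
  assumes "c \<in> iso_classes C"
  shows "\<exists>k. c \<in> loewy_classes k"
proof -
  let ?X = "rep c"
  have X: "?X \<in> Obj C" using rep_iso_class assms by blast
  interpret finite_modular_lattice "qposet ?X" "cls (idt ?X)" by (rule finite_modular_lattice_qposet[OF X])
  have "\<forall>b\<in>carrier (qposet ?X). \<exists>i. loewy i b (cls (idt ?X))" using ex_loewy by simp
  then obtain i where i: "\<And>b. b \<in> carrier (qposet ?X) \<Longrightarrow> loewy (i b) b (cls (idt ?X))" by metis
  have "loewy (Max (i ` carrier (qposet ?X))) b (cls (idt ?X))" if "b \<in> carrier (qposet ?X)" for b
    by (rule loewy_mono[OF _ i[OF that]]) (use that finite_carrier in auto)
  then show ?thesis using assms unfolding loewy_classes_def qloewy_def by blast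
qed

end

section \<open>Levels: closure, bounded Loewy length, finiteness in each rank\<close>

locale diamond_level = diamond_category C for C :: "('a, 'b) category" +
  fixes L :: "'a set set"
  assumes level: "level C L"
begin

lemma formation_level: "formation C L"
proof -
  obtain B where B: "B \<subseteq> iso_classes C" "L = \<Inter>{S. formation C S \<and> B \<subseteq> S}"
    using level unfolding level_def level_generated_by_def by blast
  have "L \<subseteq> iso_classes C" using B formation_iso_classes by blast
  moreover have "downward_closed C L"
  proof -
    have "iso_class C F \<in> L" if \<pi>: "\<pi> \<in> Epi C G F" and G: "iso_class C G \<in> L" for G F \<pi>
    proof -
      have "iso_class C F \<in> S" if "formation C S" "B \<subseteq> S" for S
        using downward_closedD[OF _ \<pi>, of S] that G B(2) by (auto simp: formation_def)
      then show ?thesis unfolding B(2) by blast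
    qed
    then show ?thesis unfolding downward_closed_def by (auto simp: quotient_mem)
  qed
  moreover have "join_closed C L"
    unfolding join_closed_def
  proof (intro ballI, clarsimp simp: quotient_mem)
    fix G H \<eta> F \<pi> J \<sigma>
    assume *: "G \<in> Obj C" "\<eta> \<in> Epi C G H" "\<pi> \<in> Epi C G F" "\<sigma> \<in> Epi C G J"
      "iso_class C H \<in> L" "iso_class C F \<in> L"
      "least (qposet G) (cls \<sigma>) (Upper (qposet G) {cls \<eta>, cls \<pi>})"
    have "iso_class C J \<in> S" if "formation C S" "B \<subseteq> S" for S
    proof -
      have "join_closed C S" "iso_class C H \<in> S" "iso_class C F \<in> S"
        using that * B(2) by (auto simp: formation_def)
      then show ?thesis using *(1-4,7) unfolding join_closed_def by (force simp: quotient_mem)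
    qed
    then show "iso_class C J \<in> L" unfolding B(2) by blast
  qed
  moreover have "minimal_classes C \<subseteq> L" unfolding B(2) formation_def by blast
  ultimately show ?thesis by (simp add: formation_def)
qed

lemma level_repD:
  assumes "c \<in> L"
  shows "rep c \<in> Obj C" "iso_class C (rep c) = c"
  using assms formation_level rep_iso_class unfolding formation_def by blast+

lemma level_quotient: "\<lbrakk>\<pi> \<in> Epi C G F; iso_class C G \<in> L\<rbrakk> \<Longrightarrow> iso_class C F \<in> L"
  using formation_level downward_closedD unfolding formation_def by blast

text \<open>Finite generation is decisive: the maximal length among the generators defines a
  formation containing them all, hence the whole level.\<close>

lemma loewy_bounded: "\<exists>k. L \<subseteq> loewy_classes k"
proof -
  obtain B where B: "finite B" "B \<subseteq> iso_classes C" "L = \<Inter>{S. formation C S \<and> B \<subseteq> S}"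
    using level unfolding level_def level_generated_by_def by blast
  obtain k where k: "\<And>c. c \<in> B \<Longrightarrow> c \<in> loewy_classes (k c)" using ex_loewy_classes B(2) by (metis subsetD)
  have "c \<in> loewy_classes (Max (k ` B))" if "c \<in> B" for c
    using loewy_classes_mono[of "k c" "Max (k ` B)"] k[OF that] that B(1) by auto
  then have "L \<subseteq> loewy_classes (Max (k ` B))" using B(3) formation_loewy_classes by blast
  then show ?thesis by blast
qed

text \<open>Individual epimorphisms with chosen targets instead of classes of quotients. A class
  then occurs \<open>aut F\<close> times, which the weights \<open>1 / aut F\<close> compensate in
  \<open>sum_Quot\<close>.\<close>

definition Quot :: "'a \<Rightarrow> ('a set \<times> 'b) set" where
  "Quot H = (SIGMA F:L. Epi C H (rep F))"

definition Over :: "'a \<Rightarrow> ('a set \<times> 'b) set" where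
  "Over X = (SIGMA H:L. Epi C (rep H) X)"

definition aut :: "'a set \<Rightarrow> real" where
  "aut F = real (card (Aut C (rep F)))"

lemma aut_pos: "F \<in> L \<Longrightarrow> aut F > 0"
  using finite_AutD[of "rep F"] level_repD by (simp add: aut_def)

text \<open>The class \<open>q\<close> determines the isomorphism class \<open>F\<close> of its
  target, so all pairs over it share their first component.\<close>

lemma Quot_fibre:
  assumes H: "iso_class C H \<in> L" "H \<in> Obj C" and q: "q \<in> carrier (qposet H)"
  obtains F \<phi> where "F \<in> L" "\<phi> \<in> Epi C H (rep F)" "q = cls \<phi>"
    "{r \<in> Quot H. cls (snd r) = q} = Pair F ` {\<psi> \<in> Epi C H (rep F). cls \<psi> = cls \<phi>}"
proof -
  obtain Y \<pi> where \<pi>: "\<pi> \<in> Epi C H Y" "q = cls \<pi>" using q by (rule carrier_cls)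
  define F where "F = iso_class C Y"
  have F: "F \<in> L" unfolding F_def by (rule level_quotient[OF \<pi>(1) H(1)])
  obtain \<rho> where \<rho>: "\<rho> \<in> Iso C Y (rep F)" unfolding F_def using Iso_rep EpiD[OF \<pi>(1)] by blast
  define \<phi> where "\<phi> = \<rho> \<cdot> \<pi>"
  have \<phi>: "\<phi> \<in> Epi C H (rep F)" unfolding \<phi>_def by (rule Epi_comp[OF \<pi>(1) Iso_Epi[OF \<rho>]])
  have q\<phi>: "q = cls \<phi>" using cls_eq_iff[OF \<pi>(1) \<phi>] \<rho> \<pi>(2) \<phi>_def by blast
  have *: "F' = F" if "F' \<in> L" "\<psi> \<in> Epi C H (rep F')" "cls \<psi> = q" for F' \<psi>
  proof -
    have "Iso C (rep F') (rep F) \<noteq> {}" using cls_eq_iff[OF that(2) \<phi>] that(3) q\<phi> by auto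
    then have "iso_class C (rep F') = iso_class C (rep F)"
      using iso_class_eq_iff level_repD that(1) F by blast
    then show ?thesis using level_repD that(1) F by metis
  qed
  have "{r \<in> Quot H. cls (snd r) = q} = Pair F ` {\<psi> \<in> Epi C H (rep F). cls \<psi> = cls \<phi>}"
  proof (intro Set.set_eqI iffI)
    fix r assume r: "r \<in> {r \<in> Quot H. cls (snd r) = q}"
    obtain F' \<psi> where [simp]: "r = (F', \<psi>)" by (cases r)
    have m: "F' \<in> L" "\<psi> \<in> Epi C H (rep F')" "cls \<psi> = q" using r by (simp_all add: Quot_def)
    then show "r \<in> Pair F ` {\<psi> \<in> Epi C H (rep F). cls \<psi> = cls \<phi>}" using *[OF m] q\<phi> by simp
  next
    fix r assume "r \<in> Pair F ` {\<psi> \<in> Epi C H (rep F). cls \<psi> = cls \<phi>}"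
    then obtain \<psi> where "r = (F, \<psi>)" "\<psi> \<in> Epi C H (rep F)" "cls \<psi> = cls \<phi>" by blast
    then show "r \<in> {r \<in> Quot H. cls (snd r) = q}" using F q\<phi> by (simp add: Quot_def)
  qed
  then show ?thesis using that F \<phi> q\<phi> by blast
qed

lemma finite_Quot:
  assumes H: "iso_class C H \<in> L" "H \<in> Obj C"
  shows "finite (Quot H)"
proof -
  have "Quot H = (\<Union>q\<in>carrier (qposet H). {r \<in> Quot H. cls (snd r) = q})"
    using cls_carrier by (auto simp: Quot_def)
  moreover have "finite {r \<in> Quot H. cls (snd r) = q}" if q: "q \<in> carrier (qposet H)" for q
  proof -
    obtain F \<phi> where eq: "{r \<in> Quot H. cls (snd r) = q} = Pair F ` {\<psi> \<in> Epi C H (rep F). cls \<psi> = cls \<phi>}"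
      using Quot_fibre[OF H q] .
    have "finite {\<psi> \<in> Epi C H (rep F). cls \<psi> = cls \<phi>}" using finite_Epi by simp
    then show ?thesis unfolding eq by (rule finite_imageI)
  qed
  ultimately show ?thesis using finite_quotients[OF H(2)] by (metis (no_types, lifting) finite_UN)
qed

text \<open>The quotients of \<open>H\<close> isomorphic to a given one form a torsor under the automorphisms of its
  codomain.\<close>

lemma sum_Quot:
  assumes H: "iso_class C H \<in> L" "H \<in> Obj C"
  shows "(\<Sum>(F, \<phi>)\<in>Quot H. f (cls \<phi>) / aut F) = (\<Sum>q\<in>carrier (qposet H). f q)"
proof -
  have "(\<Sum>(F, \<phi>)\<in>Quot H. f (cls \<phi>) / aut F)
      = (\<Sum>q\<in>carrier (qposet H). \<Sum>r\<in>{r \<in> Quot H. cls (snd r) = q}. f (cls (snd r)) / aut (fst r))"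
    unfolding split_beta
    by (rule sum.group[symmetric]) (use cls_carrier finite_Quot[OF H] finite_quotients[OF H(2)] in \<open>auto simp: Quot_def\<close>)
  also have "\<dots> = (\<Sum>q\<in>carrier (qposet H). f q)"
  proof (rule sum.cong)
    fix q assume q: "q \<in> carrier (qposet H)"
    obtain F \<phi> where F: "F \<in> L" "\<phi> \<in> Epi C H (rep F)" "q = cls \<phi>"
      "{r \<in> Quot H. cls (snd r) = q} = Pair F ` {\<psi> \<in> Epi C H (rep F). cls \<psi> = cls \<phi>}"
      using Quot_fibre[OF H q] .
    have "(\<Sum>r\<in>{r \<in> Quot H. cls (snd r) = q}. f (cls (snd r)) / aut (fst r))
        = (\<Sum>r\<in>{r \<in> Quot H. cls (snd r) = q}. f q / aut F)"
      unfolding F(4) by (rule sum.cong) (use F(3) in auto)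
    also have "\<dots> = real (card (Pair F ` {\<psi> \<in> Epi C H (rep F). cls \<psi> = cls \<phi>})) * (f q / aut F)"
      unfolding F(4) by simp
    also have "card (Pair F ` {\<psi> \<in> Epi C H (rep F). cls \<psi> = cls \<phi>}) = card (Aut C (rep F))"
      using card_Epi_fibre[OF F(2)] by (subst card_image) (auto simp: inj_on_def)
    also have "real (card (Aut C (rep F))) * (f q / aut F) = f q"
      using aut_pos[OF F(1)] by (simp add: aut_def)
    finally show "(\<Sum>r\<in>{r \<in> Quot H. cls (snd r) = q}. f (cls (snd r)) / aut (fst r)) = f q" .
  qed simp
  finally show ?thesis .
qed

text \<open>The reindexing behind every interchange of sums: H -> F -> X is either an object H over
  an object F over X, or H over X with a quotient F of H above it. The map F -> X is determined by
  the composite, as H -> F is epi.\<close>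

lemma bij_betw_factorizations:
  "bij_betw (\<lambda>(p, r). ((fst r, snd p \<cdot> snd r), (fst p, snd r)))
     (SIGMA p:Over X. Over (rep (fst p)))
     (SIGMA p:Over X. {r \<in> Quot (rep (fst p)). cls (snd p) \<sqsubseteq>\<^bsub>qposet (rep (fst p))\<^esub> cls (snd r)})"
  (is "bij_betw ?m ?S ?T")
  unfolding bij_betw_def
proof
  show "inj_on ?m ?S"
  proof (rule inj_onI)
    fix x y assume x: "x \<in> ?S" and y: "y \<in> ?S" and eq: "?m x = ?m y"
    obtain F \<rho> H \<phi> where [simp]: "x = ((F, \<rho>), (H, \<phi>))" by (metis surj_pair)
    obtain F' \<rho>' H' \<phi>' where [simp]: "y = ((F', \<rho>'), (H', \<phi>'))" by (metis surj_pair)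
    have e: "F' = F" "H' = H" "\<phi>' = \<phi>" "\<rho> \<cdot> \<phi> = \<rho>' \<cdot> \<phi>" using eq by auto
    have "\<phi> \<in> Epi C (rep H) (rep F)" "\<rho> \<in> Epi C (rep F) X" "\<rho>' \<in> Epi C (rep F) X"
      using x y e by (auto simp: Over_def)
    then have "\<rho> = \<rho>'" using Epi_cancel[of \<phi> "rep H" "rep F" \<rho> X \<rho>'] Epi_Hom e by blast
    then show "x = y" using e by simp
  qed
  show "?m ` ?S = ?T"
  proof (intro Set.set_eqI iffI)
    fix z assume "z \<in> ?m ` ?S"
    then obtain F \<rho> H \<phi> where z: "z = ((H, \<rho> \<cdot> \<phi>), (F, \<phi>))" and
      m: "F \<in> L" "\<rho> \<in> Epi C (rep F) X" "H \<in> L" "\<phi> \<in> Epi C (rep H) (rep F)"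
      by (auto simp: Over_def)
    have e: "\<rho> \<cdot> \<phi> \<in> Epi C (rep H) X" by (rule Epi_comp[OF m(4,2)])
    have "cls (\<rho> \<cdot> \<phi>) \<sqsubseteq>\<^bsub>qposet (rep H)\<^esub> cls \<phi>" using cls_le_iff[OF e m(4)] m(2) by blast
    then show "z \<in> ?T" using m e by (simp add: z Over_def Quot_def)
  next
    fix z assume "z \<in> ?T"
    then obtain H \<tau> F \<phi> where z: "z = ((H, \<tau>), (F, \<phi>))" and
      m: "H \<in> L" "\<tau> \<in> Epi C (rep H) X" "F \<in> L" "\<phi> \<in> Epi C (rep H) (rep F)"
        "cls \<tau> \<sqsubseteq>\<^bsub>qposet (rep H)\<^esub> cls \<phi>"
      by (auto simp: Over_def Quot_def)
    then obtain \<rho> where "\<rho> \<in> Epi C (rep F) X" "\<tau> = \<rho> \<cdot> \<phi>" using cls_le_iff[OF m(2,4)] by blast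
    then have "z = ?m ((F, \<rho>), (H, \<phi>))" "((F, \<rho>), (H, \<phi>)) \<in> ?S" using m by (auto simp: z Over_def)
    then show "z \<in> ?m ` ?S" by blast
  qed
qed


subsection \<open>Finiteness and countability\<close>

text \<open>A set of ranks is allowed so that the truncation up to \<open>r\<close> and the single
  rank \<open>Suc r\<close> fall under the same lemmas.\<close>

definition Over_rank :: "nat set \<Rightarrow> 'a \<Rightarrow> ('a set \<times> 'b) set" where
  "Over_rank N X = {(H, \<pi>) \<in> Over X. \<exists>n\<in>N. qchain (rep H) n (cls \<pi>) (cls (idt (rep H)))}"

text \<open>The first cover of the chain over \<open>X\<close> is a quotient \<open>K\<close> of
  \<open>H\<close> with a simple epimorphism onto \<open>X\<close>. There are finitely many such
  \<open>K\<close>, and \<open>H\<close> has rank \<open>n\<close> over \<open>K\<close>.\<close>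

lemma finite_rank_classes:
  assumes "X \<in> Obj C" "iso_class C X \<in> L"
  shows "finite {H \<in> L. \<exists>\<pi>\<in>Epi C (rep H) X. qchain (rep H) n (cls \<pi>) (cls (idt (rep H)))}"
  using assms
proof (induction n arbitrary: X)
  case 0
  have "{H \<in> L. \<exists>\<pi>\<in>Epi C (rep H) X. qchain (rep H) 0 (cls \<pi>) (cls (idt (rep H)))} \<subseteq> {iso_class C X}"
  proof
    fix H assume "H \<in> {H \<in> L. \<exists>\<pi>\<in>Epi C (rep H) X. qchain (rep H) 0 (cls \<pi>) (cls (idt (rep H)))}"
    then obtain \<pi> where H: "H \<in> L" "\<pi> \<in> Epi C (rep H) X" "qchain (rep H) 0 (cls \<pi>) (cls (idt (rep H)))" by blast
    interpret finite_modular_lattice "qposet (rep H)" "cls (idt (rep H))"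
      by (rule finite_modular_lattice_qposet) (use level_repD H in auto)
    have "cls \<pi> = cls (idt (rep H))" using H(3) by (simp add: qchain_def)
    then have "\<pi> \<in> Iso C (rep H) X" using cls_Ident_eq_iff[OF H(2)] by simp
    then have "iso_class C (rep H) = iso_class C X" using iso_class_eq_iff EpiD[OF H(2)] by blast
    then show "H \<in> {iso_class C X}" using level_repD H(1) by simp
  qed
  then show ?case by (rule finite_subset) simp
next
  case (Suc n)
  let ?S = "{c \<in> L. \<exists>K\<in>c. \<exists>\<pi>\<in>Epi C K X. simple_epi C \<pi>}"
  let ?R = "\<lambda>n X. {H \<in> L. \<exists>\<pi>\<in>Epi C (rep H) X. qchain (rep H) n (cls \<pi>) (cls (idt (rep H)))}"
  have "?R (Suc n) X \<subseteq> (\<Union>K\<in>?S. ?R n (rep K))"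
  proof
    fix H assume "H \<in> ?R (Suc n) X"
    then obtain \<pi> where H: "H \<in> L" "\<pi> \<in> Epi C (rep H) X" "qchain (rep H) (Suc n) (cls \<pi>) (cls (idt (rep H)))" by blast
    have HO: "rep H \<in> Obj C" using level_repD H(1) by blast
    interpret H: finite_modular_lattice "qposet (rep H)" "cls (idt (rep H))"
      by (rule finite_modular_lattice_qposet[OF HO])
    obtain q where q: "H.cov (cls \<pi>) q" "H.chain n q (cls (idt (rep H)))"
      using H(3) unfolding qchain_def by auto
    have qc: "q \<in> carrier (qposet (rep H))" using H.covD[OF q(1)] by blast
    have "iso_class C (rep H) \<in> L" using level_repD H(1) by simp
    from Quot_fibre[OF this HO qc] obtain K \<eta> where K: "K \<in> L" "\<eta> \<in> Epi C (rep H) (rep K)" "q = cls \<eta>" by metis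
    obtain \<theta> where \<theta>: "\<theta> \<in> Epi C (rep K) X" "\<pi> = \<theta> \<cdot> \<eta>"
      using cls_le_iff[OF H(2) K(2)] H.covD[OF q(1)] K(3) by auto
    interpret E: lower_embedding "qposet (rep K)" "cls (idt (rep K))" "qposet (rep H)" "cls (idt (rep H))" "along \<eta>"
      by (rule lower_embedding_along[OF K(2)])
    have cov: "E.P.cov (cls \<theta>) (cls (idt (rep K)))"
      using E.cov_iff[of "cls \<theta>" "cls (idt (rep K))"] q(1) along_cls[OF K(2) \<theta>(1)] along_Ident[OF K(2)]
        cls_carrier[OF \<theta>(1)] \<theta>(2) K(3) by simp
    have "interval C \<theta> = {cls \<theta>, cls (idt (rep K))}"
      using E.P.covD[OF cov] E.P.cov_between[OF cov] EpiD(1)[OF \<theta>(1)] by (auto simp: interval_def)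
    moreover have "\<theta> \<notin> Iso C (rep K) X" using E.P.covD(4)[OF cov] cls_Ident_eq_iff[OF \<theta>(1)] by simp
    ultimately have "simple_epi C \<theta>" using \<theta>(1) EpiD[OF \<theta>(1)] by (simp add: simple_epi_def)
    moreover have "rep K \<in> K" using rep_iso_class K(1) formation_level by (auto simp: formation_def)
    ultimately have "K \<in> ?S" using K(1) \<theta>(1) by blast
    moreover have "H \<in> ?R n (rep K)" using H(1) K(2,3) q(2) by (auto simp: qchain_def)
    ultimately show "H \<in> (\<Union>K\<in>?S. ?R n (rep K))" by blast
  qed
  moreover have "finite ?S" by (rule finite_simple_epis[OF level Suc.prems])
  moreover have "finite (?R n (rep K))" if "K \<in> ?S" for K
    using Suc.IH[of "rep K"] level_repD[of K] that by auto
  ultimately show ?case by (meson finite_UN finite_subset)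
qed

lemma finite_Over_rank:
  assumes "X \<in> Obj C" "iso_class C X \<in> L" "finite N"
  shows "finite (Over_rank N X)"
proof -
  have "Over_rank N X \<subseteq> (SIGMA H:(\<Union>n\<in>N. {H \<in> L. \<exists>\<pi>\<in>Epi C (rep H) X.
      qchain (rep H) n (cls \<pi>) (cls (idt (rep H)))}). Epi C (rep H) X)"
    by (auto simp: Over_rank_def Over_def)
  moreover have "finite \<dots>"
    using finite_rank_classes[OF assms(1,2)] finite_Epi assms(3) by (intro finite_SigmaI) auto
  ultimately show ?thesis by (rule finite_subset)
qed

lemma ex_rank:
  assumes "(H, \<pi>) \<in> Over X"
  shows "\<exists>n. qchain (rep H) n (cls \<pi>) (cls (idt (rep H)))"
proof -
  have H: "H \<in> L" "\<pi> \<in> Epi C (rep H) X" using assms by (auto simp: Over_def)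
  interpret finite_modular_lattice "qposet (rep H)" "cls (idt (rep H))"
    by (rule finite_modular_lattice_qposet) (use level_repD H in auto)
  show ?thesis using ex_chain[of "cls \<pi>" "cls (idt (rep H))"] cls_carrier[OF H(2)] by (simp add: qchain_def)
qed

text \<open>Every object has a minimal quotient and a finite rank over it. There are countably many
  minimal objects, and each has finitely many objects of the level over it in each rank.\<close>

lemma countable_level: "countable L"
proof -
  let ?R = "\<lambda>n X. {H \<in> L. \<exists>\<pi>\<in>Epi C (rep H) X. qchain (rep H) n (cls \<pi>) (cls (idt (rep H)))}"
  have min: "minimal_classes C \<subseteq> L" using formation_level by (simp add: formation_def)
  have "L \<subseteq> (\<Union>m\<in>minimal_classes C. \<Union>n. ?R n (rep m))"
  proof
    fix H assume H: "H \<in> L"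
    have HO: "rep H \<in> Obj C" "iso_class C (rep H) \<in> L" using level_repD H by auto
    interpret H: finite_modular_lattice "qposet (rep H)" "cls (idt (rep H))"
      by (rule finite_modular_lattice_qposet[OF HO(1)])
    obtain b where b: "b \<in> carrier (qposet (rep H))"
      "\<forall>x\<in>carrier (qposet (rep H)). x \<sqsubseteq>\<^bsub>qposet (rep H)\<^esub> b \<longrightarrow> x = b"
      using H.ex_minimal_elem[of "carrier (qposet (rep H))"] H.top_carrier by blast
    obtain K \<eta> where K: "K \<in> L" "\<eta> \<in> Epi C (rep H) (rep K)" "b = cls \<eta>" using Quot_fibre[OF HO(2,1) b(1)] by metis
    interpret E: lower_embedding "qposet (rep K)" "cls (idt (rep K))" "qposet (rep H)" "cls (idt (rep H))" "along \<eta>"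
      by (rule lower_embedding_along[OF K(2)])
    have "x = cls (idt (rep K))" if x: "x \<in> carrier (qposet (rep K))" for x
    proof -
      have "along \<eta> x \<sqsubseteq>\<^bsub>qposet (rep H)\<^esub> b"
        using E.le_iff[OF x, of "cls (idt (rep K))"] x along_Ident[OF K(2)] K(3) by simp
      then have "along \<eta> x = along \<eta> (cls (idt (rep K)))" using b(2) x along_Ident[OF K(2)] K(3) by simp
      then show ?thesis using E.eq_iff[OF x, of "cls (idt (rep K))"] by simp
    qed
    then have "carrier (qposet (rep K)) = {cls (idt (rep K))}" using E.P.top_carrier by blast
    then have "minimal_object C (rep K)" using level_repD[OF K(1)] by (simp add: minimal_object_def)
    then have "K \<in> minimal_classes C" using level_repD[OF K(1)] unfolding minimal_classes_def by force
    moreover obtain n where "qchain (rep H) n (cls \<eta>) (cls (idt (rep H)))"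
      using ex_rank[of H \<eta> "rep K"] K H by (auto simp: Over_def)
    ultimately show "H \<in> (\<Union>m\<in>minimal_classes C. \<Union>n. ?R n (rep m))" using H K(2) by blast
  qed
  moreover have "countable (\<Union>m\<in>minimal_classes C. \<Union>n. ?R n (rep m))"
  proof (intro countable_UN countable_minimal countableI_type)
    fix m n assume "m \<in> minimal_classes C"
    then show "countable (?R n (rep m))"
      using finite_rank_classes[of "rep m" n] level_repD[of m] min by (intro countable_finite) auto
  qed
  ultimately show ?thesis by (rule countable_subset)
qed

end

section \<open>Moments of measures on a level\<close>

context diamond_level
begin

text \<open>Pairs of \<open>\<pi>\<close> and a map \<open>\<eta>\<close> from \<open>rep c\<close>
  are regrouped by their composite \<open>\<psi>\<close>; the weight \<open>1 / aut\<close> turns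
  the sum over \<open>\<eta>\<close> into one over quotients \<open>q\<close> above
  \<open>\<psi>\<close>. The inversion takes \<open>h\<close> once as the inclusion and once as the
  absolute value.\<close>

lemma sum_Over_rank:
  fixes h :: "int \<Rightarrow> real"
  assumes c: "c \<in> L" and X: "X \<in> Obj C" "iso_class C X \<in> L" and N: "finite N"
  shows "(\<Sum>p\<in>Over_rank N X. h (mu C (snd p)) / aut (fst p) * real (card (Epi C (rep c) (rep (fst p)))))
    = (\<Sum>\<psi>\<in>Epi C (rep c) X. \<Sum>q\<in>{q \<in> carrier (qposet (rep c)). \<exists>n\<in>N. qchain (rep c) n (cls \<psi>) q}.
        h (moebius (qposet (rep c)) (cls \<psi>) q))"
proof -
  define Y where "Y = rep c"
  have Y: "iso_class C Y \<in> L" "Y \<in> Obj C" using level_repD c by (auto simp: Y_def)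
  define \<Phi> where "\<Phi> \<psi> q = (if \<exists>n\<in>N. qchain Y n (cls \<psi>) q then h (moebius (qposet Y) (cls \<psi>) q) else 0)" for \<psi> q
  define S where "S = (SIGMA p:Over_rank N X. Epi C Y (rep (fst p)))"
  define T where "T = (SIGMA \<psi>:Epi C Y X. {r \<in> Quot Y. \<exists>n\<in>N. qchain Y n (cls \<psi>) (cls (snd r))})"
  define m :: "('a set \<times> 'b) \<times> 'b \<Rightarrow> 'b \<times> 'a set \<times> 'b"
    where "m = (\<lambda>x. (snd (fst x) \<cdot> snd x, (fst (fst x), snd x)))"
  interpret Y: finite_modular_lattice "qposet Y" "cls (idt Y)" by (rule finite_modular_lattice_qposet[OF Y(2)])
  have chain_eq: "qchain Y n (cls (\<pi> \<cdot> \<eta>)) (cls \<eta>) \<longleftrightarrow> qchain (rep G) n (cls \<pi>) (cls (idt (rep G)))"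
    if "\<eta> \<in> Epi C Y (rep G)" "\<pi> \<in> Epi C (rep G) X" for \<eta> \<pi> G n
    using qchain_along[OF that(1), of "cls \<pi>" "cls (idt (rep G))" n] along_cls[OF that] along_Ident[OF that(1)]
      cls_carrier[OF that(2)] cls_carrier[OF Ident_Epi] EpiD(3)[OF that(2)] by simp
  have bij: "bij_betw m S T"
    unfolding bij_betw_def
  proof
    show "inj_on m S"
    proof (rule inj_onI)
      fix x y assume x: "x \<in> S" and y: "y \<in> S" and eq: "m x = m y"
      obtain G \<pi> \<eta> where [simp]: "x = ((G, \<pi>), \<eta>)" by (metis surj_pair)
      obtain G' \<pi>' \<eta>' where [simp]: "y = ((G', \<pi>'), \<eta>')" by (metis surj_pair)
      have e: "G' = G" "\<eta>' = \<eta>" "\<pi> \<cdot> \<eta> = \<pi>' \<cdot> \<eta>" using eq by (auto simp: m_def)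
      have "\<eta> \<in> Epi C Y (rep G)" "\<pi> \<in> Epi C (rep G) X" "\<pi>' \<in> Epi C (rep G) X"
        using x y e by (auto simp: S_def Over_rank_def Over_def)
      then have "\<pi> = \<pi>'" using Epi_cancel[of \<eta> Y "rep G" \<pi> X \<pi>'] Epi_Hom e by blast
      then show "x = y" using e by simp
    qed
    show "m ` S = T"
    proof (intro Set.set_eqI iffI)
      fix z assume "z \<in> m ` S"
      then obtain G \<pi> \<eta> n where z: "z = (\<pi> \<cdot> \<eta>, (G, \<eta>))" and
        e: "G \<in> L" "\<pi> \<in> Epi C (rep G) X" "\<eta> \<in> Epi C Y (rep G)" "n \<in> N"
          "qchain (rep G) n (cls \<pi>) (cls (idt (rep G)))"
        by (auto simp: S_def m_def Over_rank_def Over_def)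
      have "qchain Y n (cls (\<pi> \<cdot> \<eta>)) (cls \<eta>)" using chain_eq[OF e(3,2)] e(5) by simp
      then show "z \<in> T" using e Epi_comp[OF e(3,2)] by (auto simp: z T_def Quot_def)
    next
      fix z assume "z \<in> T"
      then obtain \<psi> G \<eta> n where z: "z = (\<psi>, (G, \<eta>))" and
        e: "\<psi> \<in> Epi C Y X" "G \<in> L" "\<eta> \<in> Epi C Y (rep G)" "n \<in> N" "qchain Y n (cls \<psi>) (cls \<eta>)"
        by (auto simp: T_def Quot_def)
      have "cls \<psi> \<sqsubseteq>\<^bsub>qposet Y\<^esub> cls \<eta>" using Y.chainD(3) e(5) by (simp add: qchain_def)
      then obtain \<pi> where \<pi>: "\<pi> \<in> Epi C (rep G) X" "\<psi> = \<pi> \<cdot> \<eta>" using cls_le_iff[OF e(1,3)] by blast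
      have "qchain (rep G) n (cls \<pi>) (cls (idt (rep G)))" using chain_eq[OF e(3) \<pi>(1)] e(5) \<pi>(2) by simp
      then have "((G, \<pi>), \<eta>) \<in> S" using e \<pi> by (auto simp: S_def Over_rank_def Over_def)
      moreover have "z = m ((G, \<pi>), \<eta>)" by (simp add: z m_def \<pi>(2))
      ultimately show "z \<in> m ` S" by blast
    qed
  qed
  have finE: "finite (Epi C Y X)" and finQ: "finite (Quot Y)" using finite_Epi finite_Quot[OF Y] by auto
  have finT: "finite T" unfolding T_def using finE finQ by (intro finite_SigmaI) auto
  then have finS: "finite S" using bij bij_betw_finite by blast

  have "(\<Sum>p\<in>Over_rank N X. h (mu C (snd p)) / aut (fst p) * real (card (Epi C Y (rep (fst p)))))
      = (\<Sum>p\<in>Over_rank N X. \<Sum>\<eta>\<in>Epi C Y (rep (fst p)). h (mu C (snd p)) / aut (fst p))"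
    by (simp add: mult.commute)
  also have "\<dots> = (\<Sum>x\<in>S. h (mu C (snd (fst x))) / aut (fst (fst x)))"
    unfolding S_def by (subst sum.Sigma) (auto simp: finite_Over_rank X N finite_Epi split_beta)
  also have "\<dots> = (\<Sum>x\<in>S. \<Phi> (fst (m x)) (cls (snd (snd (m x)))) / aut (fst (snd (m x))))"
  proof (rule sum.cong[OF refl])
    fix x assume x: "x \<in> S"
    then obtain G \<pi> \<eta> n where [simp]: "x = ((G, \<pi>), \<eta>)" and
      e: "\<pi> \<in> Epi C (rep G) X" "\<eta> \<in> Epi C Y (rep G)" "n \<in> N" "qchain (rep G) n (cls \<pi>) (cls (idt (rep G)))"
      by (auto simp: S_def Over_rank_def Over_def)
    have "\<Phi> (\<pi> \<cdot> \<eta>) (cls \<eta>) = h (mu C \<pi>)"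
      using chain_eq[OF e(2,1)] e(3,4) mu_along[OF e(2,1)] by (auto simp: \<Phi>_def)
    then show "h (mu C (snd (fst x))) / aut (fst (fst x))
        = \<Phi> (fst (m x)) (cls (snd (snd (m x)))) / aut (fst (snd (m x)))" by (simp add: m_def)
  qed
  also have "\<dots> = (\<Sum>y\<in>T. \<Phi> (fst y) (cls (snd (snd y))) / aut (fst (snd y)))"
    by (rule sum.reindex_bij_betw[OF bij])
  also have "\<dots> = (\<Sum>\<psi>\<in>Epi C Y X. \<Sum>r\<in>{r \<in> Quot Y. \<exists>n\<in>N. qchain Y n (cls \<psi>) (cls (snd r))}. \<Phi> \<psi> (cls (snd r)) / aut (fst r))"
    unfolding T_def using finE finQ by (subst sum.Sigma) (auto simp: split_beta)
  also have "\<dots> = (\<Sum>\<psi>\<in>Epi C Y X. \<Sum>(F, \<phi>)\<in>Quot Y. \<Phi> \<psi> (cls \<phi>) / aut F)"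
  proof (rule sum.cong[OF refl])
    fix \<psi>
    show "(\<Sum>r\<in>{r \<in> Quot Y. \<exists>n\<in>N. qchain Y n (cls \<psi>) (cls (snd r))}. \<Phi> \<psi> (cls (snd r)) / aut (fst r))
        = (\<Sum>(F, \<phi>)\<in>Quot Y. \<Phi> \<psi> (cls \<phi>) / aut F)"
      by (rule sum.mono_neutral_cong_left[OF finQ]) (auto simp: \<Phi>_def split: if_splits)
  qed
  also have "\<dots> = (\<Sum>\<psi>\<in>Epi C Y X. \<Sum>q\<in>carrier (qposet Y). \<Phi> \<psi> q)"
    by (simp add: sum_Quot[OF Y])
  also have "\<dots> = (\<Sum>\<psi>\<in>Epi C Y X. \<Sum>q\<in>{q \<in> carrier (qposet Y). \<exists>n\<in>N. qchain Y n (cls \<psi>) q}. h (moebius (qposet Y) (cls \<psi>) q))"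
    using finite_quotients[OF Y(2)] by (simp add: \<Phi>_def sum.inter_filter)
  finally show ?thesis by (simp add: Y_def)
qed

text \<open>\<open>truncated_moebius_sum\<close> is applied to each epimorphism
  \<open>\<psi>\<close> from \<open>rep c\<close> to \<open>rep F\<close> separately. The indicator
  terms count the isomorphisms, which number \<open>aut F\<close> or 0.\<close>

lemma truncated_inversion:
  assumes c: "c \<in> L" and F: "F \<in> L"
  shows "\<bar>(\<Sum>p\<in>Over_rank {..r} (rep F). real_of_int (mu C (snd p)) / aut (fst p) * real (card (Epi C (rep c) (rep (fst p)))))
      - (if c = F then aut F else 0)\<bar>
    \<le> (\<Sum>p\<in>Over_rank {Suc r} (rep F). \<bar>real_of_int (mu C (snd p))\<bar> / aut (fst p) * real (card (Epi C (rep c) (rep (fst p)))))"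
proof -
  define Y X where "Y = rep c" and "X = rep F"
  have Y: "iso_class C Y = c" "Y \<in> Obj C" and X: "iso_class C X = F" "X \<in> Obj C"
    using level_repD c F by (auto simp: Y_def X_def)
  interpret Y: finite_modular_lattice "qposet Y" "cls (idt Y)" by (rule finite_modular_lattice_qposet[OF Y(2)])
  have "(\<Sum>\<psi>\<in>Epi C Y X. if cls \<psi> = cls (idt Y) then 1 else 0) = real (card (Iso C Y X))"
  proof -
    have "{\<psi> \<in> Epi C Y X. cls \<psi> = cls (idt Y)} = Iso C Y X"
      using cls_Ident_eq_iff[of _ Y X] Iso_Epi[of _ Y X] by blast
    then show ?thesis using finite_Epi by (simp add: sum.If_cases Int_def)
  qed
  also have "\<dots> = (if c = F then aut F else 0)"
  proof (cases "c = F")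
    case True
    then show ?thesis by (simp add: aut_def Aut_def X_def Y_def)
  next
    case False
    then have "Iso C Y X = {}" using iso_class_eq_iff[OF Y(2) X(2)] Y(1) X(1) by simp
    then show ?thesis using False by simp
  qed
  finally have iso: "(\<Sum>\<psi>\<in>Epi C Y X. if cls \<psi> = cls (idt Y) then 1 else 0) = (if c = F then aut F else 0)" .
  have mem: "q \<in> carrier (qposet Y)" if "qchain Y n b q" for n b q
    using Y.chainD(2) that unfolding qchain_def by blast
  have set1: "{q \<in> carrier (qposet Y). \<exists>n\<in>{..r}. qchain Y n b q} = {x. \<exists>j\<le>r. Y.chain j b x}" for b
    using mem unfolding qchain_def by auto
  have set2: "{q \<in> carrier (qposet Y). \<exists>n\<in>{Suc r}. qchain Y n b q} = {x. Y.chain (Suc r) b x}" for b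
    using mem unfolding qchain_def by blast
  have "(\<Sum>p\<in>Over_rank {..r} X. real_of_int (mu C (snd p)) / aut (fst p) * real (card (Epi C Y (rep (fst p)))))
      = (\<Sum>\<psi>\<in>Epi C Y X. \<Sum>q\<in>{x. \<exists>j\<le>r. Y.chain j (cls \<psi>) x}. real_of_int (moebius (qposet Y) (cls \<psi>) q))"
    using sum_Over_rank[OF c X(2), of "{..r}" real_of_int] F X(1) unfolding Y_def[symmetric] set1 by simp
  then have "\<bar>(\<Sum>p\<in>Over_rank {..r} X. real_of_int (mu C (snd p)) / aut (fst p) * real (card (Epi C Y (rep (fst p)))))
      - (if c = F then aut F else 0)\<bar>
    = \<bar>\<Sum>\<psi>\<in>Epi C Y X. (\<Sum>q\<in>{x. \<exists>j\<le>r. Y.chain j (cls \<psi>) x}. real_of_int (moebius (qposet Y) (cls \<psi>) q))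
        - (if cls \<psi> = cls (idt Y) then 1 else 0)\<bar>"
    unfolding iso[symmetric] by (simp add: sum_subtractf)
  also have "\<dots> \<le> (\<Sum>\<psi>\<in>Epi C Y X. \<Sum>q\<in>{x. Y.chain (Suc r) (cls \<psi>) x}. \<bar>real_of_int (moebius (qposet Y) (cls \<psi>) q)\<bar>)"
  proof (intro order_trans[OF sum_abs] sum_mono)
    fix \<psi> assume "\<psi> \<in> Epi C Y X"
    then have "\<bar>(\<Sum>x\<in>{x. \<exists>j\<le>r. Y.chain j (cls \<psi>) x}. moebius (qposet Y) (cls \<psi>) x) - (if cls \<psi> = cls (idt Y) then 1 else 0)\<bar>
        \<le> (\<Sum>x\<in>{x. Y.chain (Suc r) (cls \<psi>) x}. \<bar>moebius (qposet Y) (cls \<psi>) x\<bar>)"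
      by (intro Y.truncated_moebius_sum cls_carrier)
    then have "real_of_int \<bar>(\<Sum>x\<in>{x. \<exists>j\<le>r. Y.chain j (cls \<psi>) x}. moebius (qposet Y) (cls \<psi>) x) - (if cls \<psi> = cls (idt Y) then 1 else 0)\<bar>
        \<le> real_of_int (\<Sum>x\<in>{x. Y.chain (Suc r) (cls \<psi>) x}. \<bar>moebius (qposet Y) (cls \<psi>) x\<bar>)"
      by (simp only: of_int_le_iff)
    then show "\<bar>(\<Sum>q\<in>{x. \<exists>j\<le>r. Y.chain j (cls \<psi>) x}. real_of_int (moebius (qposet Y) (cls \<psi>) q))
          - (if cls \<psi> = cls (idt Y) then 1 else 0)\<bar>
        \<le> (\<Sum>q\<in>{x. Y.chain (Suc r) (cls \<psi>) x}. \<bar>real_of_int (moebius (qposet Y) (cls \<psi>) q)\<bar>)"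
      by (simp only: of_int_abs of_int_diff of_int_sum if_distrib[of real_of_int] of_int_0 of_int_1)
  qed
  also have "\<dots> = (\<Sum>p\<in>Over_rank {Suc r} X. \<bar>real_of_int (mu C (snd p))\<bar> / aut (fst p) * real (card (Epi C Y (rep (fst p)))))"
    using sum_Over_rank[OF c X(2), of "{Suc r}" "\<lambda>x. \<bar>real_of_int x\<bar>"] F X(1)
    unfolding Y_def[symmetric] set2 by (simp del: Y.chain.simps)
  finally show ?thesis unfolding Y_def X_def .
qed

lemma Over_rank_disjoint: "Over_rank {..r} X \<inter> Over_rank {Suc r} X = {}"
proof -
  have False if "(H, \<pi>) \<in> Over X" "qchain (rep H) n (cls \<pi>) (cls (idt (rep H)))" "n \<le> r"
    "qchain (rep H) (Suc r) (cls \<pi>) (cls (idt (rep H)))" for H \<pi> n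
  proof -
    interpret finite_modular_lattice "qposet (rep H)" "cls (idt (rep H))"
      by (rule finite_modular_lattice_qposet) (use that(1) level_repD in \<open>auto simp: Over_def\<close>)
    show False using chain_unique[of n "cls \<pi>" _ "Suc r"] that by (auto simp: qchain_def simp del: chain.simps)
  qed
  then show ?thesis unfolding Over_rank_def by blast
qed

end

section \<open>Absolute convergence for well-behaved tuples\<close>

locale well_behaved_level = diamond_level C L for C :: "('a, 'b) category" and L +
  fixes M :: "'a set \<Rightarrow> real"
  assumes well_behaved: "well_behaved C L M"
begin

definition summand :: "'a set \<times> 'b \<Rightarrow> real" where
  "summand p = real_of_int (mu C (snd p)) / aut (fst p) * M (fst p)"

definition bound :: "'a set \<times> 'b \<Rightarrow> real" where
  "bound p = \<bar>real_of_int (mu C (snd p))\<bar> / aut (fst p) * real (Z_count C (snd p)) ^ 3 * \<bar>M (fst p)\<bar>"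

text \<open>The terms are nonnegative and the inner sums finite, so the iterated sum in
  \<open>well_behaved\<close> and the sum over pairs converge together.\<close>

lemma summable_bound:
  assumes "F \<in> L"
  shows "bound summable_on Over (rep F)"
  unfolding Over_def
proof (rule summable_on_SigmaI)
  show "((\<lambda>\<pi>. bound (G, \<pi>)) has_sum (\<Sum>\<pi>\<in>Epi C (rep G) (rep F). bound (G, \<pi>))) (Epi C (rep G) (rep F))" for G
    by (rule has_sum_finite[OF finite_Epi])
  show "(\<lambda>G. \<Sum>\<pi>\<in>Epi C (rep G) (rep F). bound (G, \<pi>)) summable_on L"
    using well_behaved assms by (simp add: well_behaved_def bound_def aut_def)
qed (simp add: bound_def aut_def)

lemma Z_count_pos: "\<pi> \<in> Epi C G F \<Longrightarrow> Z_count C \<pi> \<ge> 1"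
  using finite_modular_lattice.card_distributive_pos[OF finite_modular_lattice_qposet cls_carrier]
    Z_count_eq EpiD(3) by metis

lemma abs_summand_le:
  assumes "p \<in> Over X"
  shows "\<bar>summand p\<bar> \<le> bound p"
proof -
  have "(1 :: real) \<le> real (Z_count C (snd p)) ^ 3"
    using Z_count_pos[of "snd p"] assms by (auto simp: Over_def intro!: one_le_power)
  moreover have "aut (fst p) > 0" using assms aut_pos by (auto simp: Over_def)
  ultimately have "\<bar>real_of_int (mu C (snd p))\<bar> / aut (fst p) * 1 * \<bar>M (fst p)\<bar> \<le> bound p"
    unfolding bound_def by (intro mult_right_mono mult_left_mono) auto
  moreover have "\<bar>summand p\<bar> = \<bar>real_of_int (mu C (snd p))\<bar> / aut (fst p) * 1 * \<bar>M (fst p)\<bar>"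
    using \<open>aut (fst p) > 0\<close> by (simp add: summand_def abs_mult)
  ultimately show ?thesis by simp
qed

lemma abs_summable_summand:
  assumes "F \<in> L"
  shows "(\<lambda>p. \<bar>summand p\<bar>) summable_on Over (rep F)"
  using Infinite_Sum.abs_summable_on_comparison_test'[OF summable_bound[OF assms], of summand] abs_summand_le by simp

lemma summable_summand: "F \<in> L \<Longrightarrow> summand summable_on Over (rep F)"
  using abs_summable_summand abs_summable_summable[of summand] by simp

text \<open>Fubini over the finite sets of epimorphisms; the factor \<open>aut F\<close> appears
  because \<open>mu_hat\<close> counts orbits.\<close>

lemma v_coeff_eq:
  assumes F: "F \<in> L"
  shows "infsum summand (Over (rep F)) = aut F * v_coeff C L M F"
proof -
  have "infsum summand (Over (rep F)) = (\<Sum>\<^sub>\<infinity>G\<in>L. \<Sum>\<^sub>\<infinity>\<pi>\<in>Epi C (rep G) (rep F). summand (G, \<pi>))"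
    unfolding Over_def by (rule infsum_Sigma_banach[symmetric]) (use summable_summand[OF F] in \<open>simp add: Over_def\<close>)
  also have "\<dots> = (\<Sum>\<^sub>\<infinity>G\<in>L. aut F * (real_of_int (mu_hat C (rep F) (rep G)) / aut G * M G))"
  proof (rule infsum_cong)
    fix G assume G: "G \<in> L"
    have "(\<Sum>\<^sub>\<infinity>\<pi>\<in>Epi C (rep G) (rep F). summand (G, \<pi>)) = (\<Sum>\<pi>\<in>Epi C (rep G) (rep F). real_of_int (mu C \<pi>)) / aut G * M G"
      by (simp add: finite_Epi summand_def sum_distrib_right sum_divide_distrib)
    then show "(\<Sum>\<^sub>\<infinity>\<pi>\<in>Epi C (rep G) (rep F). summand (G, \<pi>)) = aut F * (real_of_int (mu_hat C (rep F) (rep G)) / aut G * M G)"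
      using mu_hat_eq[of "rep G" "rep F"] level_repD G F by (simp add: aut_def)
  qed
  also have "\<dots> = aut F * (\<Sum>\<^sub>\<infinity>G\<in>L. real_of_int (mu_hat C (rep F) (rep G)) / aut G * M G)"
    by (rule infsum_cmult_right')
  finally show ?thesis by (simp add: v_coeff_def aut_def)
qed

text \<open>The finite sets \<open>Over_rank {..r}\<close> exhaust \<open>Over\<close>. One and the
  same \<open>r\<close> must also make rank \<open>Suc r\<close> small, because that rank is the
  error term of \<open>truncated_inversion\<close>.\<close>

lemma summand_approximation:
  assumes F: "F \<in> L" and "\<epsilon> > 0"
  obtains r where "\<bar>(\<Sum>p\<in>Over_rank {..r} (rep F). summand p) - aut F * v_coeff C L M F\<bar> < \<epsilon>"
    and "(\<Sum>p\<in>Over_rank {Suc r} (rep F). \<bar>summand p\<bar>) < \<epsilon>"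
proof -
  let ?I = "Over (rep F)"
  have fin: "finite (Over_rank N (rep F))" if "finite N" for N
    using finite_Over_rank[of "rep F" N] level_repD[OF F] F that by simp
  have s1: "(sum summand \<longlongrightarrow> aut F * v_coeff C L M F) (finite_subsets_at_top ?I)"
    using has_sum_infsum[OF summable_summand[OF F]] v_coeff_eq[OF F] by (simp add: has_sum_def)
  define S where "S = infsum (\<lambda>p. \<bar>summand p\<bar>) ?I"
  have s2: "(sum (\<lambda>p. \<bar>summand p\<bar>) \<longlongrightarrow> S) (finite_subsets_at_top ?I)"
    using has_sum_infsum[OF abs_summable_summand[OF F]] by (simp add: has_sum_def S_def)
  have "\<forall>\<^sub>F Y in finite_subsets_at_top ?I. dist (sum summand Y) (aut F * v_coeff C L M F) < \<epsilon>"
    using s1 assms(2) by (rule tendstoD)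
  then obtain A where A: "finite A" "A \<subseteq> ?I"
    "\<And>Y. finite Y \<Longrightarrow> A \<subseteq> Y \<Longrightarrow> Y \<subseteq> ?I \<Longrightarrow> dist (sum summand Y) (aut F * v_coeff C L M F) < \<epsilon>"
    unfolding eventually_finite_subsets_at_top by metis
  have "\<forall>\<^sub>F Y in finite_subsets_at_top ?I. dist (sum (\<lambda>p. \<bar>summand p\<bar>) Y) S < \<epsilon> / 2"
    using s2 assms(2) by (intro tendstoD) auto
  then obtain B where B: "finite B" "B \<subseteq> ?I"
    "\<And>Y. finite Y \<Longrightarrow> B \<subseteq> Y \<Longrightarrow> Y \<subseteq> ?I \<Longrightarrow> dist (sum (\<lambda>p. \<bar>summand p\<bar>) Y) S < \<epsilon> / 2"
    unfolding eventually_finite_subsets_at_top by metis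
  have "\<forall>p\<in>A \<union> B. \<exists>n. qchain (rep (fst p)) n (cls (snd p)) (cls (idt (rep (fst p))))"
    using A(2) B(2) ex_rank by (metis Un_iff prod.collapse subsetD)
  then obtain n where n: "\<And>p. p \<in> A \<union> B \<Longrightarrow> qchain (rep (fst p)) (n p) (cls (snd p)) (cls (idt (rep (fst p))))"
    by metis
  define r where "r = Max (insert 0 (n ` (A \<union> B)))"
  have "n p \<le> r" if "p \<in> A \<union> B" for p
    unfolding r_def using A(1) B(1) that by (intro Max_ge) auto
  then have sub: "A \<union> B \<subseteq> Over_rank {..r} (rep F)"
    using n A(2) B(2) unfolding Over_rank_def by fastforce
  have I: "Over_rank N (rep F) \<subseteq> ?I" for N by (auto simp: Over_rank_def)
  have "dist (sum summand (Over_rank {..r} (rep F))) (aut F * v_coeff C L M F) < \<epsilon>"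
    using sub by (intro A(3) fin I) auto
  moreover have "dist (sum (\<lambda>p. \<bar>summand p\<bar>) (Over_rank {..r} (rep F))) S < \<epsilon> / 2"
    using sub by (intro B(3) fin I) auto
  \<comment> \<open>The absolute sums up to rank \<open>r\<close> and up to rank
    \<open>Suc r\<close> are both within \<open>\<epsilon> / 2\<close> of \<open>S\<close>, so rank
    \<open>Suc r\<close> alone contributes less than \<open>\<epsilon>\<close>.\<close>
  moreover have "dist (sum (\<lambda>p. \<bar>summand p\<bar>) (Over_rank {..r} (rep F) \<union> Over_rank {Suc r} (rep F))) S < \<epsilon> / 2"
    using sub I by (intro B(3)) (auto simp: fin)
  moreover have "sum (\<lambda>p. \<bar>summand p\<bar>) (Over_rank {..r} (rep F) \<union> Over_rank {Suc r} (rep F))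
      = sum (\<lambda>p. \<bar>summand p\<bar>) (Over_rank {..r} (rep F)) + sum (\<lambda>p. \<bar>summand p\<bar>) (Over_rank {Suc r} (rep F))"
    using Over_rank_disjoint by (intro sum.union_disjoint fin) auto
  ultimately show ?thesis unfolding dist_real_def by (intro that[of r]) linarith+
qed

section \<open>Integration against measures on the level, and robustness\<close>

lemma integrable_card_Epi:
  assumes \<nu>: "discrete_measure_on L \<nu>" and fin: "moment C \<nu> G \<noteq> \<infinity>"
  shows "integrable \<nu> (\<lambda>H. real (card (Epi C (rep H) (rep G))))"
    and "(\<integral>H. real (card (Epi C (rep H) (rep G))) \<partial>\<nu>) = real_of_ereal (moment C \<nu> G)"
proof -
  have meas: "f \<in> borel_measurable \<nu>" for f :: "'a set \<Rightarrow> real"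
    using \<nu> by (intro measurableI) (auto simp: discrete_measure_on_def)
  have eq: "(\<integral>\<^sup>+H. ennreal (real (card (Epi C (rep H) (rep G)))) \<partial>\<nu>) = (\<integral>\<^sup>+H. of_nat (card (Epi C (rep H) (rep G))) \<partial>\<nu>)"
    by (simp add: ennreal_of_nat_eq_real_of_nat)
  have "(\<integral>\<^sup>+H. of_nat (card (Epi C (rep H) (rep G))) \<partial>\<nu>) \<noteq> \<infinity>"
    using fin by (auto simp: moment_def)
  then show "integrable \<nu> (\<lambda>H. real (card (Epi C (rep H) (rep G))))"
    unfolding eq[symmetric] by (intro integrableI_nonneg meas) (auto simp: less_top)
  show "(\<integral>H. real (card (Epi C (rep H) (rep G))) \<partial>\<nu>) = real_of_ereal (moment C \<nu> G)"
    using integral_eq_nn_integral[OF meas, of "\<lambda>H. real (card (Epi C (rep H) (rep G)))"]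
    unfolding eq moment_def enn2real_def by simp
qed

text \<open>The identity is an epimorphism, so the integrand of the \<open>F\<close>-moment is at
  least 1 at \<open>F\<close>.\<close>

lemma emeasure_singleton_finite:
  assumes \<nu>: "discrete_measure_on L \<nu>" and fin: "moment C \<nu> F \<noteq> \<infinity>" and F: "F \<in> L"
  shows "emeasure \<nu> {F} < \<infinity>"
proof -
  have "card (Epi C (rep F) (rep F)) \<ge> 1"
    using Ident_Epi[of "rep F"] level_repD[OF F] finite_Epi by (simp add: Suc_le_eq card_gt_0_iff) blast
  then have *: "(1 :: ennreal) \<le> of_nat (card (Epi C (rep F) (rep F)))"
    by (metis of_nat_1 of_nat_mono)
  have "emeasure \<nu> {F} = (\<integral>\<^sup>+H. indicator {F} H \<partial>\<nu>)"
    using \<nu> F by (subst nn_integral_indicator) (auto simp: discrete_measure_on_def)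
  also have "\<dots> \<le> (\<integral>\<^sup>+H. of_nat (card (Epi C (rep H) (rep F))) \<partial>\<nu>)"
    using * by (intro nn_integral_mono) (auto simp: indicator_def)
  also have "\<dots> < \<infinity>" using fin by (auto simp: moment_def less_top)
  finally show ?thesis .
qed

text \<open>Integrating the Bonferroni-type inequality only involves finitely many moments, so it survives
  the passage to the limit.\<close>

lemma integrated_truncated_inversion:
  assumes \<nu>: "discrete_measure_on L \<nu>" and F: "F \<in> L"
    and fin: "\<And>p. p \<in> Over_rank {..Suc r} (rep F) \<Longrightarrow> moment C \<nu> (fst p) \<noteq> \<infinity>" "moment C \<nu> F \<noteq> \<infinity>"
  shows "\<bar>(\<Sum>p\<in>Over_rank {..r} (rep F). real_of_int (mu C (snd p)) / aut (fst p) * real_of_ereal (moment C \<nu> (fst p)))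
      - aut F * measure \<nu> {F}\<bar>
    \<le> (\<Sum>p\<in>Over_rank {Suc r} (rep F). \<bar>real_of_int (mu C (snd p))\<bar> / aut (fst p) * real_of_ereal (moment C \<nu> (fst p)))"
proof -
  let ?e = "\<lambda>H G. real (card (Epi C (rep H) (rep G)))"
  define A where "A H = (\<Sum>p\<in>Over_rank {..r} (rep F). real_of_int (mu C (snd p)) / aut (fst p) * ?e H (fst p))
    - aut F * indicator {F} H" for H
  define B where "B H = (\<Sum>p\<in>Over_rank {Suc r} (rep F). \<bar>real_of_int (mu C (snd p))\<bar> / aut (fst p) * ?e H (fst p))" for H
  have sub: "Over_rank {..r} (rep F) \<subseteq> Over_rank {..Suc r} (rep F)" "Over_rank {Suc r} (rep F) \<subseteq> Over_rank {..Suc r} (rep F)"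
    by (auto simp: Over_rank_def intro: le_SucI)
  have int: "integrable \<nu> (\<lambda>H. ?e H (fst p))" "(\<integral>H. ?e H (fst p) \<partial>\<nu>) = real_of_ereal (moment C \<nu> (fst p))"
    if "p \<in> Over_rank {..r} (rep F) \<or> p \<in> Over_rank {Suc r} (rep F)" for p
    using integrable_card_Epi[OF \<nu> fin(1)[of p]] sub that by blast+
  have intF: "integrable \<nu> (indicator {F} :: 'a set \<Rightarrow> real)"
    using emeasure_singleton_finite[OF \<nu> fin(2) F] \<nu> F
    by (intro integrable_real_indicator) (auto simp: discrete_measure_on_def)
  have mF: "(\<integral>H. indicator {F} H \<partial>\<nu>) = measure \<nu> {F}"
    using \<nu> F by (simp add: discrete_measure_on_def)
  have intA: "integrable \<nu> A"
    unfolding A_def using int intF by (intro Bochner_Integration.integrable_diff Bochner_Integration.integrable_sum integrable_mult_right) auto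
  have intB: "integrable \<nu> B"
    unfolding B_def using int by (intro Bochner_Integration.integrable_sum integrable_mult_right) auto
  have "\<bar>\<integral>H. A H \<partial>\<nu>\<bar> \<le> (\<integral>H. \<bar>A H\<bar> \<partial>\<nu>)" by (rule integral_abs_bound)
  also have "\<dots> \<le> (\<integral>H. B H \<partial>\<nu>)"
  proof (rule integral_mono)
    fix H assume "H \<in> space \<nu>"
    then have "H \<in> L" using \<nu> by (simp add: discrete_measure_on_def)
    moreover have "aut F * indicator {F} H = (if H = F then aut F else 0)" by simp
    ultimately show "\<bar>A H\<bar> \<le> B H" using truncated_inversion[OF _ F, of H r] unfolding A_def B_def by simp
  qed (use intA intB in auto)
  also have "(\<integral>H. A H \<partial>\<nu>) = (\<Sum>p\<in>Over_rank {..r} (rep F). real_of_int (mu C (snd p)) / aut (fst p) * real_of_ereal (moment C \<nu> (fst p)))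
      - aut F * measure \<nu> {F}"
  proof -
    have "(\<integral>H. A H \<partial>\<nu>) = (\<integral>H. (\<Sum>p\<in>Over_rank {..r} (rep F). real_of_int (mu C (snd p)) / aut (fst p) * ?e H (fst p)) \<partial>\<nu>)
        - (\<integral>H. aut F * indicator {F} H \<partial>\<nu>)"
      unfolding A_def using int intF
      by (intro Bochner_Integration.integral_diff Bochner_Integration.integrable_sum integrable_mult_right) auto
    also have "(\<integral>H. aut F * indicator {F} H \<partial>\<nu>) = aut F * measure \<nu> {F}" using mF by simp
    also have "(\<integral>H. (\<Sum>p\<in>Over_rank {..r} (rep F). real_of_int (mu C (snd p)) / aut (fst p) * ?e H (fst p)) \<partial>\<nu>)
        = (\<Sum>p\<in>Over_rank {..r} (rep F). \<integral>H. real_of_int (mu C (snd p)) / aut (fst p) * ?e H (fst p) \<partial>\<nu>)"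
      using int by (intro Bochner_Integration.integral_sum integrable_mult_right) auto
    also have "\<dots> = (\<Sum>p\<in>Over_rank {..r} (rep F). real_of_int (mu C (snd p)) / aut (fst p) * real_of_ereal (moment C \<nu> (fst p)))"
      using int(2) by (intro sum.cong refl) simp
    finally show ?thesis .
  qed
  also have "(\<integral>H. B H \<partial>\<nu>) = (\<Sum>p\<in>Over_rank {Suc r} (rep F). \<bar>real_of_int (mu C (snd p))\<bar> / aut (fst p) * real_of_ereal (moment C \<nu> (fst p)))"
  proof -
    have "(\<integral>H. B H \<partial>\<nu>) = (\<Sum>p\<in>Over_rank {Suc r} (rep F). \<integral>H. \<bar>real_of_int (mu C (snd p))\<bar> / aut (fst p) * ?e H (fst p) \<partial>\<nu>)"
      unfolding B_def using int by (intro Bochner_Integration.integral_sum integrable_mult_right) auto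
    also have "\<dots> = (\<Sum>p\<in>Over_rank {Suc r} (rep F). \<bar>real_of_int (mu C (snd p))\<bar> / aut (fst p) * real_of_ereal (moment C \<nu> (fst p)))"
      using int(2) by (intro sum.cong refl) simp
    finally show ?thesis .
  qed
  finally show ?thesis .
qed

text \<open>The rank \<open>r\<close> is fixed before \<open>t\<close> grows. Then three errors
  below \<open>e / 4\<close> remain: from truncating the series, from the finitely many moments in
  \<open>A\<close>, and from the bound \<open>B\<close>.\<close>

lemma robustness:
  assumes \<nu>: "\<And>t. discrete_measure_on L (\<nu> t)"
    and lim: "\<And>G. G \<in> L \<Longrightarrow> (\<lambda>t :: nat. moment C (\<nu> t) G) \<longlonglongrightarrow> ereal (M G)"
    and F: "F \<in> L"
  shows "(\<lambda>t. enn2ereal (emeasure (\<nu> t) {F})) \<longlonglongrightarrow> ereal (v_coeff C L M F)"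
proof -
  \<comment> \<open>\<open>real_of_ereal\<close> sends infinity to 0, so the integrated inequality
    is invoked only at those \<open>t\<close> where the moments involved are finite; a finite limit
    guarantees this eventually.\<close>
  have ev_fin: "\<forall>\<^sub>F t in sequentially. moment C (\<nu> t) G \<noteq> \<infinity>" if "G \<in> L" for G
    using order_tendstoD(2)[OF lim[OF that], of \<infinity>] by (auto elim: eventually_mono)
  have mlim: "(\<lambda>t. real_of_ereal (moment C (\<nu> t) G)) \<longlonglongrightarrow> M G" if "G \<in> L" for G
    using lim_real_of_ereal[OF lim[OF that]] .
  have OL: "fst p \<in> L" if "p \<in> Over_rank N (rep F)" for p N
    using that by (auto simp: Over_rank_def Over_def)
  have "(\<lambda>t. aut F * measure (\<nu> t) {F}) \<longlonglongrightarrow> aut F * v_coeff C L M F"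
  proof (rule tendstoI)
    fix e :: real assume "e > 0"
    then have "e / 4 > 0" by simp
    from summand_approximation[OF F this] obtain r where
      r: "\<bar>(\<Sum>p\<in>Over_rank {..r} (rep F). summand p) - aut F * v_coeff C L M F\<bar> < e / 4"
        "(\<Sum>p\<in>Over_rank {Suc r} (rep F). \<bar>summand p\<bar>) < e / 4" .
    define A where "A t = (\<Sum>p\<in>Over_rank {..r} (rep F). real_of_int (mu C (snd p)) / aut (fst p) * real_of_ereal (moment C (\<nu> t) (fst p)))" for t
    define B where "B t = (\<Sum>p\<in>Over_rank {Suc r} (rep F). \<bar>real_of_int (mu C (snd p))\<bar> / aut (fst p) * real_of_ereal (moment C (\<nu> t) (fst p)))" for t
    have "A \<longlonglongrightarrow> (\<Sum>p\<in>Over_rank {..r} (rep F). summand p)"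
      unfolding A_def summand_def by (intro tendsto_sum tendsto_mult_left mlim OL)
    then have evA: "\<forall>\<^sub>F t in sequentially. dist (A t) (\<Sum>p\<in>Over_rank {..r} (rep F). summand p) < e / 4"
      using \<open>e / 4 > 0\<close> by (rule tendstoD)
    have "B \<longlonglongrightarrow> (\<Sum>p\<in>Over_rank {Suc r} (rep F). \<bar>real_of_int (mu C (snd p))\<bar> / aut (fst p) * M (fst p))"
      unfolding B_def by (intro tendsto_sum tendsto_mult_left mlim OL)
    moreover have "(\<Sum>p\<in>Over_rank {Suc r} (rep F). \<bar>real_of_int (mu C (snd p))\<bar> / aut (fst p) * M (fst p))
        \<le> (\<Sum>p\<in>Over_rank {Suc r} (rep F). \<bar>summand p\<bar>)"
    proof (rule sum_mono)
      fix p assume "p \<in> Over_rank {Suc r} (rep F)"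
      then have "0 < aut (fst p)" using OL aut_pos by blast
      then show "\<bar>real_of_int (mu C (snd p))\<bar> / aut (fst p) * M (fst p) \<le> \<bar>summand p\<bar>"
        by (simp add: summand_def abs_mult divide_right_mono mult_left_mono)
    qed
    then have "(\<Sum>p\<in>Over_rank {Suc r} (rep F). \<bar>real_of_int (mu C (snd p))\<bar> / aut (fst p) * M (fst p)) < e / 4"
      using r(2) by linarith
    ultimately have evB: "\<forall>\<^sub>F t in sequentially. B t < e / 4" by (rule order_tendstoD)
    have "finite (Over_rank {..Suc r} (rep F))"
      using finite_Over_rank[of "rep F" "{..Suc r}"] level_repD[OF F] F by simp
    then have evf: "\<forall>\<^sub>F t in sequentially. \<forall>p\<in>Over_rank {..Suc r} (rep F). moment C (\<nu> t) (fst p) \<noteq> \<infinity>"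
      using ev_fin OL by (intro eventually_ball_finite) auto
    show "\<forall>\<^sub>F t in sequentially. dist (aut F * measure (\<nu> t) {F}) (aut F * v_coeff C L M F) < e"
      using evA evB evf ev_fin[OF F]
    proof eventually_elim
      case (elim t)
      have "\<bar>A t - aut F * measure (\<nu> t) {F}\<bar> \<le> B t"
        unfolding A_def B_def using elim by (intro integrated_truncated_inversion[OF \<nu> F]) auto
      then show ?case 
        using elim(1,2) r(1) \<open>e > 0\<close> unfolding dist_real_def by linarith
    qed
  qed
  then have "(\<lambda>t. (aut F * measure (\<nu> t) {F}) / aut F) \<longlonglongrightarrow> (aut F * v_coeff C L M F) / aut F"
    by (intro tendsto_divide tendsto_const) (use aut_pos[OF F] in auto)
  then have "(\<lambda>t. measure (\<nu> t) {F}) \<longlonglongrightarrow> v_coeff C L M F" using aut_pos[OF F] by simp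
  then have "(\<lambda>t. ereal (measure (\<nu> t) {F})) \<longlonglongrightarrow> ereal (v_coeff C L M F)" by simp
  moreover have "\<forall>\<^sub>F t in sequentially. ereal (measure (\<nu> t) {F}) = enn2ereal (emeasure (\<nu> t) {F})"
    using ev_fin[OF F]
  proof eventually_elim
    case (elim t)
    have "emeasure (\<nu> t) {F} = ennreal (measure (\<nu> t) {F})"
      using emeasure_singleton_finite[OF \<nu> elim F] by (intro emeasure_eq_ennreal_measure) auto
    then show ?case by (simp add: enn2ereal_ennreal)
  qed
  ultimately show ?thesis by (rule Lim_transform_eventually)
qed

end

section \<open>Existence\<close>

context well_behaved_level
begin

definition full_loewy :: "nat \<Rightarrow> 'a \<Rightarrow> 'b \<Rightarrow> bool" where
  "full_loewy i H \<tau> \<longleftrightarrow> qloewy H i (cls \<tau>) (cls (idt H))"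

text \<open>The \<open>i\<close>-th term of the Loewy series over \<open>b\<close>; for
  \<open>i = 1\<close> the ordinary socle.\<close>

definition is_socle :: "nat \<Rightarrow> 'a \<Rightarrow> ('a \<times> 'b) set \<Rightarrow> ('a \<times> 'b) set \<Rightarrow> bool" where
  "is_socle i Y b q \<longleftrightarrow> qloewy Y i b q \<and> (\<forall>y. qloewy Y i b y \<longrightarrow> y \<sqsubseteq>\<^bsub>qposet Y\<^esub> q)"

definition partial_summand :: "nat \<Rightarrow> 'b \<Rightarrow> 'a set \<times> 'b \<Rightarrow> real" where
  "partial_summand i \<rho> p = (if full_loewy i (rep (fst p)) (\<rho> \<cdot> snd p) then summand p else 0)"

text \<open>Formally, for moments of a measure and \<open>p = (F, \<rho>)\<close> over
  \<open>X\<close>, this sums the masses of the objects K times the number of epimorphisms from K to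
  \<open>rep F\<close> that are the \<open>i\<close>-th Loewy term of K over \<open>X\<close>. It
  interpolates between moments at \<open>i = 0\<close> and \<open>aut F * v_coeff\<close> for large
  \<open>i\<close>.\<close>

definition partial_v :: "nat \<Rightarrow> 'a set \<times> 'b \<Rightarrow> real" where
  "partial_v i p = infsum (partial_summand i (snd p)) (Over (rep (fst p)))"

lemma summable_partial_summand:
  assumes "F \<in> L"
  shows "partial_summand i \<rho> summable_on Over (rep F)"
proof -
  have "norm (partial_summand i \<rho> p) \<le> \<bar>summand p\<bar>" for p by (simp add: partial_summand_def)
  then have "(\<lambda>p. norm (partial_summand i \<rho> p)) summable_on Over (rep F)"
    by (intro Infinite_Sum.abs_summable_on_comparison_test'[OF abs_summable_summand[OF assms]])
  then show ?thesis by (rule abs_summable_summable)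
qed

lemma full_loewy_along:
  assumes "\<eta> \<in> Epi C H K" "\<rho> \<in> Epi C K X"
  shows "qloewy H i (cls (\<rho> \<cdot> \<eta>)) (cls \<eta>) \<longleftrightarrow> full_loewy i K \<rho>"
  using qloewy_along[OF assms(1) cls_carrier[OF assms(2)], of "cls (idt K)" i] along_cls[OF assms]
    along_Ident[OF assms(1)] cls_carrier[OF Ident_Epi] EpiD(3)[OF assms(2)] by (simp add: full_loewy_def)

text \<open>A socle condition on the intermediate object \<open>K\<close> becomes a condition on
  \<open>cls \<phi>\<close> in the lattice of \<open>H\<close>, where the layer sums live. The
  length bound for \<open>K\<close> is inherited from \<open>H\<close>.\<close>

lemma is_socle_layer:
  assumes \<phi>: "\<phi> \<in> Epi C H K" and \<theta>: "\<theta> \<in> Epi C K F" and \<rho>: "\<rho> \<in> Epi C F X"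
    and full: "full_loewy i F \<rho>" and fH: "full_loewy (Suc i) H ((\<rho> \<cdot> \<theta>) \<cdot> \<phi>)"
  shows "full_loewy (Suc i) K (\<rho> \<cdot> \<theta>) \<and> is_socle i K (cls (\<rho> \<cdot> \<theta>)) (cls \<theta>) \<longleftrightarrow>
    cls \<phi> \<in> finite_modular_lattice.loewy_layer (qposet H) (cls (idt H)) i (cls (\<rho> \<cdot> (\<theta> \<cdot> \<phi>))) (cls (\<theta> \<cdot> \<phi>))"
proof -
  interpret E: lower_embedding "qposet K" "cls (idt K)" "qposet H" "cls (idt H)" "along \<phi>"
    by (rule lower_embedding_along[OF \<phi>])
  have \<rho>\<theta>: "\<rho> \<cdot> \<theta> \<in> Epi C K X" by (rule Epi_comp[OF \<theta> \<rho>])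
  have assoc: "(\<rho> \<cdot> \<theta>) \<cdot> \<phi> = \<rho> \<cdot> (\<theta> \<cdot> \<phi>)"
    using Comp_assoc[OF Epi_Hom[OF \<phi>] Epi_Hom[OF \<theta>] Epi_Hom[OF \<rho>]] by simp
  have \<theta>\<phi>: "\<theta> \<cdot> \<phi> \<in> Epi C H F" by (rule Epi_comp[OF \<phi> \<theta>])
  note [simp] = cls_carrier[OF \<phi>] cls_carrier[OF \<theta>] cls_carrier[OF \<rho>\<theta>] cls_carrier[OF \<theta>\<phi>]
  define b where "b = cls (\<rho> \<cdot> (\<theta> \<cdot> \<phi>))"
  have b: "along \<phi> (cls (\<rho> \<cdot> \<theta>)) = b" using along_cls[OF \<phi> \<rho>\<theta>] assoc by (simp add: b_def)
  have c: "along \<phi> (cls \<theta>) = cls (\<theta> \<cdot> \<phi>)" by (rule along_cls[OF \<phi> \<theta>])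
  have q: "along \<phi> (cls (idt K)) = cls \<phi>" by (rule along_Ident[OF \<phi>])
  have bc [simp]: "b \<in> carrier (qposet H)" using b E.closed by fastforce
  have le: "cls (\<theta> \<cdot> \<phi>) \<sqsubseteq>\<^bsub>qposet H\<^esub> cls \<phi>" using E.le_iff[of "cls \<theta>" "cls (idt K)"] c q by simp
  have bq: "b \<sqsubseteq>\<^bsub>qposet H\<^esub> cls \<phi>" using E.le_iff[of "cls (\<rho> \<cdot> \<theta>)" "cls (idt K)"] b q by simp
  have lc: "qloewy K i (cls (\<rho> \<cdot> \<theta>)) (cls \<theta>)" using full_loewy_along[OF \<theta> \<rho>] full by simp
  have "E.Q.loewy (Suc i) b (cls (idt H))" using fH assoc by (simp only: full_loewy_def qloewy_def b_def)
  then have "E.Q.loewy (Suc i) b (cls \<phi>)" by (rule E.Q.loewy_lower) (use bq in auto)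
  then have 1: "full_loewy (Suc i) K (\<rho> \<cdot> \<theta>)"
    using full_loewy_along[OF \<phi> \<rho>\<theta>] assoc unfolding qloewy_def b_def by metis
  have "(\<forall>y. E.P.loewy i (cls (\<rho> \<cdot> \<theta>)) y \<longrightarrow> y \<sqsubseteq>\<^bsub>qposet K\<^esub> cls \<theta>) \<longleftrightarrow>
      (\<forall>y. E.Q.loewy i b y \<longrightarrow> y \<sqsubseteq>\<^bsub>qposet H\<^esub> cls \<phi> \<longrightarrow> y \<sqsubseteq>\<^bsub>qposet H\<^esub> cls (\<theta> \<cdot> \<phi>))" (is "?l \<longleftrightarrow> ?r")
  proof
    assume l: ?l
    show ?r
    proof (intro allI impI)
      fix y assume y: "E.Q.loewy i b y" "y \<sqsubseteq>\<^bsub>qposet H\<^esub> cls \<phi>"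
      obtain x where x: "x \<in> carrier (qposet K)" "along \<phi> x = y"
        using E.lower[of "cls (idt K)" y] q y(2) E.Q.loewyD(2)[OF y(1)] by auto
      have "E.P.loewy i (cls (\<rho> \<cdot> \<theta>)) x" using E.loewy_iff[OF _ x(1), of "cls (\<rho> \<cdot> \<theta>)" i] y(1) b x(2) by simp
      then have "x \<sqsubseteq>\<^bsub>qposet K\<^esub> cls \<theta>" using l by blast
      then show "y \<sqsubseteq>\<^bsub>qposet H\<^esub> cls (\<theta> \<cdot> \<phi>)" using E.le_iff[OF x(1), of "cls \<theta>"] x(2) c by simp
    qed
  next
    assume r: ?r
    show ?l
    proof (intro allI impI)
      fix y assume y: "E.P.loewy i (cls (\<rho> \<cdot> \<theta>)) y"
      have yc: "y \<in> carrier (qposet K)" by (rule E.P.loewyD(2)[OF y])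
      have "E.Q.loewy i b (along \<phi> y)" using E.loewy_iff[OF _ yc, of "cls (\<rho> \<cdot> \<theta>)" i] y b by simp
      moreover have "along \<phi> y \<sqsubseteq>\<^bsub>qposet H\<^esub> cls \<phi>" using E.le_iff[OF yc, of "cls (idt K)"] yc q by simp
      ultimately have "along \<phi> y \<sqsubseteq>\<^bsub>qposet H\<^esub> along \<phi> (cls \<theta>)" using r c by simp
      then show "y \<sqsubseteq>\<^bsub>qposet K\<^esub> cls \<theta>" using E.le_iff[OF yc, of "cls \<theta>"] by simp
    qed
  qed
  then show ?thesis
    using 1 lc le unfolding is_socle_def E.Q.loewy_layer_def b_def[symmetric] qloewy_def
    by (simp add: E.Q.ivl_iff)
qed

abbreviation above :: "'a set \<Rightarrow> 'b \<Rightarrow> ('a \<times> 'b) set set" where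
  "above H \<tau> \<equiv> {q \<in> carrier (qposet (rep H)). cls \<tau> \<sqsubseteq>\<^bsub>qposet (rep H)\<^esub> q}"

abbreviation quotients_above :: "'a set \<times> 'b \<Rightarrow> ('a set \<times> 'b) set" where
  "quotients_above p \<equiv> {r \<in> Quot (rep (fst p)). cls (snd p) \<sqsubseteq>\<^bsub>qposet (rep (fst p))\<^esub> cls (snd r)}"

lemma sum_Quot_above:
  assumes H: "H \<in> L" and \<tau>: "\<tau> \<in> Epi C (rep H) X"
  shows "(\<Sum>r\<in>{r \<in> Quot (rep H). cls \<tau> \<sqsubseteq>\<^bsub>qposet (rep H)\<^esub> cls (snd r)}. f (cls (snd r)) / aut (fst r))
    = (\<Sum>q\<in>above H \<tau>. f q)"
proof -
  have H': "iso_class C (rep H) \<in> L" "rep H \<in> Obj C" using level_repD[OF H] H by auto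
  define f' where "f' q = (if cls \<tau> \<sqsubseteq>\<^bsub>qposet (rep H)\<^esub> q then f q else 0)" for q
  have "(\<Sum>r\<in>{r \<in> Quot (rep H). cls \<tau> \<sqsubseteq>\<^bsub>qposet (rep H)\<^esub> cls (snd r)}. f (cls (snd r)) / aut (fst r))
      = (\<Sum>(F, \<phi>)\<in>Quot (rep H). f' (cls \<phi>) / aut F)"
    by (rule sum.mono_neutral_cong_left[OF finite_Quot[OF H']]) (auto simp: f'_def split: if_splits)
  also have "\<dots> = (\<Sum>q\<in>carrier (qposet (rep H)). f' q)" by (rule sum_Quot[OF H'])
  also have "\<dots> = (\<Sum>q\<in>above H \<tau>. f q)"
    using finite_quotients[OF H'(2)] by (simp add: f'_def sum.inter_filter)
  finally show ?thesis .
qed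

lemma finite_quotients_above: "p \<in> Over X \<Longrightarrow> finite (quotients_above p)"
  using finite_Quot level_repD by (auto simp: Over_def)

text \<open>Here well-behavedness enters through \<open>Z_count\<close>: it makes the double sum over a layer absolutely
  convergent.\<close>

lemma has_sum_layer:
  assumes F: "F \<in> L" and \<rho>: "\<rho> \<in> Epi C (rep F) X" and full: "full_loewy i (rep F) \<rho>"
  shows "((\<lambda>p. if full_loewy (Suc i) (rep (fst p)) (\<rho> \<cdot> snd p) \<and>
        is_socle i (rep (fst p)) (cls (\<rho> \<cdot> snd p)) (cls (snd p))
      then partial_v (Suc i) (fst p, \<rho> \<cdot> snd p) / aut (fst p) else 0)
    has_sum partial_v i (F, \<rho>)) (Over (rep F))"
proof -
  let ?I = "Over (rep F)"
  define layer where "layer p = finite_modular_lattice.loewy_layer (qposet (rep (fst p))) (cls (idt (rep (fst p)))) i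
    (cls (\<rho> \<cdot> snd p)) (cls (snd p))" for p :: "'a set \<times> 'b"
  \<comment> \<open>For \<open>p = (H, \<tau>)\<close>, the candidate intermediate objects are the
    quotients \<open>q\<close> of \<open>H\<close> whose \<open>i\<close>-th Loewy term is the
    target of \<open>\<tau>\<close>, and \<open>H\<close> is required to have length at most
    \<open>Suc i\<close>.\<close>
  define g where "g p q = (if full_loewy (Suc i) (rep (fst p)) (\<rho> \<cdot> snd p) \<and> q \<in> layer p
    then real_of_int (moebius (qposet (rep (fst p))) q (cls (idt (rep (fst p))))) / aut (fst p) * M (fst p) else 0)" for p q
  define u where "u x = g (fst x) (cls (snd (snd x))) / aut (fst (snd x))" for x :: "('a set \<times> 'b) \<times> 'a set \<times> 'b"
  define cond where "cond p \<longleftrightarrow> full_loewy (Suc i) (rep (fst p)) (\<rho> \<cdot> snd p) \<and>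
        is_socle i (rep (fst p)) (cls (\<rho> \<cdot> snd p)) (cls (snd p))" for p :: "'a set \<times> 'b"
  define w where "w x = (if cond (fst x) then partial_summand (Suc i) (\<rho> \<cdot> snd (fst x)) (snd x) / aut (fst (fst x)) else 0)"
    for x :: "('a set \<times> 'b) \<times> 'a set \<times> 'b"
  let ?S = "SIGMA p:?I. Over (rep (fst p))"
  let ?T = "SIGMA p:?I. quotients_above p"
  let ?m = "\<lambda>(p, r). ((fst r, snd p \<cdot> snd r), (fst p, snd r)) :: ('a set \<times> 'b) \<times> 'a set \<times> 'b"

  have sums: "(\<Sum>q\<in>above H \<tau>. g (H, \<tau>) q) = partial_summand i \<rho> (H, \<tau>)"
    "(\<Sum>q\<in>above H \<tau>. \<bar>g (H, \<tau>) q\<bar>) \<le> bound (H, \<tau>)"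
    if p: "(H, \<tau>) \<in> ?I" for H \<tau>
  proof -
    have H: "H \<in> L" and \<tau>: "\<tau> \<in> Epi C (rep H) (rep F)" using p by (auto simp: Over_def)
    have HO: "rep H \<in> Obj C" using level_repD[OF H] by simp
    interpret H: finite_modular_lattice "qposet (rep H)" "cls (idt (rep H))" by (rule finite_modular_lattice_qposet[OF HO])
    have lc: "H.loewy i (cls (\<rho> \<cdot> \<tau>)) (cls \<tau>)" using full_loewy_along[OF \<tau> \<rho>] full by (simp add: qloewy_def)
    have lay: "layer (H, \<tau>) \<subseteq> above H \<tau>"
      by (auto simp: layer_def H.loewy_layer_def H.ivl_iff)
    have fin: "finite (above H \<tau>)"
      using finite_quotients[OF HO] by simp
    have mu: "mu C \<tau> = H.\<mu> (cls \<tau>) (cls (idt (rep H)))" using EpiD(1)[OF \<tau>] by (simp add: mu_def)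
    have autH: "aut H > 0" by (rule aut_pos[OF H])
    show "(\<Sum>q\<in>above H \<tau>. g (H, \<tau>) q) = partial_summand i \<rho> (H, \<tau>)"
    proof (cases "full_loewy (Suc i) (rep H) (\<rho> \<cdot> \<tau>)")
      case True
      have "(\<Sum>q\<in>above H \<tau>. g (H, \<tau>) q)
          = (\<Sum>q\<in>layer (H, \<tau>). real_of_int (H.\<mu> q (cls (idt (rep H)))) / aut H * M H)"
        by (rule sum.mono_neutral_cong_right[OF fin lay]) (auto simp: g_def True)
      also have "\<dots> = real_of_int (\<Sum>q\<in>layer (H, \<tau>). H.\<mu> q (cls (idt (rep H)))) / aut H * M H"
        by (simp add: sum_distrib_right sum_divide_distrib)
      also have "\<dots> = partial_summand i \<rho> (H, \<tau>)"
        using H.sum_moebius_loewy_layer[OF lc]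
        by (simp add: layer_def partial_summand_def summand_def full_loewy_def qloewy_def mu)
      finally show ?thesis .
    next
      case False
      then have "\<not> full_loewy i (rep H) (\<rho> \<cdot> \<tau>)"
        using H.loewy_Suc unfolding full_loewy_def qloewy_def by blast
      then show ?thesis using False by (simp add: g_def partial_summand_def)
    qed
    show "(\<Sum>q\<in>above H \<tau>. \<bar>g (H, \<tau>) q\<bar>) \<le> bound (H, \<tau>)"
    proof (cases "full_loewy (Suc i) (rep H) (\<rho> \<cdot> \<tau>)")
      case True
      have "(\<Sum>q\<in>above H \<tau>. \<bar>g (H, \<tau>) q\<bar>)
          = (\<Sum>q\<in>layer (H, \<tau>). \<bar>real_of_int (H.\<mu> q (cls (idt (rep H))))\<bar> * (\<bar>M H\<bar> / aut H))"
        using autH by (intro sum.mono_neutral_cong_right[OF fin lay]) (auto simp: g_def True abs_mult)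
      also have "\<dots> = (\<Sum>q\<in>layer (H, \<tau>). \<bar>real_of_int (H.\<mu> q (cls (idt (rep H))))\<bar>) * (\<bar>M H\<bar> / aut H)"
        by (rule sum_distrib_right[symmetric])
      also have "\<dots> \<le> (real (card (H.distributive (cls \<tau>))) ^ 3 * \<bar>real_of_int (H.\<mu> (cls \<tau>) (cls (idt (rep H))))\<bar>) * (\<bar>M H\<bar> / aut H)"
        using H.sum_abs_moebius_loewy_layer[OF lc] True autH
        by (intro mult_right_mono) (simp_all add: layer_def full_loewy_def qloewy_def)
      also have "\<dots> = bound (H, \<tau>)"
        by (simp add: bound_def Z_count_eq[OF \<tau>] mu)
      finally show ?thesis .
    qed (use autH in \<open>simp add: g_def bound_def\<close>)
  qed
  have fib: "(\<Sum>r\<in>quotients_above p. u (p, r)) = partial_summand i \<rho> p"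
    "(\<Sum>r\<in>quotients_above p. \<bar>u (p, r)\<bar>) \<le> bound p" if p: "p \<in> ?I" for p
  proof -
    obtain H \<tau> where [simp]: "p = (H, \<tau>)" by (cases p)
    have H: "H \<in> L" "\<tau> \<in> Epi C (rep H) (rep F)" using p by (auto simp: Over_def)
    show "(\<Sum>r\<in>quotients_above p. u (p, r)) = partial_summand i \<rho> p"
      using sum_Quot_above[OF H, of "g p"] sums(1)[of H \<tau>] p by (simp add: u_def)
    have "(\<Sum>r\<in>quotients_above p. \<bar>u (p, r)\<bar>) = (\<Sum>r\<in>quotients_above p. \<bar>g p (cls (snd r))\<bar> / aut (fst r))"
      by (intro sum.cong refl) (simp add: u_def aut_def)
    then show "(\<Sum>r\<in>quotients_above p. \<bar>u (p, r)\<bar>) \<le> bound p"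
      using sum_Quot_above[OF H, of "\<lambda>q. \<bar>g p q\<bar>"] sums(2)[of H \<tau>] p by simp
  qed
  have "(\<lambda>x. norm (u x)) summable_on ?T"
  proof (rule summable_on_SigmaI)
    show "((\<lambda>r. norm (u (p, r))) has_sum (\<Sum>r\<in>quotients_above p. norm (u (p, r)))) (quotients_above p)"
      if "p \<in> ?I" for p
      by (rule has_sum_finite[OF finite_quotients_above[OF that]])
    have "norm (\<Sum>r\<in>quotients_above p. norm (u (p, r))) \<le> bound p" if "p \<in> ?I" for p
      using fib(2)[OF that] by (simp add: sum_nonneg)
    then have "(\<lambda>p. norm (\<Sum>r\<in>quotients_above p. norm (u (p, r)))) summable_on ?I"
      by (rule Infinite_Sum.abs_summable_on_comparison_test'[OF summable_bound[OF F]])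
    then show "(\<lambda>p. \<Sum>r\<in>quotients_above p. norm (u (p, r))) summable_on ?I"
      by (rule abs_summable_summable)
  qed simp
  then have "u summable_on ?T" by (rule abs_summable_summable)
  then obtain s where s: "(u has_sum s) ?T" by (auto simp: summable_on_def)
  \<comment> \<open>With the composite outside, each inner sum collapses by
    \<open>sum_moebius_loewy_layer\<close>, and what is left is the series defining
    \<open>partial_v i\<close>.\<close>
  have "((\<lambda>p. partial_summand i \<rho> p) has_sum s) ?I"
  proof (rule has_sum_SigmaD[OF s])
    fix p assume p: "p \<in> ?I"
    show "((\<lambda>r. u (p, r)) has_sum partial_summand i \<rho> p) (quotients_above p)"
      using has_sum_finite[OF finite_quotients_above[OF p], of "\<lambda>r. u (p, r)"] fib(1)[OF p] by simp
  qed
  then have "s = partial_v i (F, \<rho>)" unfolding partial_v_def by (simp add: infsumI)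
  then have "((\<lambda>x. u (?m x)) has_sum partial_v i (F, \<rho>)) ?S"
    using s has_sum_reindex_bij_betw[OF bij_betw_factorizations] by blast
  moreover have "u (?m x) = w x" if x: "x \<in> ?S" for x
  proof -
    obtain K \<theta> H \<phi> where [simp]: "x = ((K, \<theta>), (H, \<phi>))" by (metis surj_pair)
    have m: "K \<in> L" "\<theta> \<in> Epi C (rep K) (rep F)" "H \<in> L" "\<phi> \<in> Epi C (rep H) (rep K)"
      using x by (auto simp: Over_def)
    have assoc: "(\<rho> \<cdot> \<theta>) \<cdot> \<phi> = \<rho> \<cdot> (\<theta> \<cdot> \<phi>)"
      using Comp_assoc[OF Epi_Hom[OF m(4)] Epi_Hom[OF m(2)] Epi_Hom[OF \<rho>]] by simp
    have mu: "mu C \<phi> = moebius (qposet (rep H)) (cls \<phi>) (cls (idt (rep H)))"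
      using EpiD(1)[OF m(4)] by (simp add: mu_def)
    show ?thesis
    proof (cases "full_loewy (Suc i) (rep H) ((\<rho> \<cdot> \<theta>) \<cdot> \<phi>)")
      case True
      then have "cond (K, \<theta>) \<longleftrightarrow> cls \<phi> \<in> layer (H, \<theta> \<cdot> \<phi>)"
        using is_socle_layer[OF m(4,2) \<rho> full] by (simp add: cond_def layer_def)
      then show ?thesis using True assoc by (simp add: u_def g_def w_def partial_summand_def summand_def mu)
    next
      case False
      then show ?thesis using assoc by (simp add: u_def g_def w_def partial_summand_def)
    qed
  qed
  ultimately have "(w has_sum partial_v i (F, \<rho>)) ?S" by (simp cong: has_sum_cong)
  \<comment> \<open>The same family, now with the intermediate object outside: each inner sum is the
    series of \<open>partial_v (Suc i)\<close> for that object.\<close>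
  then have "((\<lambda>p. if cond p then partial_v (Suc i) (fst p, \<rho> \<cdot> snd p) / aut (fst p) else 0)
    has_sum partial_v i (F, \<rho>)) ?I"
  proof (rule has_sum_SigmaD)
    fix p assume p: "p \<in> ?I"
    have "(partial_summand (Suc i) (\<rho> \<cdot> snd p) has_sum partial_v (Suc i) (fst p, \<rho> \<cdot> snd p)) (Over (rep (fst p)))"
      unfolding partial_v_def fst_conv snd_conv
      by (rule has_sum_infsum[OF summable_partial_summand]) (use p in \<open>auto simp: Over_def\<close>)
    then show "((\<lambda>r. w (p, r)) has_sum (if cond p then partial_v (Suc i) (fst p, \<rho> \<cdot> snd p) / aut (fst p) else 0)) (Over (rep (fst p)))"
      by (simp add: w_def has_sum_divide_const)
  qed
  then show ?thesis by (simp only: cond_def)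
qed

text \<open>Formally, the contribution to the moment at \<open>X\<close> of those epimorphisms onto
  \<open>X\<close> whose \<open>i\<close>-th Loewy term is of the type \<open>p\<close>; dividing by
  \<open>aut\<close> undoes the labelling by automorphisms.\<close>

definition weighted_v :: "nat \<Rightarrow> 'a set \<times> 'b \<Rightarrow> real" where
  "weighted_v i p = (if full_loewy i (rep (fst p)) (snd p) then partial_v i p / aut (fst p) else 0)"

text \<open>Each \<open>weighted_v i\<close> is expanded by \<open>has_sum_layer\<close>, and the
  pairs are regrouped by the composite. An object over \<open>X\<close> has exactly one
  \<open>i\<close>-th Loewy term, so it is counted once.\<close>

lemma has_sum_weighted_v_Suc:
  assumes S: "(weighted_v i has_sum s) (Over X)"
    and nonneg: "\<And>p. p \<in> Over X \<Longrightarrow> 0 \<le> weighted_v (Suc i) p"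
  shows "(weighted_v (Suc i) has_sum s) (Over X)"
proof -
  define w where "w x = (if full_loewy i (rep (fst (fst x))) (snd (fst x)) \<and>
      is_socle i (rep (fst (snd x))) (cls (snd (fst x) \<cdot> snd (snd x))) (cls (snd (snd x)))
    then weighted_v (Suc i) (fst (snd x), snd (fst x) \<cdot> snd (snd x)) / aut (fst (fst x)) else 0)"
    for x :: "('a set \<times> 'b) \<times> 'a set \<times> 'b"
  define u where "u x = (if is_socle i (rep (fst (fst x))) (cls (snd (fst x))) (cls (snd (snd x)))
    then weighted_v (Suc i) (fst x) else 0) / aut (fst (snd x))" for x :: "('a set \<times> 'b) \<times> 'a set \<times> 'b"
  let ?S = "SIGMA p:Over X. Over (rep (fst p))"
  let ?T = "SIGMA p:Over X. quotients_above p"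
  let ?m = "\<lambda>(p, r). ((fst r, snd p \<cdot> snd r), (fst p, snd r)) :: ('a set \<times> 'b) \<times> 'a set \<times> 'b"
  have inner: "((\<lambda>r. w (p, r)) has_sum weighted_v i p) (Over (rep (fst p)))" if p: "p \<in> Over X" for p
  proof (cases "full_loewy i (rep (fst p)) (snd p)")
    case True
    have "fst p \<in> L" "snd p \<in> Epi C (rep (fst p)) X" using p by (auto simp: Over_def)
    from has_sum_divide_const[OF has_sum_layer[OF this True], of "aut (fst p)"]
    have "((\<lambda>r. (if full_loewy (Suc i) (rep (fst r)) (snd p \<cdot> snd r) \<and>
        is_socle i (rep (fst r)) (cls (snd p \<cdot> snd r)) (cls (snd r))
      then partial_v (Suc i) (fst r, snd p \<cdot> snd r) / aut (fst r) else 0) / aut (fst p))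
      has_sum weighted_v i p) (Over (rep (fst p)))"
      using True by (simp add: weighted_v_def)
    moreover have "(if full_loewy (Suc i) (rep (fst r)) (snd p \<cdot> snd r) \<and>
        is_socle i (rep (fst r)) (cls (snd p \<cdot> snd r)) (cls (snd r))
      then partial_v (Suc i) (fst r, snd p \<cdot> snd r) / aut (fst r) else 0) / aut (fst p) = w (p, r)" for r
      using True by (simp add: w_def weighted_v_def)
    ultimately show ?thesis by simp
  next
    case False
    then show ?thesis by (simp add: w_def weighted_v_def)
  qed
  have "w summable_on ?S"
  \<comment> \<open>No absolute bound is available across different layers; nonnegativity at index
    \<open>Suc i\<close> yields summability of the double family.\<close>
  proof (rule summable_on_SigmaI[OF inner])
    show "weighted_v i summable_on Over X" using S by (rule has_sum_imp_summable)
    fix p r assume p: "p \<in> Over X" "r \<in> Over (rep (fst p))"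
    then have "(fst r, snd p \<cdot> snd r) \<in> Over X" using Epi_comp by (auto simp: Over_def)
    then show "0 \<le> w (p, r)" using nonneg by (simp add: w_def aut_def)
  qed
  then have "(w has_sum s) ?S" using has_sum_SigmaI[OF inner S] by blast
  moreover have "w x = u (?m x)" if x: "x \<in> ?S" for x
  proof -
    obtain F \<rho> H \<phi> where [simp]: "x = ((F, \<rho>), (H, \<phi>))" by (metis surj_pair)
    have m: "\<rho> \<in> Epi C (rep F) X" "\<phi> \<in> Epi C (rep H) (rep F)" using x by (auto simp: Over_def)
    have "is_socle i (rep H) (cls (\<rho> \<cdot> \<phi>)) (cls \<phi>) \<Longrightarrow> full_loewy i (rep F) \<rho>"
      using full_loewy_along[OF m(2,1)] by (simp add: is_socle_def)
    then show ?thesis by (auto simp: w_def u_def)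
  qed
  ultimately have "((\<lambda>x. u (?m x)) has_sum s) ?S" by (simp cong: has_sum_cong)
  then have "(u has_sum s) ?T" using has_sum_reindex_bij_betw[OF bij_betw_factorizations] by blast
  then show ?thesis
  proof (rule has_sum_SigmaD)
    fix p assume p: "p \<in> Over X"
    obtain H \<tau> where [simp]: "p = (H, \<tau>)" by (cases p)
    have H: "H \<in> L" "\<tau> \<in> Epi C (rep H) X" using p by (auto simp: Over_def)
    have HO: "rep H \<in> Obj C" using level_repD[OF H(1)] by simp
    interpret H: finite_modular_lattice "qposet (rep H)" "cls (idt (rep H))" by (rule finite_modular_lattice_qposet[OF HO])
    obtain s where s: "H.loewy i (cls \<tau>) s" "\<And>y. H.loewy i (cls \<tau>) y \<Longrightarrow> y \<sqsubseteq>\<^bsub>qposet (rep H)\<^esub> s"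
      using H.ex_greatest_loewy[OF cls_carrier[OF H(2)]] by blast
    \<comment> \<open>The greatest element is unique, so of all quotients above
      \<open>\<tau>\<close> only the one with class \<open>s\<close> contributes.\<close>
    have uniq: "is_socle i (rep H) (cls \<tau>) q \<longleftrightarrow> q = s" for q
      using s H.le_antisym[of q s] H.loewyD(2) unfolding is_socle_def qloewy_def by blast
    have "(\<Sum>r\<in>quotients_above p. u (p, r))
        = (\<Sum>q\<in>above H \<tau>. if q = s then weighted_v (Suc i) p else 0)"
      using sum_Quot_above[OF H, of "\<lambda>q. if q = s then weighted_v (Suc i) p else 0"] by (simp add: u_def uniq cong: if_cong)
    also have "\<dots> = weighted_v (Suc i) p"
      using H.loewyD(2,3)[OF s(1)] finite_quotients[OF HO] by simp
    finally show "((\<lambda>r. u (p, r)) has_sum weighted_v (Suc i) p) (quotients_above p)"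
      using has_sum_finite[OF finite_quotients_above[OF p], of "\<lambda>r. u (p, r)"] by simp
  qed
qed

text \<open>Length 0 means isomorphism, so only the automorphisms of \<open>rep G\<close>
  contribute: \<open>aut G\<close> equal terms, each \<open>M G / aut G\<close>. The same count
  evaluates the inner series \<open>partial_v 0\<close>.\<close>

lemma has_sum_weighted_v_0:
  assumes G: "G \<in> L"
  shows "(weighted_v 0 has_sum M G) (Over (rep G))"
proof -
  let ?B = "Pair G ` Aut C (rep G)"
  have GO: "rep G \<in> Obj C" "iso_class C (rep G) = G" using level_repD[OF G] by auto
  have full0: "full_loewy 0 Y \<tau> \<longleftrightarrow> \<tau> \<in> Iso C Y Z" if "\<tau> \<in> Epi C Y Z" for \<tau> Y Z
  proof -
    interpret finite_modular_lattice "qposet Y" "cls (idt Y)"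
      by (rule finite_modular_lattice_qposet) (use EpiD[OF that] in simp)
    show ?thesis using cls_Ident_eq_iff[OF that] cls_carrier[OF that] by (auto simp: full_loewy_def qloewy_def)
  qed
  have isoG: "H = G" if "H \<in> L" "\<tau> \<in> Iso C (rep H) (rep G)" for H \<tau>
    using iso_class_eq_iff[of "rep H" "rep G"] that level_repD[OF that(1)] GO by auto
  have finB: "finite ?B" using finite_AutD[OF GO(1)] by simp
  have BO: "?B \<subseteq> Over (rep G)" using G Iso_Epi by (auto simp: Over_def Aut_def)
  have cardB: "real (card ?B) = aut G" by (simp add: aut_def card_image inj_on_def)
  have v: "partial_v 0 (G, \<rho>) = M G" if \<rho>: "\<rho> \<in> Aut C (rep G)" for \<rho>
  proof -
    have \<rho>i: "\<rho> \<in> Iso C (rep G) (rep G)" using \<rho> by (simp add: Aut_def)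
    obtain \<rho>' where \<rho>': "\<rho>' \<in> Iso C (rep G) (rep G)" "\<rho>' \<cdot> \<rho> = idt (rep G)" using Iso_inverse[OF \<rho>i] by blast
    have iff: "\<rho> \<cdot> \<phi> \<in> Iso C (rep H) (rep G) \<longleftrightarrow> \<phi> \<in> Iso C (rep H) (rep G)" if \<phi>: "\<phi> \<in> Epi C (rep H) (rep G)" for H \<phi>
    proof
      assume "\<rho> \<cdot> \<phi> \<in> Iso C (rep H) (rep G)"
      then have "\<rho>' \<cdot> (\<rho> \<cdot> \<phi>) \<in> Iso C (rep H) (rep G)" using Iso_comp \<rho>'(1) by blast
      moreover have "\<rho>' \<cdot> (\<rho> \<cdot> \<phi>) = \<phi>"
        using Comp_assoc[OF Epi_Hom[OF \<phi>] Iso_Hom[OF \<rho>i] Iso_Hom[OF \<rho>'(1)]] \<rho>'(2) Ident_Comp[OF Epi_Hom[OF \<phi>]] by simp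
      ultimately show "\<phi> \<in> Iso C (rep H) (rep G)" by simp
    next
      assume "\<phi> \<in> Iso C (rep H) (rep G)"
      then show "\<rho> \<cdot> \<phi> \<in> Iso C (rep H) (rep G)" using Iso_comp \<rho>i by blast
    qed
    have "(partial_summand 0 \<rho> has_sum M G) (Over (rep G))"
    proof (rule has_sum_finite_neutralI[OF finB BO])
      fix p assume p: "p \<in> Over (rep G) - ?B"
      obtain H \<phi> where [simp]: "p = (H, \<phi>)" by (cases p)
      have m: "H \<in> L" "\<phi> \<in> Epi C (rep H) (rep G)" using p by (auto simp: Over_def)
      have "\<phi> \<notin> Iso C (rep H) (rep G)" using p isoG[OF m(1)] by (auto simp: Aut_def)
      then show "partial_summand 0 \<rho> p = 0"
        using full0[OF Epi_comp[OF m(2) Iso_Epi[OF \<rho>i]]] iff[OF m(2)] by (simp add: partial_summand_def)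
    next
      have "partial_summand 0 \<rho> p = M G / aut G" if p: "p \<in> ?B" for p
      proof -
        obtain \<phi> where [simp]: "p = (G, \<phi>)" and \<phi>: "\<phi> \<in> Iso C (rep G) (rep G)" using p by (auto simp: Aut_def)
        have e: "\<phi> \<in> Epi C (rep G) (rep G)" by (rule Iso_Epi[OF \<phi>])
        interpret finite_modular_lattice "qposet (rep G)" "cls (idt (rep G))"
          by (rule finite_modular_lattice_qposet[OF GO(1)])
        have "mu C \<phi> = 1" using cls_Ident_eq_iff[OF e] \<phi> EpiD(1)[OF e] by (simp add: mu_def)
        then show ?thesis
          using full0[OF Epi_comp[OF e Iso_Epi[OF \<rho>i]]] iff[OF e] \<phi> by (simp add: partial_summand_def summand_def)
      qed
      then have "(\<Sum>p\<in>?B. partial_summand 0 \<rho> p) = real (card ?B) * (M G / aut G)" by simp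
      then show "M G = (\<Sum>p\<in>?B. partial_summand 0 \<rho> p)" using cardB aut_pos[OF G] by simp
    qed
    then show ?thesis by (simp add: partial_v_def infsumI)
  qed
  show ?thesis
  proof (rule has_sum_finite_neutralI[OF finB BO])
    fix p assume p: "p \<in> Over (rep G) - ?B"
    obtain H \<phi> where [simp]: "p = (H, \<phi>)" by (cases p)
    have m: "H \<in> L" "\<phi> \<in> Epi C (rep H) (rep G)" using p by (auto simp: Over_def)
    have "\<phi> \<notin> Iso C (rep H) (rep G)" using p isoG[OF m(1)] by (auto simp: Aut_def)
    then show "weighted_v 0 p = 0" using full0[OF m(2)] by (simp add: weighted_v_def)
  next
    have "weighted_v 0 p = M G / aut G" if p: "p \<in> ?B" for p
      using p v full0[OF Iso_Epi] by (auto simp: weighted_v_def Aut_def)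
    then have "(\<Sum>p\<in>?B. weighted_v 0 p) = real (card ?B) * (M G / aut G)" by simp
    then show "M G = (\<Sum>p\<in>?B. weighted_v 0 p)" using cardB aut_pos[OF G] by simp
  qed
qed

text \<open>At the uniform bound \<open>k\<close> every length condition holds, so
  \<open>weighted_v k\<close> is \<open>v_coeff\<close>. Two inductions run in opposite directions
  between 0 and \<open>k\<close>.\<close>

lemma has_sum_moment:
  assumes nonneg: "\<And>F. F \<in> L \<Longrightarrow> 0 \<le> v_coeff C L M F" and G: "G \<in> L"
  shows "((\<lambda>F. real (card (Epi C (rep F) (rep G))) * v_coeff C L M F) has_sum M G) L"
proof -
  obtain k where k: "L \<subseteq> loewy_classes k" using loewy_bounded by blast
  have full_k: "full_loewy k (rep H) \<tau>" if "H \<in> L" "\<tau> \<in> Epi C (rep H) X" for H \<tau> X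
    using k that level_repD[OF that(1)] loewy_classes_iff[of "rep H" k] cls_carrier[OF that(2)]
    by (auto simp: full_loewy_def)
  have wk: "weighted_v k p = v_coeff C L M (fst p)" if p: "p \<in> Over (rep G)" for p
  proof -
    obtain F \<rho> where [simp]: "p = (F, \<rho>)" by (cases p)
    have m: "F \<in> L" "\<rho> \<in> Epi C (rep F) (rep G)" using p by (auto simp: Over_def)
    have "partial_summand k \<rho> q = summand q" if "q \<in> Over (rep F)" for q
    proof -
      have "fst q \<in> L" "snd q \<in> Epi C (rep (fst q)) (rep F)" using that by (auto simp: Over_def)
      then show ?thesis using full_k[of "fst q" "\<rho> \<cdot> snd q" "rep G"] Epi_comp[OF _ m(2)]
        by (simp add: partial_summand_def)
    qed
    then have "infsum (partial_summand k \<rho>) (Over (rep F)) = infsum summand (Over (rep F))"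
      by (rule infsum_cong)
    then have "partial_v k p = infsum summand (Over (rep F))" by (simp add: partial_v_def)
    then show ?thesis
      using v_coeff_eq[OF m(1)] full_k[OF m] aut_pos[OF m(1)] by (simp add: weighted_v_def)
  qed
  \<comment> \<open>Downwards from \<open>k\<close>: by \<open>has_sum_layer\<close>,
    \<open>partial_v i\<close> is a sum of terms of index \<open>Suc i\<close>, so it inherits
    nonnegativity.\<close>
  have nn: "0 \<le> weighted_v i p" if "i \<le> k" "p \<in> Over (rep G)" for i p
    using that
  proof (induction i arbitrary: p rule: inc_induct)
    case base
    then show ?case using wk nonneg by (auto simp: Over_def)
  next
    case (step i)
    obtain F \<rho> where [simp]: "p = (F, \<rho>)" by (cases p)
    have m: "F \<in> L" "\<rho> \<in> Epi C (rep F) (rep G)" using step.prems by (auto simp: Over_def)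
    show ?case
    proof (cases "full_loewy i (rep F) \<rho>")
      case True
      have "0 \<le> partial_v i (F, \<rho>)"
      proof (rule has_sum_nonneg[OF has_sum_layer[OF m True]])
        fix r assume r: "r \<in> Over (rep F)"
        then have "(fst r, \<rho> \<cdot> snd r) \<in> Over (rep G)" using Epi_comp m(2) by (auto simp: Over_def)
        then have "0 \<le> weighted_v (Suc i) (fst r, \<rho> \<cdot> snd r)" by (rule step.IH)
        then show "0 \<le> (if full_loewy (Suc i) (rep (fst r)) (\<rho> \<cdot> snd r) \<and>
            is_socle i (rep (fst r)) (cls (\<rho> \<cdot> snd r)) (cls (snd r))
          then partial_v (Suc i) (fst r, \<rho> \<cdot> snd r) / aut (fst r) else 0)"
          by (simp add: weighted_v_def split: if_splits)
      qed
      then show ?thesis by (simp add: weighted_v_def aut_def)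
    qed (simp add: weighted_v_def)
  qed
  \<comment> \<open>Upwards from 0, where the value is \<open>M G\<close>; nonnegativity of all
    indices is already in place.\<close>
  have "(weighted_v i has_sum M G) (Over (rep G))" if "i \<le> k" for i
    using that
  proof (induction i)
    case 0
    show ?case by (rule has_sum_weighted_v_0[OF G])
  next
    case (Suc i)
    then show ?case using nn by (intro has_sum_weighted_v_Suc) auto
  qed
  then have "(weighted_v k has_sum M G) (Over (rep G))" by simp
  moreover have "(weighted_v k has_sum M G) (Over (rep G)) \<longleftrightarrow>
      ((\<lambda>p. v_coeff C L M (fst p)) has_sum M G) (Over (rep G))"
    by (rule has_sum_cong) (rule wk)
  ultimately have "((\<lambda>p. v_coeff C L M (fst p)) has_sum M G) (Over (rep G))" by simp
  then show ?thesis
    unfolding Over_def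
  proof (rule has_sum_SigmaD)
    fix F
    show "((\<lambda>\<pi>. v_coeff C L M (fst (F, \<pi>))) has_sum real (card (Epi C (rep F) (rep G))) * v_coeff C L M F) (Epi C (rep F) (rep G))"
      using has_sum_finite[OF finite_Epi, of "\<lambda>_. v_coeff C L M F"] by simp
  qed
qed

lemma existence:
  assumes nonneg: "\<And>F. F \<in> L \<Longrightarrow> 0 \<le> v_coeff C L M F"
  shows "has_moments C L M (density (count_space L) (\<lambda>F. ennreal (v_coeff C L M F)))"
    (is "has_moments C L M ?\<nu>")
proof -
  have "moment C ?\<nu> G = ereal (M G)" if G: "G \<in> L" for G
  proof -
    let ?f = "\<lambda>F. real (card (Epi C (rep F) (rep G))) * v_coeff C L M F"
    note hs = has_sum_moment[OF nonneg G]
    have f_nonneg: "0 \<le> ?f F" if "F \<in> L" for F using nonneg[OF that] by simp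
    have "(\<lambda>F. norm (?f F)) summable_on L"
      using has_sum_imp_summable[OF hs] f_nonneg by (simp cong: summable_on_cong)
    then have abs: "Infinite_Set_Sum.abs_summable_on ?f L" using abs_summable_equivalent[of ?f L] by simp
    have "(\<integral>\<^sup>+F. of_nat (card (Epi C (rep F) (rep G))) \<partial>?\<nu>)
        = (\<integral>\<^sup>+F. ennreal (v_coeff C L M F) * of_nat (card (Epi C (rep F) (rep G))) \<partial>count_space L)"
      by (subst nn_integral_density) auto
    also have "\<dots> = (\<integral>\<^sup>+F. ennreal (?f F) \<partial>count_space L)"
      using nonneg by (intro nn_integral_cong) (simp add: ennreal_of_nat_eq_real_of_nat ennreal_mult'' mult.commute)
    also have "\<dots> = ennreal (infsum ?f L)"
      using nn_integral_conv_infsetsum[OF abs f_nonneg] infsetsum_infsum[OF abs] by simp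
    also have "infsum ?f L = M G" using hs by (rule infsumI)
    finally have "(\<integral>\<^sup>+F. of_nat (card (Epi C (rep F) (rep G))) \<partial>?\<nu>) = ennreal (M G)" .
    \<comment> \<open>\<open>ennreal\<close> would truncate a negative value to 0, so the sign is
      needed to read off the moment in \<open>ereal\<close>.\<close>
    moreover have "0 \<le> M G" using has_sum_nonneg[OF hs] f_nonneg by blast
    ultimately show ?thesis by (simp add: moment_def enn2ereal_ennreal)
  qed
  then show ?thesis by (simp add: has_moments_def discrete_measure_on_def)
qed

text \<open>Robustness for a constant sequence of measures.\<close>

lemma emeasure_eq_v_coeff:
  assumes "has_moments C L M \<nu>" "F \<in> L"
  shows "enn2ereal (emeasure \<nu> {F}) = ereal (v_coeff C L M F)"
proof -
  have "(\<lambda>t :: nat. enn2ereal (emeasure \<nu> {F})) \<longlonglongrightarrow> ereal (v_coeff C L M F)"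
    by (rule robustness) (use assms in \<open>auto simp: has_moments_def\<close>)
  then show ?thesis by (simp add: LIMSEQ_const_iff)
qed

text \<open>On a countable level a measure is determined by its values on singletons, which
  \<open>emeasure_eq_v_coeff\<close> prescribes.\<close>

lemma unique_moments:
  assumes "has_moments C L M \<nu>" "has_moments C L M \<nu>'"
  shows "\<nu> = \<nu>'"
proof (rule measure_eqI_countable[of _ L])
  show "sets \<nu> = Pow L" "sets \<nu>' = Pow L"
    using assms by (auto simp: has_moments_def discrete_measure_on_def)
  fix F assume "F \<in> L"
  then have "enn2ereal (emeasure \<nu> {F}) = enn2ereal (emeasure \<nu>' {F})"
    using emeasure_eq_v_coeff assms by metis
  then show "emeasure \<nu> {F} = emeasure \<nu>' {F}" by (simp add: enn2ereal_inject)
qed (rule countable_level)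

end

theorem theorem1p6:
  fixes C :: "('o, 'm) category" and L :: "'o set set" and M :: "'o set \<Rightarrow> real"
  assumes "diamond_category C" and "level C L" and "well_behaved C L M"
  shows "((\<exists>\<nu>. has_moments C L M \<nu>) \<longleftrightarrow> (\<forall>F\<in>L. v_coeff C L M F \<ge> 0)) \<and>
    ((\<exists>\<nu>. has_moments C L M \<nu>) \<longrightarrow> (\<exists>!\<nu>. has_moments C L M \<nu>)) \<and>
    (\<forall>\<nu>. has_moments C L M \<nu> \<longrightarrow>
      (\<forall>F\<in>L. enn2ereal (emeasure \<nu> {F}) = ereal (v_coeff C L M F))) \<and>
    (\<forall>\<nu> :: nat \<Rightarrow> 'o set measure.
      (\<forall>t. discrete_measure_on L (\<nu> t)) \<and>
      (\<forall>G\<in>L. (\<lambda>t. moment C (\<nu> t) G) \<longlonglongrightarrow> ereal (M G)) \<longrightarrow>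
      (\<forall>F\<in>L. (\<lambda>t. enn2ereal (emeasure (\<nu> t) {F})) \<longlonglongrightarrow> ereal (v_coeff C L M F)))"
proof -
  interpret diamond_category C by fact
  interpret well_behaved_level C L M by unfold_locales fact+
  have "0 \<le> v_coeff C L M F" if "has_moments C L M \<nu>" "F \<in> L" for \<nu> F
    using emeasure_eq_v_coeff[OF that] enn2ereal_nonneg[of "emeasure \<nu> {F}"] by simp
  then have "(\<exists>\<nu>. has_moments C L M \<nu>) \<longleftrightarrow> (\<forall>F\<in>L. v_coeff C L M F \<ge> 0)"
    using existence by blast
  moreover have "(\<exists>\<nu>. has_moments C L M \<nu>) \<longrightarrow> (\<exists>!\<nu>. has_moments C L M \<nu>)"
    using unique_moments by blast
  ultimately show ?thesis
    by (intro conjI allI impI ballI) (blast, blast, rule emeasure_eq_v_coeff, assumption+, rule robustness, auto)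
qed

end
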